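(* Let $A\in\mathcal A_{\$}(\mathbf X)$ be a rich band-dominated operator on $\mathbf X=l^p(\mathbb Z^N,X)$. Then $$\|(A+\mathcal K(\mathbf X,\mathcal P))^{-1}\|^{-1}=\mu(A).$$
   Context: Let $N\in\mathbb N$, $p\in\{0\}\cup[1,\infty]$, and let $X\ne\{0\}$ be a complex Banach space. $\mathbf X=l^p(\mathbb Z^N,X)$ is the space of sequences $x=(x_i)_{i\in\mathbb Z^N}$, $x_i\in X$, with the usual $p$-norm for $1\le p\le\infty$; $l^0(\mathbb Z^N,X)$ denotes the closure in $l^\infty(\mathbb Z^N,X)$ of the finitely supported sequences. $\mathcal L(\mathbf X)$ is the algebra of bounded linear operators. $P_n:=\chi_{\{-n,\dots,n\}^N}I$ (multiplication by the characteristic function), $Q_n:=I-P_n$ ($n\in\mathbb N$), $\mathcal P:=(P_n)$. $\mathcal K(\mathbf X,\mathcal P):=\{K\in\mathcal L(\mathbf X):\|Q_nK\|+\|KQ_n\|\to0\}$; $\mathcal L(\mathbf X,\mathcal P):=\{A\in\mathcal L(\mathbf X): AK,KA\in\mathcal K(\mathbf X,\mathcal P)\ \forall K\in\mathcal K(\mathbf X,\mathcal P)\}$, a closed subalgebra of $\mathcal L(\mathbf X)$ containing $\mathcal K(\mathbf X,\mathcal P)$ as a closed two-sided ideal. The inverse $(A+\mathcal K(\mathbf X,\mathcal P))^{-1}$ and its norm are taken in $\mathcal L(\mathbf X,\mathcal P)/\mathcal K(\mathbf X,\mathcal P)$; convention: $\|b^{-1}\|^{-1}:=0$ if $b$ is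 not invertible. $(A_n)\subset\mathcal L(\mathbf X)$ converges $\mathcal P$-strongly to $A$ if $\|K(A_n-A)\|+\|(A_n-A)K\|\to0$ for every $K\in\mathcal K(\mathbf X,\mathcal P)$. Shifts: $(V_kx)_i=x_{i-k}$ for $k\in\mathbb Z^N$. For $A\in\mathcal L(\mathbf X,\mathcal P)$ and a sequence $h=(h_n)\subset\mathbb Z^N$ with $|h_n|\to\infty$, the limit operator $A_h$ is the $\mathcal P$-strong limit of $V_{-h_n}AV_{h_n}$, if it exists. $A$ is rich if every $h\subset\mathbb Z^N$ tending to infinity has a subsequence $g$ such that $A_g$ exists. A band operator is a finite sum $\sum_\alpha a_\alpha V_\alpha$ with $\alpha\in\mathbb Z^N$, $a_\alpha\in l^\infty(\mathbb Z^N,\mathcal L(X))$ acting by $(a_\alpha x)_i=a_\alpha(i)x_i$. $\mathcal A(\mathbf X)\subset\mathcal L(\mathbf X,\mathcal P)$ is the norm closure in $\mathcal L(\mathbf X)$ of the set of band operators; $\mathcal A_{\$}(\mathbf X)$ is the set of all rich operators in $\mathcal A(\mathbf X)$. Lower norm of an operator $B$ between Banach spaces: $\nu(B):=\inf\{\|Bx\|:\|x\|=1\}$. Put $\tilde\mu(A):=\lim_{m\to\infty}\nu(A|_{\mathrm{im}\,Q_m})$, with $A|_{\mathrm{im}\,Q_m}:\mathrm{im}\,Q_m\to\mathbf X$ (the limit exists by monotonicity), analogously $\tilde\mu(A^* ):=\lim_{m\to\infty}\nu(A^*|_{\mathrm{im}\,Q_m^*})$ on the dual space $\mathbf X^*$,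 and $\mu(A):=\min\{\tilde\mu(A),\tilde\mu(A^* )\}$. *)

theory Defs
  imports
    "HOL-Analysis.Analysis"
    "HOL-Algebra.QuotRing"
    "HOL-Library.Function_Algebras"
begin

class complex_banach = banach +
  fixes scaleC :: "complex \<Rightarrow> 'a \<Rightarrow> 'a" (infixr "*\<^sub>C" 75)
  assumes scaleC_add_right: "c *\<^sub>C (x + y) = c *\<^sub>C x + c *\<^sub>C y"
    and scaleC_add_left: "(c + d) *\<^sub>C x = c *\<^sub>C x + d *\<^sub>C x"
    and scaleC_scaleC: "c *\<^sub>C (d *\<^sub>C x) = (c * d) *\<^sub>C x"
    and scaleC_one: "1 *\<^sub>C x = x"
    and scaleR_scaleC: "r *\<^sub>R x = complex_of_real r *\<^sub>C x"
    and norm_scaleC: "norm (c *\<^sub>C x) = cmod c * norm x"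

instantiation complex :: complex_banach
begin

definition scaleC_complex :: "complex \<Rightarrow> complex \<Rightarrow> complex"
  where "scaleC_complex c x = c * x"

instance
  by standard (auto simp: scaleC_complex_def algebra_simps norm_mult scaleR_conv_of_real)

end

text \<open>
  The lattice \<open>\<int>\<^sup>N\<close> is the type \<open>int ^ 'n\<close> with \<open>N = CARD('n)\<close>. Since the exponent \<open>p\<close> is a
  variable, the space \<open>l\<^sup>p\<close> is a carrier set inside the type of all families; it is only
  meaningful for \<open>p = 0\<close> or \<open>1 \<le> p\<close> (with \<open>p = \<infinity>\<close> included). Sums and differences
  of families, and of operators, are pointwise (\<^theory>\<open>HOL-Library.Function_Algebras\<close>).
\<close>

type_synonym ('n, 'x) seq = "int ^ 'n \<Rightarrow> 'x"
type_synonym ('n, 'x) seq_op = "('n, 'x) seq \<Rightarrow> ('n, 'x) seq"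

definition linf :: "('n::finite, 'x::complex_banach) seq set"
  where "linf = {x. bounded (range x)}"

definition sup_norm :: "('n::finite, 'x::complex_banach) seq \<Rightarrow> real"
  where "sup_norm x = (SUP i. norm (x i))"

definition lp :: "ennreal \<Rightarrow> ('n::finite, 'x::complex_banach) seq set"
  where "lp p =
    (if p = 0 then {x \<in> linf. \<forall>\<epsilon>>0. \<exists>y. finite {i. y i \<noteq> 0} \<and> sup_norm (x - y) < \<epsilon>}
     else if p = \<infinity> then linf
     else {x. (\<lambda>i. norm (x i) powr enn2real p) summable_on UNIV})"

definition lp_norm :: "ennreal \<Rightarrow> ('n::finite, 'x::complex_banach) seq \<Rightarrow> real"
  where "lp_norm p x =
    (if p = 0 \<or> p = \<infinity> then sup_norm x
     else (\<Sum>\<^sub>\<infinity>i. norm (x i) powr enn2real p) powr (1 / enn2real p))"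

text \<open>
  Operators and functionals on \<open>lp p\<close> are total functions that vanish outside \<open>lp p\<close>, so that
  equality of functions is equality on \<open>lp p\<close>. This convention is stable under
  pointwise addition and under composition; concrete operators are cut down by \<open>on_lp\<close>.
\<close>

definition on_lp :: "ennreal \<Rightarrow> ('n, 'x) seq_op \<Rightarrow> ('n::finite, 'x::complex_banach) seq_op"
  where "on_lp p T = (\<lambda>x. if x \<in> lp p then T x else 0)"

definition bounded_ops :: "ennreal \<Rightarrow> ('n::finite, 'x::complex_banach) seq_op set"
  where "bounded_ops p = {T.
    (\<forall>x\<in>lp p. T x \<in> lp p) \<and>
    (\<forall>x. x \<notin> lp p \<longrightarrow> T x = 0) \<and>
    (\<forall>x\<in>lp p. \<forall>y\<in>lp p. T (x + y) = T x + T y) \<and>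
    (\<forall>c. \<forall>x\<in>lp p. T (\<lambda>i. c *\<^sub>C x i) = (\<lambda>i. c *\<^sub>C T x i)) \<and>
    (\<exists>C. \<forall>x\<in>lp p. lp_norm p (T x) \<le> C * lp_norm p x)}"

definition op_norm :: "ennreal \<Rightarrow> ('n::finite, 'x::complex_banach) seq_op \<Rightarrow> real"
  where "op_norm p T = (SUP x\<in>{x \<in> lp p. lp_norm p x \<le> 1}. lp_norm p (T x))"

definition dual :: "ennreal \<Rightarrow> (('n::finite, 'x::complex_banach) seq \<Rightarrow> complex) set"
  where "dual p = {f.
    (\<forall>x. x \<notin> lp p \<longrightarrow> f x = 0) \<and>
    (\<forall>x\<in>lp p. \<forall>y\<in>lp p. f (x + y) = f x + f y) \<and>
    (\<forall>c. \<forall>x\<in>lp p. f (\<lambda>i. c *\<^sub>C x i) = c * f x) \<and>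
    (\<exists>C. \<forall>x\<in>lp p. cmod (f x) \<le> C * lp_norm p x)}"

definition dual_norm :: "ennreal \<Rightarrow> (('n::finite, 'x::complex_banach) seq \<Rightarrow> complex) \<Rightarrow> real"
  where "dual_norm p f = (SUP x\<in>{x \<in> lp p. lp_norm p x \<le> 1}. cmod (f x))"

definition adjoint_op ::
    "('n, 'x) seq_op \<Rightarrow> (('n::finite, 'x::complex_banach) seq \<Rightarrow> complex) \<Rightarrow> ('n, 'x) seq \<Rightarrow> complex"
  where "adjoint_op T f = f \<circ> T"

text \<open>Lower norm of an operator \<open>B\<close> defined on the space \<open>E\<close>, with norms \<open>nE\<close> on
  \<open>E\<close> and \<open>nF\<close> on the target space.\<close>

definition lower_norm :: "'e set \<Rightarrow> ('e \<Rightarrow> real) \<Rightarrow> ('f \<Rightarrow> real) \<Rightarrow> ('e \<Rightarrow> 'f) \<Rightarrow> real"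
  where "lower_norm E nE nF B = (INF x\<in>{x \<in> E. nE x = 1}. nF (B x))"

definition id_op :: "ennreal \<Rightarrow> ('n::finite, 'x::complex_banach) seq_op"
  where "id_op p = on_lp p (\<lambda>x. x)"

definition P_op :: "ennreal \<Rightarrow> nat \<Rightarrow> ('n::finite, 'x::complex_banach) seq_op"
  where "P_op p n =
    on_lp p (\<lambda>x i. if \<forall>j. i $ j \<in> {- int n..int n} then x i else 0)"

definition Q_op :: "ennreal \<Rightarrow> nat \<Rightarrow> ('n::finite, 'x::complex_banach) seq_op"
  where "Q_op p n = id_op p - P_op p n"

definition K_ops :: "ennreal \<Rightarrow> ('n::finite, 'x::complex_banach) seq_op set"
  where "K_ops p = {K \<in> bounded_ops p.
    (\<lambda>n. op_norm p (Q_op p n \<circ> K) + op_norm p (K \<circ> Q_op p n)) \<longlonglongrightarrow> 0}"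

definition L_ops :: "ennreal \<Rightarrow> ('n::finite, 'x::complex_banach) seq_op set"
  where "L_ops p = {A \<in> bounded_ops p. \<forall>K\<in>K_ops p. A \<circ> K \<in> K_ops p \<and> K \<circ> A \<in> K_ops p}"

definition P_strong_lim ::
    "ennreal \<Rightarrow> (nat \<Rightarrow> ('n::finite, 'x::complex_banach) seq_op) \<Rightarrow> ('n, 'x) seq_op \<Rightarrow> bool"
  where "P_strong_lim p As A \<longleftrightarrow> A \<in> bounded_ops p \<and>
    (\<forall>K\<in>K_ops p. (\<lambda>n. op_norm p (K \<circ> (As n - A)) + op_norm p ((As n - A) \<circ> K)) \<longlonglongrightarrow> 0)"

definition L_ring :: "ennreal \<Rightarrow> ('n::finite, 'x::complex_banach) seq_op ring"
  where "L_ring p =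
    \<lparr>carrier = L_ops p, monoid.mult = (\<lambda>A B. A \<circ> B), one = id_op p,
     ring.zero = (\<lambda>x. 0), add = (\<lambda>A B. A + B)\<rparr>"

definition LK_quot :: "ennreal \<Rightarrow> ('n::finite, 'x::complex_banach) seq_op set ring"
  where "LK_quot p = FactRing (L_ring p) (K_ops p)"

definition LK_coset ::
    "ennreal \<Rightarrow> ('n::finite, 'x::complex_banach) seq_op \<Rightarrow> ('n, 'x) seq_op set"
  where "LK_coset p A = a_r_coset (L_ring p) (K_ops p) A"

definition quot_norm :: "ennreal \<Rightarrow> ('n::finite, 'x::complex_banach) seq_op set \<Rightarrow> real"
  where "quot_norm p b = (INF B\<in>b. op_norm p B)"

definition inv_norm_recip :: "ennreal \<Rightarrow> ('n::finite, 'x::complex_banach) seq_op set \<Rightarrow> real"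
  where "inv_norm_recip p b =
    (if b \<in> Units (LK_quot p) then inverse (quot_norm p (m_inv (LK_quot p) b)) else 0)"

definition shift_op :: "ennreal \<Rightarrow> int ^ 'n \<Rightarrow> ('n::finite, 'x::complex_banach) seq_op"
  where "shift_op p k = on_lp p (\<lambda>x i. x (i - k))"

definition tends_to_infinity :: "(nat \<Rightarrow> int ^ 'n::finite) \<Rightarrow> bool"
  where "tends_to_infinity h \<longleftrightarrow> filterlim (\<lambda>n. Max (range (\<lambda>j. \<bar>h n $ j\<bar>))) at_top sequentially"

definition is_limit_op ::
    "ennreal \<Rightarrow> ('n::finite, 'x::complex_banach) seq_op \<Rightarrow> (nat \<Rightarrow> int ^ 'n) \<Rightarrow> ('n, 'x) seq_op \<Rightarrow> bool"
  where "is_limit_op p A h B \<longleftrightarrow>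
    P_strong_lim p (\<lambda>n. shift_op p (- h n) \<circ> A \<circ> shift_op p (h n)) B"

definition rich :: "ennreal \<Rightarrow> ('n::finite, 'x::complex_banach) seq_op \<Rightarrow> bool"
  where "rich p A \<longleftrightarrow>
    (\<forall>h. tends_to_infinity h \<longrightarrow>
      (\<exists>r. strict_mono (r :: nat \<Rightarrow> nat) \<and> (\<exists>B. is_limit_op p A (h \<circ> r) B)))"

text \<open>Elements of \<open>l\<^sup>\<infinity>(\<int>\<^sup>N, L(X))\<close>. The library's bounded linear maps are real-linear,
  so complex homogeneity has to be demanded separately.\<close>

definition linf_coeff :: "(int ^ 'n::finite \<Rightarrow> 'x::complex_banach \<Rightarrow>\<^sub>L 'x) set"
  where "linf_coeff = {a. bounded (range a) \<and>
    (\<forall>i c x. blinfun_apply (a i) (c *\<^sub>C x) = c *\<^sub>C blinfun_apply (a i) x)}"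

definition mult_op ::
    "ennreal \<Rightarrow> (int ^ 'n \<Rightarrow> 'x \<Rightarrow>\<^sub>L 'x) \<Rightarrow> ('n::finite, 'x::complex_banach) seq_op"
  where "mult_op p a = on_lp p (\<lambda>x i. blinfun_apply (a i) (x i))"

definition band_ops :: "ennreal \<Rightarrow> ('n::finite, 'x::complex_banach) seq_op set"
  where "band_ops p = {(\<Sum>\<alpha>\<in>F. mult_op p (a \<alpha>) \<circ> shift_op p \<alpha>) | F a.
    finite F \<and> (\<forall>\<alpha>\<in>F. a \<alpha> \<in> linf_coeff)}"

definition band_dominated :: "ennreal \<Rightarrow> ('n::finite, 'x::complex_banach) seq_op set"
  where "band_dominated p =
    {A \<in> bounded_ops p. \<forall>\<epsilon>>0. \<exists>B\<in>band_ops p. op_norm p (A - B) < \<epsilon>}"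

definition rich_band_dominated :: "ennreal \<Rightarrow> ('n::finite, 'x::complex_banach) seq_op set"
  where "rich_band_dominated p = {A \<in> band_dominated p. rich p A}"

definition mu_tilde :: "ennreal \<Rightarrow> ('n::finite, 'x::complex_banach) seq_op \<Rightarrow> real"
  where "mu_tilde p A =
    lim (\<lambda>m. lower_norm (Q_op p m ` lp p) (lp_norm p) (lp_norm p) A)"

definition mu_tilde_dual :: "ennreal \<Rightarrow> ('n::finite, 'x::complex_banach) seq_op \<Rightarrow> real"
  where "mu_tilde_dual p A =
    lim (\<lambda>m. lower_norm (adjoint_op (Q_op p m) ` dual p) (dual_norm p) (dual_norm p) (adjoint_op A))"

definition mu :: "ennreal \<Rightarrow> ('n::finite, 'x::complex_banach) seq_op \<Rightarrow> real"
  where "mu p A = min (mu_tilde p A) (mu_tilde_dual p A)"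

end

theory Submission
  imports Defs
begin

text \<open>
  Suppose first that \<open>A\<close> is invertible modulo \<open>K\<close>, with \<open>B\<close> in the inverse class. Far from the origin
  \<open>x = B A x - (B A - I) x\<close> with a small second term, so \<open>A\<close> cannot shrink such an \<open>x\<close> by more than
  \<open>1 / \<parallel>B\<parallel>\<close>; the same computation with functionals bounds the dual lower norm. Conversely \<open>A B y\<close> is
  almost \<open>y\<close> for \<open>y\<close> far out, and \<open>B y\<close> is then small near the origin, so that the lower bound \<open>\<delta>\<close> of \<open>A\<close>
  at infinity gives \<open>\<parallel>B y\<parallel> \<le> (1 + \<epsilon>) \<parallel>y\<parallel> / \<delta>\<close>; since \<open>B Q\<^sub>n\<close> is in the class of \<open>B\<close>, the quotient norm is
  at most \<open>1 / \<delta>\<close>. This settles the formula for invertible classes (\<open>mu_tilde_properties\<close>,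
  \<open>mu_tilde_dual_properties\<close>, \<open>quot_norm_le\<close>). What remains, and carries the weight of the proof, is that
  \<open>\<mu>(A) > 0\<close> forces invertibility (\<open>invertible_if_mu_pos\<close>).

  The lower bound for functionals far out is dual to approximate solvability: \<open>Q\<^sub>m A x \<approx> y\<close> has a solution
  with \<open>\<parallel>x\<parallel> \<le> 2 \<parallel>y\<parallel> / \<delta>\<close> (\<open>approximately_onto\<close>, by the Hahn--Banach theorem). A band-dominated operator
  almost commutes with multiplication by slowly varying functions, so if \<open>y\<close> lives in a cube far out, the
  solution can be cut off to a larger cube (\<open>local_solution\<close>). Such solutions do not depend linearly on
  \<open>y\<close>, and the blocks \<open>X\<close> may be infinite-dimensional, so no linear selection is available directly.
  This is where richness enters. A limit operator inherits the lower bound as well as the approximate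
  solvability; being bounded below it has exact, unique and hence linear solutions for finitely supported
  data (\<open>finite_closure_onto\<close>, \<open>solve\<close>). Restricting to finitely supported data treats all exponents alike,
  although these data are not dense when \<open>p = \<infinity>\<close>. A compactness argument carries the solution maps back
  to \<open>A\<close>: outside some bounded set every cube of a given size has a linear approximate right inverse of
  \<open>A\<close>, with uniform bounds (\<open>local_inverses\<close>).

  These local inverses are patched over a tiling of the lattice. Tiles of one colour are so far apart
  that the pieces do not interact (\<open>patch_one_colour\<close>), and \<open>3\<^sup>N\<close> colours suffice, a number that does not
  depend on the size of the cubes; hence the total error can be made at most \<open>1/2\<close> and removed by a Neumann
  series (\<open>right_parametrix\<close>). A right inverse modulo \<open>K\<close> is a left inverse as well, because \<open>A\<close> is bounded
  below at infinity (\<open>K_if_comp_K\<close>).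
\<close>

section \<open>The complex Hahn--Banach theorem\<close>

locale complex_subspace = vector_space scale
  for scale :: "complex \<Rightarrow> 'v::ab_group_add \<Rightarrow> 'v" +
  fixes V :: "'v set"
  assumes subspace: "subspace V"
begin

text \<open>
  Functionals are set to \<open>0\<close> outside \<open>V\<close>, so that pointwise comparison on all of the type is
  antisymmetric and minimal elements can be compared by equality.
\<close>

definition sublinear :: "('v \<Rightarrow> real) \<Rightarrow> bool"
  where "sublinear s \<longleftrightarrow> (\<forall>x\<in>V. \<forall>y\<in>V. s (x + y) \<le> s x + s y) \<and>
    (\<forall>t::real. \<forall>x\<in>V. t > 0 \<longrightarrow> s (scale t x) = t * s x) \<and> s 0 = 0 \<and> (\<forall>x. x \<notin> V \<longrightarrow> s x = 0)"

text \<open>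
  The largest sublinear functional below \<open>s\<close> that agrees with \<open>s\<close> at \<open>v\<close> and is additive in that
  direction. It serves twice: a minimal sublinear functional equals all of its lowerings and is
  therefore linear, and lowering the dominating functional at \<open>y\<close> first makes the linear functional
  found below it attain its bound at \<open>y\<close>.
\<close>

definition lowered :: "('v \<Rightarrow> real) \<Rightarrow> 'v \<Rightarrow> 'v \<Rightarrow> real"
  where "lowered s v x = (if x \<in> V then INF t\<in>{0::real..}. s (x + scale t v) - t * s v else 0)"

lemma sublinear_scale:
  assumes "sublinear s" "x \<in> V" "t \<ge> (0::real)"
  shows "s (scale t x) = t * s x"
  using assms unfolding sublinear_def by (cases "t = 0") auto

text \<open>
  Subadditivity at \<open>t v = (x + t v) - x\<close>; this is what keeps the infimum in the lowering finite.
\<close>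

lemma lowered_bdd:
  assumes s: "sublinear s" and x: "x \<in> V" and v: "v \<in> V" and t: "t \<ge> 0"
  shows "- s (- x) \<le> s (x + scale (of_real t) v) - t * s v"
proof -
  have tv: "scale (of_real t) v \<in> V" using v subspace subspace_scale by blast
  have "s ((x + scale (of_real t) v) + (-x)) \<le> s (x + scale (of_real t) v) + s (-x)"
    using s x tv subspace subspace_add subspace_neg unfolding sublinear_def by blast
  moreover have "s (scale (of_real t) v) = t * s v"
    using sublinear_scale[OF s v t] by simp
  ultimately show ?thesis by simp
qed

lemma lowered_le_term:
  assumes "sublinear s" "x \<in> V" "v \<in> V" "t \<ge> 0"
  shows "lowered s v x \<le> s (x + scale (of_real t) v) - t * s v"
  unfolding lowered_def using assms lowered_bdd[OF assms(1-3)]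
  by (auto intro!: cINF_lower bdd_belowI2[where m = "- s (- x)"])

lemma lowered_greatest:
  assumes "x \<in> V" "\<And>t. t \<ge> 0 \<Longrightarrow> m \<le> s (x + scale (of_real t) v) - t * s v"
  shows "m \<le> lowered s v x"
  unfolding lowered_def using assms by (auto intro!: cINF_greatest)

lemma lowered_le:
  assumes "sublinear s" "x \<in> V" "v \<in> V"
  shows "lowered s v x \<le> s x"
  using lowered_le_term[OF assms, of 0] by simp

lemma lowered_neg:
  assumes "sublinear s" "v \<in> V"
  shows "lowered s v (- v) \<le> - s v"
proof -
  have "-v \<in> V" using assms subspace subspace_neg by blast
  then show ?thesis
    using lowered_le_term[OF assms(1) _ assms(2), of "- v" 1] assms unfolding sublinear_def by simp
qed

lemma lowered_sublinear:
  assumes s: "sublinear s" and v: "v \<in> V"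
  shows "sublinear (lowered s v)"
  unfolding sublinear_def
proof (intro conjI ballI allI impI)
  note [simp] = subspace_add[OF subspace] subspace_scale[OF subspace]
  fix x y assume x: "x \<in> V" and y: "y \<in> V"
  have "lowered s v (x + y) - (s (x + scale (of_real t) v) - t * s v) \<le> s (y + scale (of_real u) v) - u * s v"
    if t: "t \<ge> 0" and u: "u \<ge> 0" for t u
  proof -
    have "lowered s v (x + y) \<le> s ((x + y) + scale (of_real (t + u)) v) - (t + u) * s v"
      using lowered_le_term[OF s _ v, of "x + y" "t + u"] x y t u by simp
    also have "(x + y) + scale (of_real (t + u)) v = (x + scale (of_real t) v) + (y + scale (of_real u) v)"
      by (simp add: scale_left_distrib algebra_simps)
    also have "s \<dots> \<le> s (x + scale (of_real t) v) + s (y + scale (of_real u) v)"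
      using s x y v unfolding sublinear_def by simp
    finally show ?thesis by (simp add: algebra_simps)
  qed
  then have "lowered s v (x + y) - (s (x + scale (of_real t) v) - t * s v) \<le> lowered s v y" if "t \<ge> 0" for t
    using that y by (intro lowered_greatest) auto
  then have "lowered s v (x + y) - lowered s v y \<le> s (x + scale (of_real t) v) - t * s v" if "t \<ge> 0" for t
    using that by (simp add: algebra_simps)
  then have "lowered s v (x + y) - lowered s v y \<le> lowered s v x"
    using x by (intro lowered_greatest) auto
  then show "lowered s v (x + y) \<le> lowered s v x + lowered s v y" by simp
next
  have *: "t * lowered s v x \<le> lowered s v (scale (of_real t) x)" if x: "x \<in> V" and t: "t > 0" for x t
  proof (rule lowered_greatest)
    show "scale (of_real t) x \<in> V" using x subspace subspace_scale by blast
    fix u :: real assume u: "u \<ge> 0"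
    have uv: "x + scale (of_real (u / t)) v \<in> V"
      using x v subspace subspace_scale subspace_add by blast
    have "t * lowered s v x \<le> t * (s (x + scale (of_real (u / t)) v) - u / t * s v)"
      using lowered_le_term[OF s x v, of "u / t"] u t by simp
    also have "\<dots> = t * s (x + scale (of_real (u / t)) v) - u * s v"
      using t by (simp add: algebra_simps)
    also have "t * s (x + scale (of_real (u / t)) v) = s (scale (of_real t) (x + scale (of_real (u / t)) v))"
      using sublinear_scale[OF s uv, of t] t by simp
    also have "scale (of_real t) (x + scale (of_real (u / t)) v) = scale (of_real t) x + scale (of_real u) v"
      using t by (simp add: scale_right_distrib)
    finally show "t * lowered s v x \<le> s (scale (of_real t) x + scale (of_real u) v) - u * s v" .
  qed
  fix t :: real and x assume x: "x \<in> V" and t: "t > 0"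
  have tx: "scale (of_real t) x \<in> V" using x subspace subspace_scale by blast
  have "(1/t) * lowered s v (scale (of_real t) x) \<le> lowered s v x"
    using *[OF tx, of "1/t"] t by simp
  then have "lowered s v (scale (of_real t) x) \<le> t * lowered s v x"
    using t by (simp add: field_simps)
  with *[OF x t] show "lowered s v (scale (of_real t) x) = t * lowered s v x" by simp
next
  have z: "0 \<in> V" using subspace subspace_0 by blast
  have s0: "s 0 = 0" using s unfolding sublinear_def by simp
  have "0 \<le> lowered s v 0"
    using lowered_greatest[OF z, of 0 s v] sublinear_scale[OF s v] by simp
  then show "lowered s v 0 = 0" using lowered_le[OF s z v] s0 by simp
next
  fix x assume "x \<notin> V"
  then show "lowered s v x = 0" by (simp add: lowered_def)
qed

text \<open>
  Zorn's lemma. The pointwise infimum of a chain is again sublinear because two members can be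
  replaced by the smaller one, and it is finite because \<open>s x \<ge> - q (- x)\<close> for each member.
\<close>

lemma exists_minimal_sublinear:
  assumes q: "sublinear q"
  obtains s where "sublinear s" "\<And>x. s x \<le> q x"
    "\<And>s'. sublinear s' \<Longrightarrow> (\<And>x. s' x \<le> s x) \<Longrightarrow> s' = s"
proof -
  define S where "S = {s. sublinear s \<and> (\<forall>x. s x \<le> q x)}"
  define P :: "('v \<Rightarrow> real) \<Rightarrow> ('v \<Rightarrow> real) \<Rightarrow> bool" where "P = (\<lambda>s s'. \<forall>x. s' x \<le> s x)"
  have po: "partial_order_on S (relation_of P S)"
  proof (rule partial_order_on_relation_ofI)
    fix a b c assume "P a b" "P b c"
    then show "P a c" unfolding P_def by (meson order_trans)
  next
    fix a b assume "P a b" "P b a"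
    then show "a = b" unfolding P_def by (meson antisym ext)
  qed (simp add: P_def)
  have "\<exists>u\<in>S. \<forall>a\<in>C. P a u" if C: "C \<in> Chains (relation_of P S)" for C
  proof (cases "C = {}")
    case True
    then show ?thesis using q unfolding S_def by auto
  next
    case False
    have CS: "C \<subseteq> S" and tot: "\<And>a b. a \<in> C \<Longrightarrow> b \<in> C \<Longrightarrow> P a b \<or> P b a"
      using C unfolding Chains_def relation_of_def by auto
    have lower: "- q (- x) \<le> s x" if "x \<in> V" "s \<in> C" for x s
    proof -
      have s: "sublinear s" "s (- x) \<le> q (- x)" using CS that unfolding S_def by auto
      have "- x \<in> V" using that subspace subspace_neg by blast
      then have "s (x + - x) \<le> s x + s (- x)" using s that unfolding sublinear_def by blast
      then show ?thesis using s unfolding sublinear_def by simp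
    qed
    have lower': "\<exists>m. \<forall>s\<in>C. m \<le> s x" for x
    proof (cases "x \<in> V")
      case False
      then have "\<forall>s\<in>C. s x = 0" using CS unfolding S_def sublinear_def by blast
      then show ?thesis by (metis order_refl)
    qed (use lower in blast)
    have bdd: "bdd_below ((\<lambda>s. s x) ` C)" for x
      using lower'[of x] by (auto simp: bdd_below_def)
    define u where "u x = (INF s\<in>C. s x)" for x
    have ule: "u x \<le> s x" if "s \<in> C" for s x
      unfolding u_def using bdd that by (rule cINF_lower)
    have ug: "m \<le> u x" if "\<And>s. s \<in> C \<Longrightarrow> m \<le> s x" for m x
      unfolding u_def using False that by (rule cINF_greatest)
    have "sublinear u" unfolding sublinear_def
    proof (intro conjI ballI allI impI)
      fix x y assume x: "x \<in> V" and y: "y \<in> V"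
      have "u (x + y) - s x \<le> s' y" if s: "s \<in> C" and s': "s' \<in> C" for s s'
      proof -
        have "\<exists>w\<in>C. w x \<le> s x \<and> w y \<le> s' y" using tot[OF s s'] s s' unfolding P_def by auto
        then obtain w where w: "w \<in> C" "w x \<le> s x" "w y \<le> s' y" by blast
        have "w (x + y) \<le> w x + w y"
          using w(1) CS x y unfolding S_def sublinear_def by blast
        then show ?thesis using ule[OF w(1), of "x + y"] w by linarith
      qed
      then have "u (x + y) - s x \<le> u y" if "s \<in> C" for s using that by (intro ug) auto
      then have "u (x + y) - u y \<le> s x" if "s \<in> C" for s using that by (simp add: algebra_simps)
      then have "u (x + y) - u y \<le> u x" by (intro ug)
      then show "u (x + y) \<le> u x + u y" by simp
    next
      fix t :: real and x assume x: "x \<in> V" and t: "t > 0"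
      have eq: "s (scale (of_real t) x) = t * s x" if "s \<in> C" for s
        using that CS x t unfolding S_def sublinear_def by blast
      have "t * u x \<le> u (scale (of_real t) x)" using ule t by (intro ug) (simp add: eq)
      moreover have "u (scale (of_real t) x) / t \<le> u x"
        using ule[of _ "scale (of_real t) x"] t by (intro ug) (simp add: eq field_simps)
      ultimately show "u (scale (of_real t) x) = t * u x" using t by (simp add: field_simps)
    next
      have "s 0 = 0" if "s \<in> C" for s using that CS unfolding S_def sublinear_def by blast
      moreover obtain s where "s \<in> C" using False by blast
      ultimately show "u 0 = 0" using ule[of s 0] ug[of 0 0] by force
    next
      fix x assume "x \<notin> V"
      then have "s x = 0" if "s \<in> C" for s using that CS unfolding S_def sublinear_def by blast
      moreover obtain s where "s \<in> C" using False by blast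
      ultimately show "u x = 0" using ule[of s x] ug[of 0 x] by force
    qed
    moreover have "u x \<le> q x" for x
    proof -
      obtain s where "s \<in> C" using False by blast
      then show ?thesis using ule[of s x] CS unfolding S_def by (auto intro: order_trans)
    qed
    ultimately have "u \<in> S" unfolding S_def by simp
    then show ?thesis using ule unfolding P_def by blast
  qed
  from predicate_Zorn[OF po this] obtain s where s: "s \<in> S" "\<forall>a\<in>S. P s a \<longrightarrow> a = s" by blast
  show ?thesis
  proof (rule that[of s])
    fix s' assume s': "sublinear s'" "\<And>x. s' x \<le> s x"
    then have "s' \<in> S" using s(1) unfolding S_def by (auto intro: order_trans)
    then show "s' = s" using s(2) s' unfolding P_def by blast
  qed (use s in \<open>auto simp: S_def\<close>)
qed

text \<open>
  A minimal sublinear functional satisfies \<open>s (- v) \<le> - s v\<close> for every \<open>v\<close>, so it is odd, and an odd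
  sublinear functional is linear.
\<close>

lemma dominated_real_functional:
  assumes q: "sublinear q" and y: "y \<in> V"
  obtains s :: "'v \<Rightarrow> real" where "\<And>x z. x \<in> V \<Longrightarrow> z \<in> V \<Longrightarrow> s (x + z) = s x + s z"
    "\<And>t::real. \<And>x. x \<in> V \<Longrightarrow> s (scale t x) = t * s x"
    "\<And>x. x \<in> V \<Longrightarrow> s x \<le> q x" "s y = q y"
proof -
  note neg = subspace_neg[OF subspace] and add = subspace_add[OF subspace]
  obtain s where s: "sublinear s" "\<And>x. s x \<le> lowered q y x"
      and min: "\<And>s'. sublinear s' \<Longrightarrow> (\<And>x. s' x \<le> s x) \<Longrightarrow> s' = s"
    using exists_minimal_sublinear[OF lowered_sublinear[OF q y]] by blast
  have s0: "s 0 = 0" and sub: "\<And>x z. x \<in> V \<Longrightarrow> z \<in> V \<Longrightarrow> s (x + z) \<le> s x + s z"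
    using s(1) unfolding sublinear_def by auto
  have sneg: "s (- v) = - s v" if v: "v \<in> V" for v
  proof -
    have "lowered s v x \<le> s x" for x
    proof (cases "x \<in> V")
      case False
      then show ?thesis using s(1) unfolding lowered_def sublinear_def by simp
    qed (use lowered_le[OF s(1) _ v] in blast)
    then have "lowered s v = s" using min lowered_sublinear[OF s(1) v] by blast
    then have "s (- v) \<le> - s v" using lowered_neg[OF s(1) v] by simp
    moreover have "s (v + - v) \<le> s v + s (- v)" using sub v neg by blast
    ultimately show ?thesis using s0 by simp
  qed
  have sle: "s x \<le> q x" if "x \<in> V" for x
    using order_trans[OF s(2) lowered_le[OF q that y]] .
  show ?thesis
  proof (rule that[of s])
    fix x z assume x: "x \<in> V" and z: "z \<in> V"
    have "s ((x + z) + - z) \<le> s (x + z) + s (- z)" using sub add neg x z by blast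
    then show "s (x + z) = s x + s z" using sub[OF x z] sneg[OF z] by simp
  next
    fix t :: real and x assume x: "x \<in> V"
    show "s (scale t x) = t * s x"
    proof (cases "t \<ge> 0")
      case True
      then show ?thesis using sublinear_scale[OF s(1) x] by simp
    next
      case False
      have "s (scale (of_real (- t)) (- x)) = (- t) * s (- x)"
        using sublinear_scale[OF s(1) neg[OF x], of "- t"] False by simp
      then show ?thesis using sneg[OF x] by simp
    qed
  next
    have "s (- y) \<le> - q y" using s(2)[of "- y"] lowered_neg[OF q y] by linarith
    then show "s y = q y" using sneg[OF y] sle[OF y] by simp
  qed (rule sle)
qed

text \<open>
  The usual complexification of the real functional; the modulus is estimated after rotating the
  argument so that the value becomes real and nonnegative.
\<close>

theorem complex_Hahn_Banach:
  fixes q :: "'v \<Rightarrow> real"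
  assumes tri: "\<And>x y. x \<in> V \<Longrightarrow> y \<in> V \<Longrightarrow> q (x + y) \<le> q x + q y"
    and hom: "\<And>c x. x \<in> V \<Longrightarrow> q (scale c x) = cmod c * q x"
    and y: "y \<in> V"
  obtains f :: "'v \<Rightarrow> complex" where "\<And>x z. x \<in> V \<Longrightarrow> z \<in> V \<Longrightarrow> f (x + z) = f x + f z"
    "\<And>c x. x \<in> V \<Longrightarrow> f (scale c x) = c * f x"
    "\<And>x. x \<in> V \<Longrightarrow> cmod (f x) \<le> q x" "f y = complex_of_real (q y)"
proof -
  note neg = subspace_neg[OF subspace] and add = subspace_add[OF subspace]
    and scl = subspace_scale[OF subspace]
  define q' where "q' x = (if x \<in> V then q x else 0)" for x
  have "q 0 = 0" using hom[OF y, of 0] by simp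
  then have q': "sublinear q'" unfolding sublinear_def q'_def
    using tri add scl hom[of _ "of_real _"] by auto
  obtain u :: "'v \<Rightarrow> real" where u_add: "\<And>x z. x \<in> V \<Longrightarrow> z \<in> V \<Longrightarrow> u (x + z) = u x + u z"
    and u_scl: "\<And>t::real. \<And>x. x \<in> V \<Longrightarrow> u (scale t x) = t * u x"
    and u_le: "\<And>x. x \<in> V \<Longrightarrow> u x \<le> q x" and u_y: "u y = q y"
  proof -
    obtain s :: "'v \<Rightarrow> real" where s: "\<And>x z. x \<in> V \<Longrightarrow> z \<in> V \<Longrightarrow> s (x + z) = s x + s z"
      "\<And>t::real. \<And>x. x \<in> V \<Longrightarrow> s (scale t x) = t * s x"
      "\<And>x. x \<in> V \<Longrightarrow> s x \<le> q' x" "s y = q' y"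
      using dominated_real_functional[OF q' y] by blast
    show ?thesis by (rule that[of s]) (use s y in \<open>auto simp: q'_def\<close>)
  qed
  define f where "f x = Complex (u x) (- u (scale \<i> x))" for x
  have f_add: "f (x + z) = f x + f z" if "x \<in> V" "z \<in> V" for x z
    using that u_add scl unfolding f_def by (simp add: scale_right_distrib complex_eq_iff)
  have f_scl: "f (scale c x) = c * f x" if x: "x \<in> V" for c x
  proof -
    have comb: "u (scale c x) = Re c * u x + Im c * u (scale \<i> x)" for c
    proof -
      have "scale c x = scale (of_real (Re c)) x + scale (of_real (Im c)) (scale \<i> x)"
        by (simp add: scale_left_distrib[symmetric] mult.commute complex_eq[symmetric])
      also have "u \<dots> = u (scale (of_real (Re c)) x) + u (scale (of_real (Im c)) (scale \<i> x))"
        by (rule u_add) (use scl x in blast)+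
      also have "\<dots> = Re c * u x + Im c * u (scale \<i> x)"
        using u_scl[OF x] u_scl[OF scl[OF x]] by presburger
      finally show ?thesis .
    qed
    show ?thesis using comb[of c] comb[of "\<i> * c"] unfolding f_def
      by (simp add: complex_eq_iff)
  qed
  have f_le: "cmod (f x) \<le> q x" if x: "x \<in> V" for x
  proof (cases "f x = 0")
    case True
    have "0 \<le> q x"
    proof -
      have "q (x + - x) \<le> q x + q (- x)" using tri x neg by blast
      moreover have "q (scale (- 1) x) = cmod (- 1) * q x" using hom[OF x] .
      ultimately show ?thesis using \<open>q 0 = 0\<close> by simp
    qed
    then show ?thesis using True by simp
  next
    case False
    define c where "c = cnj (f x) / cmod (f x)"
    have "cmod c = 1" using False unfolding c_def by (simp add: norm_divide)
    have "c * f x = cmod (f x)"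
      using False unfolding c_def by (simp add: complex_norm_square[symmetric] power2_eq_square mult.commute)
    then have "cmod (f x) = Re (f (scale c x))" using f_scl[OF x] by simp
    also have "\<dots> = u (scale c x)" unfolding f_def by simp
    also have "\<dots> \<le> q x" using u_le[OF scl[OF x], of c] hom[OF x, of c] \<open>cmod c = 1\<close> by (metis mult_1)
    finally show ?thesis .
  qed
  have "Re (f y) = q y" using u_y unfolding f_def by simp
  moreover have "cmod (f y) \<le> q y" using f_le y by blast
  moreover have "(cmod (f y))\<^sup>2 = (Re (f y))\<^sup>2 + (Im (f y))\<^sup>2" by (rule cmod_power2)
  ultimately have "Im (f y) = 0"
    
    using power_mono[of "cmod (f y)" "q y" 2] by simp
  then have "f y = complex_of_real (q y)" using \<open>Re (f y) = q y\<close> by (simp add: complex_eq_iff)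
  then show ?thesis using that f_add f_scl f_le by blast
qed

end

section \<open>The spaces \<open>l\<^sup>p\<close>\<close>

lemma powr_convex_combination:
  assumes "r \<ge> 1" "0 \<le> u" "0 \<le> w" "0 \<le> a" "0 \<le> b" "a + b = (1::real)"
  shows "(a * u + b * w) powr r \<le> a * u powr r + b * w powr r"
proof -
  have contract: "(a * u) powr r \<le> a * u powr r" if "0 \<le> a" "a \<le> 1" "0 \<le> u" for a u :: real
  proof -
    have "a powr r \<le> a powr 1" using powr_mono'[of 1 r a] that assms(1) by simp
    then show ?thesis using that by (simp add: powr_mult mult_right_mono)
  qed
  show ?thesis
  proof (cases "u = 0 \<or> w = 0")
    case True
    then show ?thesis using contract[of a u] contract[of b w] assms by auto
  next
    case False
    have "((1 - a) *\<^sub>R w + a *\<^sub>R u) powr r \<le> (1 - a) * w powr r + a * u powr r"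
      by (rule convex_onD[OF powr_convex[OF assms(1)]]) (use assms False in auto)
    moreover have "1 - a = b" using assms by simp
    ultimately show ?thesis by (simp add: add.commute)
  qed
qed

text \<open>
  With \<open>\<lambda> = C / (C + D)\<close>, each term \<open>(a + b) / (C + D)\<close> is the convex combination of \<open>a / C\<close> and \<open>b / D\<close>
  with weights \<open>\<lambda>\<close> and \<open>1 - \<lambda>\<close>; sum the convexity inequality.
\<close>

lemma minkowski_finite:
  fixes a b :: "'i \<Rightarrow> real"
  assumes r: "r \<ge> 1" and F: "finite F" and nn: "\<And>i. 0 \<le> a i" "\<And>i. 0 \<le> b i"
    and C: "0 \<le> C" "(\<Sum>i\<in>F. a i powr r) \<le> C powr r"
    and D: "0 \<le> D" "(\<Sum>i\<in>F. b i powr r) \<le> D powr r"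
  shows "(\<Sum>i\<in>F. (a i + b i) powr r) \<le> (C + D) powr r"
proof -
  have zero: "\<forall>i\<in>F. c i = 0" if "(\<Sum>i\<in>F. c i powr r) \<le> 0 powr r" "\<And>i. 0 \<le> c i" for c :: "'i \<Rightarrow> real"
  proof -
    have "(\<Sum>i\<in>F. c i powr r) = 0" using that r by (intro antisym sum_nonneg) auto
    then show ?thesis using F by (subst (asm) sum_nonneg_eq_0_iff) auto
  qed
  show ?thesis
  proof (cases "C = 0 \<or> D = 0")
    case True
    then show ?thesis using zero[of a] zero[of b] nn C D by auto
  next
    case False
    then have pos: "C > 0" "D > 0" using C D by auto
    define s where "s = C + D"
    have s: "s > 0" using pos s_def by simp
    have *: "(a i + b i) powr r \<le> s powr r * (C / s * (a i / C) powr r + D / s * (b i / D) powr r)" for i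
    proof -
      have "a i + b i = s * (C / s * (a i / C) + D / s * (b i / D))"
        using pos s by (simp add: field_simps)
      also have "\<dots> powr r = s powr r * (C / s * (a i / C) + D / s * (b i / D)) powr r"
        by (rule powr_mult)
      also have "\<dots> \<le> s powr r * (C / s * (a i / C) powr r + D / s * (b i / D) powr r)"
        using pos s nn r
        by (intro mult_left_mono powr_convex_combination) (auto simp: s_def add_divide_distrib[symmetric])
      finally show ?thesis .
    qed
    have "(\<Sum>i\<in>F. (a i + b i) powr r) \<le> (\<Sum>i\<in>F. s powr r * (C / s * (a i / C) powr r + D / s * (b i / D) powr r))"
      by (intro sum_mono *)
    also have "\<dots> = s powr r * (C / s * ((\<Sum>i\<in>F. a i powr r) / C powr r) + D / s * ((\<Sum>i\<in>F. b i powr r) / D powr r))"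
    proof -
      have "(a i / C) powr r = a i powr r / C powr r" "(b i / D) powr r = b i powr r / D powr r" for i
        using pos nn by (simp_all add: powr_divide)
      then show ?thesis by (simp only: sum_distrib_left sum_divide_distrib sum.distrib distrib_left)
    qed
    also have "\<dots> \<le> s powr r * (C / s * 1 + D / s * 1)"
      using pos s C D by (intro mult_left_mono add_mono) auto
    also have "\<dots> = s powr r" using s by (simp add: s_def add_divide_distrib[symmetric])
    finally show ?thesis by (simp add: s_def)
  qed
qed

definition cscale :: "complex \<Rightarrow> ('n, 'x) seq \<Rightarrow> ('n::finite, 'x::complex_banach) seq"
  where "cscale c x = (\<lambda>i. c *\<^sub>C x i)"

definition cutoff :: "(int ^ 'n) set \<Rightarrow> ('n, 'x) seq \<Rightarrow> ('n::finite, 'x::complex_banach) seq"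
  where "cutoff F x = (\<lambda>i. if i \<in> F then x i else 0)"

lemma sum_seq_apply: "(\<Sum>k\<in>F. x k) i = (\<Sum>k\<in>F. x k i)" for x :: "'k \<Rightarrow> 'i \<Rightarrow> 'a::comm_monoid_add"
  by (induction F rule: infinite_finite_induct) auto

lemma cscale_apply [simp]: "cscale c x i = c *\<^sub>C x i" by (simp add: cscale_def)

lemma cutoff_apply: "cutoff F x i = (if i \<in> F then x i else 0)" by (simp add: cutoff_def)

lemma scaleC_zero_right [simp]: "c *\<^sub>C (0::'x::complex_banach) = 0"
  using norm_scaleC[of c "0::'x"] by simp

lemma scaleC_zero_left [simp]: "0 *\<^sub>C (x::'x::complex_banach) = 0"
  using norm_scaleC[of 0 x] by simp

lemma scaleC_minus1: "(-1) *\<^sub>C (x::'x::complex_banach) = - x"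
  using scaleC_add_left[of "-1" 1 x] by (simp add: scaleC_one eq_neg_iff_add_eq_0)

lemma cscale_vector_space: "vector_space (cscale :: complex \<Rightarrow> ('n::finite, 'x::complex_banach) seq \<Rightarrow> _)"
  by unfold_locales
    (auto simp: fun_eq_iff scaleC_add_left scaleC_add_right scaleC_scaleC scaleC_one)

text \<open>
  The condition \<open>\<parallel>x\<parallel> \<le> C\<close> expressed by finitely many coordinates at a time. It makes sense for every
  family, is stable under pointwise limits, and treats the sum norms and the supremum norm alike.
\<close>

definition lp_bounded :: "ennreal \<Rightarrow> real \<Rightarrow> ('n::finite, 'x::complex_banach) seq \<Rightarrow> bool"
  where "lp_bounded p C x \<longleftrightarrow> 0 \<le> C \<and>
    (if p = 0 \<or> p = \<infinity> then \<forall>i. norm (x i) \<le> C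
     else \<forall>F. finite F \<longrightarrow> (\<Sum>i\<in>F. norm (x i) powr enn2real p) \<le> C powr enn2real p)"

text \<open>
  The part of membership that \<open>lp_bounded\<close> does not see: for \<open>p = 0\<close> the families must vanish at
  infinity.
\<close>

definition vanishing :: "ennreal \<Rightarrow> ('n::finite, 'x::complex_banach) seq \<Rightarrow> bool"
  where "vanishing p x \<longleftrightarrow> (p = 0 \<longrightarrow> (\<forall>\<epsilon>>0. finite {i. \<epsilon> \<le> norm (x i)}))"

locale lp_exponent =
  fixes p :: ennreal
  assumes exponent: "p = 0 \<or> 1 \<le> p"
begin

lemma exponent_ge_1: "\<not> (p = 0 \<or> p = \<infinity>) \<Longrightarrow> 1 \<le> enn2real p"
  using exponent by (metis enn2real_1 enn2real_mono infinity_ennreal_def top.not_eq_extremum)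

lemma lp_bounded_nonneg: "lp_bounded p C x \<Longrightarrow> 0 \<le> C"
  unfolding lp_bounded_def by simp

lemma lp_bounded_sum: "lp_bounded p C x \<Longrightarrow> \<not> (p = 0 \<or> p = \<infinity>) \<Longrightarrow> finite F
    \<Longrightarrow> (\<Sum>i\<in>F. norm (x i) powr enn2real p) \<le> C powr enn2real p"
  unfolding lp_bounded_def by auto

lemma lp_bounded_sup: "lp_bounded p C x \<Longrightarrow> p = 0 \<or> p = \<infinity> \<Longrightarrow> norm (x i) \<le> C"
  unfolding lp_bounded_def by auto

lemma lp_bounded_coord:
  assumes "lp_bounded p C x"
  shows "norm (x i) \<le> C"
proof (cases "p = 0 \<or> p = \<infinity>")
  case False
  have "(\<Sum>j\<in>{i}. norm (x j) powr enn2real p) \<le> C powr enn2real p"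
    using lp_bounded_sum[OF assms False] by blast
  then have "norm (x i) powr enn2real p \<le> C powr enn2real p" by simp
  then show ?thesis
    using powr_less_mono2[of "enn2real p" C "norm (x i)"] exponent_ge_1[OF False] lp_bounded_nonneg[OF assms]
    by linarith
qed (use lp_bounded_sup assms in blast)

lemma lp_bounded_add:
  assumes x: "lp_bounded p C x" and y: "lp_bounded p D y"
  shows "lp_bounded p (C + D) (x + y)"
proof (cases "p = 0 \<or> p = \<infinity>")
  case True
  then show ?thesis using lp_bounded_nonneg[OF x] lp_bounded_nonneg[OF y] lp_bounded_sup[OF x] lp_bounded_sup[OF y]
    unfolding lp_bounded_def by (auto intro: norm_triangle_le add_mono)
next
  case False
  note r = exponent_ge_1[OF False]
  have "(\<Sum>i\<in>F. norm ((x + y) i) powr enn2real p) \<le> (C + D) powr enn2real p" if F: "finite F" for F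
  proof -
    have "(\<Sum>i\<in>F. norm ((x + y) i) powr enn2real p) \<le> (\<Sum>i\<in>F. (norm (x i) + norm (y i)) powr enn2real p)"
      using r by (intro sum_mono powr_mono2) (auto intro: norm_triangle_ineq)
    also have "\<dots> \<le> (C + D) powr enn2real p"
      using r F lp_bounded_nonneg[OF x] lp_bounded_nonneg[OF y] lp_bounded_sum[OF x False F] lp_bounded_sum[OF y False F]
      by (intro minkowski_finite) auto
    finally show ?thesis .
  qed
  then show ?thesis using False lp_bounded_nonneg[OF x] lp_bounded_nonneg[OF y] unfolding lp_bounded_def by auto
qed

lemma lp_bounded_mono:
  assumes x: "lp_bounded p C x" and le: "\<And>i. norm (y i) \<le> norm (x i)" and "C \<le> D"
  shows "lp_bounded p D y"
proof (cases "p = 0 \<or> p = \<infinity>")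
  case True
  have "norm (y i) \<le> D" for i
    using lp_bounded_sup[OF x True, of i] le[of i] \<open>C \<le> D\<close> by linarith
  then show ?thesis using True lp_bounded_nonneg[OF x] \<open>C \<le> D\<close> unfolding lp_bounded_def by simp
next
  case False
  have "(\<Sum>i\<in>F. norm (y i) powr enn2real p) \<le> D powr enn2real p" if F: "finite F" for F
  proof -
    have "(\<Sum>i\<in>F. norm (y i) powr enn2real p) \<le> (\<Sum>i\<in>F. norm (x i) powr enn2real p)"
      using le exponent_ge_1[OF False] by (intro sum_mono powr_mono2) auto
    also have "\<dots> \<le> C powr enn2real p" by (rule lp_bounded_sum[OF x False F])
    also have "\<dots> \<le> D powr enn2real p"
      using lp_bounded_nonneg[OF x] \<open>C \<le> D\<close> exponent_ge_1[OF False] by (intro powr_mono2) auto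
    finally show ?thesis .
  qed
  then show ?thesis using False lp_bounded_nonneg[OF x] \<open>C \<le> D\<close> unfolding lp_bounded_def by auto
qed

lemma lp_bounded_scale:
  assumes x: "lp_bounded p C x" and le: "\<And>i. norm (y i) \<le> a * norm (x i)" and a: "0 \<le> a"
  shows "lp_bounded p (a * C) y"
proof (cases "p = 0 \<or> p = \<infinity>")
  case True
  have "norm (y i) \<le> a * C" for i
    using order_trans[OF le mult_left_mono[OF lp_bounded_sup[OF x True] a]] .
  then show ?thesis using True lp_bounded_nonneg[OF x] a unfolding lp_bounded_def by simp
next
  case False
  have "(\<Sum>i\<in>F. norm (y i) powr enn2real p) \<le> (a * C) powr enn2real p" if F: "finite F" for F
  proof -
    have "(\<Sum>i\<in>F. norm (y i) powr enn2real p) \<le> (\<Sum>i\<in>F. (a * norm (x i)) powr enn2real p)"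
      using le exponent_ge_1[OF False] by (intro sum_mono powr_mono2) auto
    also have "\<dots> = a powr enn2real p * (\<Sum>i\<in>F. norm (x i) powr enn2real p)"
      using a by (simp add: powr_mult sum_distrib_left)
    also have "\<dots> \<le> a powr enn2real p * C powr enn2real p"
      by (intro mult_left_mono lp_bounded_sum[OF x False F]) auto
    also have "\<dots> = (a * C) powr enn2real p"
      using a lp_bounded_nonneg[OF x] by (simp add: powr_mult)
    finally show ?thesis .
  qed
  then show ?thesis using False lp_bounded_nonneg[OF x] a unfolding lp_bounded_def by auto
qed

text \<open>
  Only finitely many coordinates enter each inequality, so pointwise convergence is enough. Completeness
  of the spaces rests on this.
\<close>

lemma lp_bounded_limit:
  assumes "\<And>n. lp_bounded p C (x n)" and lim: "\<And>i. (\<lambda>n. x n i) \<longlonglongrightarrow> y i"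
  shows "lp_bounded p C y"
proof (cases "p = 0 \<or> p = \<infinity>")
  case True
  have "norm (y i) \<le> C" for i
    using lp_bounded_sup[OF assms(1) True] by (intro LIMSEQ_le_const2[OF tendsto_norm[OF lim]]) auto
  then show ?thesis using True lp_bounded_nonneg[OF assms(1)] unfolding lp_bounded_def by auto
next
  case False
  note r = exponent_ge_1[OF False]
  have "(\<Sum>i\<in>F. norm (y i) powr enn2real p) \<le> C powr enn2real p" if F: "finite F" for F
  proof (rule LIMSEQ_le_const2)
    show "(\<lambda>n. \<Sum>i\<in>F. norm (x n i) powr enn2real p) \<longlonglongrightarrow> (\<Sum>i\<in>F. norm (y i) powr enn2real p)"
      using r by (intro tendsto_sum tendsto_powr2 tendsto_norm lim tendsto_const) auto
  qed (use lp_bounded_sum[OF assms(1) False F] in auto)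
  then show ?thesis using False lp_bounded_nonneg[OF assms(1)] unfolding lp_bounded_def by auto
qed

lemma lp_bounded_reindex:
  assumes x: "lp_bounded p C x" and inj: "inj \<sigma>"
  shows "lp_bounded p C (\<lambda>i. x (\<sigma> i))"
proof (cases "p = 0 \<or> p = \<infinity>")
  case False
  have "(\<Sum>i\<in>F. norm (x (\<sigma> i)) powr enn2real p) \<le> C powr enn2real p" if F: "finite F" for F
  proof -
    have "(\<Sum>i\<in>F. norm (x (\<sigma> i)) powr enn2real p) = (\<Sum>i\<in>\<sigma> ` F. norm (x i) powr enn2real p)"
      using inj by (subst sum.reindex) (auto intro: inj_on_subset)
    then show ?thesis using lp_bounded_sum[OF x False, of "\<sigma> ` F"] F by simp
  qed
  then show ?thesis using False x unfolding lp_bounded_def by auto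
qed (use x in \<open>auto simp: lp_bounded_def\<close>)

text \<open>
  If \<open>y\<close> on each block \<open>B k\<close> is dominated by \<open>x\<close> on the block \<open>D k\<close>, and the \<open>D k\<close> are disjoint, then the
  blockwise estimates add up with the same constant. The blocks \<open>B k\<close> may overlap: each coordinate of
  \<open>y\<close> is charged to one of them only.
\<close>

lemma lp_bounded_blocks:
  assumes x: "lp_bounded p C x" and a: "0 \<le> a"
    and fin: "\<And>k. k \<in> K \<Longrightarrow> finite (B k)" "\<And>k. k \<in> K \<Longrightarrow> finite (D k)"
    and disj: "\<And>k l. k \<in> K \<Longrightarrow> l \<in> K \<Longrightarrow> k \<noteq> l \<Longrightarrow> D k \<inter> D l = {}"
    and supp: "\<And>i. y i \<noteq> 0 \<Longrightarrow> \<exists>k\<in>K. i \<in> B k"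
    and le: "\<And>k t. k \<in> K \<Longrightarrow> lp_bounded p t (cutoff (D k) x) \<Longrightarrow> lp_bounded p (a * t) (cutoff (B k) y)"
  shows "lp_bounded p (a * C) y"
proof -
  have cutC: "lp_bounded p C (cutoff F x)" for F
    by (rule lp_bounded_mono[OF x]) (auto simp: cutoff_apply)
  show ?thesis
  proof (cases "p = 0 \<or> p = \<infinity>")
    case True
    have "norm (y i) \<le> a * C" for i
    proof (cases "y i = 0")
      case False
      then obtain k where k: "k \<in> K" "i \<in> B k" using supp by blast
      have "norm (cutoff (B k) y i) \<le> a * C" using lp_bounded_coord[OF le[OF k(1) cutC]] .
      then show ?thesis using k by (simp add: cutoff_apply)
    qed (use a lp_bounded_nonneg[OF x] in simp)
    then show ?thesis using True a lp_bounded_nonneg[OF x] unfolding lp_bounded_def by simp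
  next
    case False
    define r where "r = enn2real p"
    have r: "r \<ge> 1" using exponent_ge_1[OF False] r_def by simp
    have "(\<Sum>i\<in>F. norm (y i) powr r) \<le> (a * C) powr r" if F: "finite F" for F
    proof -
      define F' where "F' = {i \<in> F. y i \<noteq> 0}"
      obtain \<kappa> where \<kappa>: "\<And>i. i \<in> F' \<Longrightarrow> \<kappa> i \<in> K \<and> i \<in> B (\<kappa> i)"
        using supp unfolding F'_def by (metis (mono_tags, lifting) mem_Collect_eq)
      have F': "finite F'" using F unfolding F'_def by simp
      define L where "L = \<kappa> ` F'"
      have L: "finite L" "L \<subseteq> K" using F' \<kappa> unfolding L_def by auto
      have block: "(\<Sum>i\<in>B k. norm (y i) powr r) \<le> a powr r * (\<Sum>i\<in>D k. norm (x i) powr r)"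
        if k: "k \<in> K" for k
      proof -
        define t where "t = (\<Sum>i\<in>D k. norm (x i) powr r) powr (1 / r)"
        have tr: "t powr r = (\<Sum>i\<in>D k. norm (x i) powr r)"
          unfolding t_def using r by (simp add: powr_powr sum_nonneg)
        have "(\<Sum>i\<in>F. norm (cutoff (D k) x i) powr r) \<le> t powr r" if "finite F" for F
        proof -
          have "(\<Sum>i\<in>F. norm (cutoff (D k) x i) powr r) = (\<Sum>i\<in>F \<inter> D k. norm (x i) powr r)"
            using that r by (intro sum.mono_neutral_cong_right) (auto simp: cutoff_apply)
          also have "\<dots> \<le> t powr r" unfolding tr using fin(2)[OF k] by (intro sum_mono2) auto
          finally show ?thesis .
        qed
        then have "lp_bounded p t (cutoff (D k) x)" using False unfolding lp_bounded_def r_def[symmetric] t_def by auto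
        from lp_bounded_sum[OF le[OF k this] False fin(1)[OF k]]
        have "(\<Sum>i\<in>B k. norm (y i) powr r) \<le> (a * t) powr r" by (simp add: cutoff_apply r_def)
        also have "\<dots> = a powr r * t powr r" using a unfolding t_def by (simp add: powr_mult)
        finally show ?thesis unfolding tr .
      qed
      have "(\<Sum>i\<in>F. norm (y i) powr r) = (\<Sum>i\<in>F'. norm (y i) powr r)"
        unfolding F'_def using F r by (intro sum.mono_neutral_right) auto
      also have "\<dots> = (\<Sum>k\<in>L. \<Sum>i\<in>{i \<in> F'. \<kappa> i = k}. norm (y i) powr r)"
        unfolding L_def by (rule sum.image_gen[OF F'])
      also have "\<dots> \<le> (\<Sum>k\<in>L. \<Sum>i\<in>B k. norm (y i) powr r)"
        using L fin(1) \<kappa> by (intro sum_mono sum_mono2) auto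
      also have "\<dots> \<le> (\<Sum>k\<in>L. a powr r * (\<Sum>i\<in>D k. norm (x i) powr r))"
        using L by (intro sum_mono block) auto
      also have "\<dots> = a powr r * (\<Sum>i\<in>(\<Union>k\<in>L. D k). norm (x i) powr r)"
        using L fin(2) disj by (subst sum.UNION_disjoint) (auto simp: sum_distrib_left subset_iff)
      also have "\<dots> \<le> a powr r * C powr r"
        using L fin(2) lp_bounded_sum[OF x False, of "\<Union>k\<in>L. D k"]
        by (intro mult_left_mono) (auto simp: r_def)
      also have "\<dots> = (a * C) powr r" using a lp_bounded_nonneg[OF x] by (simp add: powr_mult)
      finally show ?thesis .
    qed
    then show ?thesis using False a lp_bounded_nonneg[OF x] unfolding lp_bounded_def r_def by auto
  qed
qed

lemma sup_norm_le_iff: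
  assumes "x \<in> linf"
  shows "sup_norm x \<le> C \<longleftrightarrow> (\<forall>i. norm (x i) \<le> C)"
proof -
  have "bdd_above (range (\<lambda>i. norm (x i)))"
    using assms unfolding linf_def bounded_iff by (auto simp: bdd_above_def)
  then show ?thesis unfolding sup_norm_def by (subst cSUP_le_iff) auto
qed

lemma lp_0_iff: "x \<in> lp 0 \<longleftrightarrow> vanishing 0 x \<and> x \<in> linf"
proof
  assume x: "x \<in> lp 0"
  then have xl: "x \<in> linf" unfolding lp_def by simp
  have "finite {i. \<epsilon> \<le> norm (x i)}" if "\<epsilon> > 0" for \<epsilon>
  proof -
    obtain y where y: "finite {i. y i \<noteq> 0}" "sup_norm (x - y) < \<epsilon>"
    proof -
      have "\<forall>\<epsilon>>0. \<exists>y. finite {i. y i \<noteq> 0} \<and> sup_norm (x - y) < \<epsilon>" using x by (simp add: lp_def)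
      then show ?thesis using that \<open>\<epsilon> > 0\<close> by blast
    qed
    have "range y \<subseteq> insert 0 (y ` {i. y i \<noteq> 0})" by auto
    then have "bounded (range y)" using y(1)
      by (meson finite_imageI finite_imp_bounded finite_insert finite_subset)
    then have "x - y \<in> linf" using xl bounded_minus_comp[of x UNIV y] unfolding linf_def
      by (simp add: fun_diff_def)
    then have "norm (x i - y i) < \<epsilon>" for i
      using sup_norm_le_iff[of "x - y" "sup_norm (x - y)"] y(2) by (auto intro: le_less_trans)
    then have "{i. \<epsilon> \<le> norm (x i)} \<subseteq> {i. y i \<noteq> 0}"
      by (metis (mono_tags, lifting) Collect_mono diff_zero linorder_not_less)
    then show ?thesis using y(1) finite_subset by blast
  qed
  then show "vanishing 0 x \<and> x \<in> linf" using xl unfolding vanishing_def by simp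
next
  assume x: "vanishing 0 x \<and> x \<in> linf"
  have "\<exists>y. finite {i. y i \<noteq> 0} \<and> sup_norm (x - y) < \<epsilon>" if "\<epsilon> > 0" for \<epsilon>
  proof -
    define y where "y = cutoff {i. \<epsilon> / 2 \<le> norm (x i)} x"
    have "finite {i. \<epsilon> / 2 \<le> norm (x i)}" using x half_gt_zero[OF that] unfolding vanishing_def by blast
    then have "finite {i. y i \<noteq> 0}"
      by (rule rev_finite_subset) (auto simp: y_def cutoff_apply)
    moreover have le: "norm ((x - y) i) \<le> \<epsilon> / 2" for i
      using that by (auto simp: y_def cutoff_apply)
    then have "sup_norm (x - y) \<le> \<epsilon> / 2"
      unfolding sup_norm_def by (intro cSUP_least) auto
    ultimately show ?thesis using that by (intro exI[of _ y]) auto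
  qed
  then show "x \<in> lp 0" using x unfolding lp_def by simp
qed

lemma lp_iff: "x \<in> lp p \<longleftrightarrow> vanishing p x \<and> (\<exists>C. lp_bounded p C x)"
proof (cases "p = 0 \<or> p = \<infinity>")
  case True
  have "x \<in> linf \<longleftrightarrow> (\<exists>C. lp_bounded p C x)"
  proof
    assume "x \<in> linf"
    then obtain C where "\<forall>i. norm (x i) \<le> C" unfolding linf_def bounded_iff by auto
    then have "lp_bounded p C x" using True norm_ge_zero order_trans unfolding lp_bounded_def by (metis (full_types))
    then show "\<exists>C. lp_bounded p C x" by blast
  next
    assume "\<exists>C. lp_bounded p C x"
    then show "x \<in> linf" using True unfolding linf_def bounded_iff lp_bounded_def by auto
  qed
  then show ?thesis using True lp_0_iff by (auto simp: lp_def vanishing_def)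
next
  case False
  define r where "r = enn2real p"
  have r: "r \<ge> 1" using exponent_ge_1[OF False] r_def by simp
  let ?f = "\<lambda>i. norm (x i) powr r"
  have "?f summable_on UNIV \<longleftrightarrow> (\<exists>C. lp_bounded p C x)"
  proof
    assume s: "?f summable_on UNIV"
    have "sum ?f F \<le> (infsum ?f UNIV powr (1 / r)) powr r" if "finite F" for F
    proof -
      have "sum ?f F \<le> infsum ?f UNIV" using that s by (intro finite_sum_le_infsum) auto
      then show ?thesis using r by (simp add: powr_powr infsum_nonneg)
    qed
    then show "\<exists>C. lp_bounded p C x" using False unfolding lp_bounded_def r_def
      by (intro exI[of _ "infsum ?f UNIV powr (1 / r)"]) (auto simp: r_def)
  next
    assume "\<exists>C. lp_bounded p C x"
    then obtain C where "\<forall>F. finite F \<longrightarrow> sum ?f F \<le> C powr r"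
      using False unfolding lp_bounded_def r_def by auto
    then show "?f summable_on UNIV"
      by (intro nonneg_bdd_above_summable_on) (auto simp: bdd_above_def)
  qed
  then show ?thesis using False by (auto simp: lp_def vanishing_def r_def)
qed

lemma norm_le_iff:
  assumes x: "x \<in> lp p"
  shows "lp_norm p x \<le> C \<longleftrightarrow> lp_bounded p C x"
proof (cases "p = 0 \<or> p = \<infinity>")
  case True
  then have "x \<in> linf" using x by (auto simp: lp_def)
  from sup_norm_le_iff[OF this] show ?thesis
    using True order_trans[OF norm_ge_zero[of "x undefined"]] unfolding lp_bounded_def lp_norm_def by auto
next
  case False
  define r where "r = enn2real p"
  have r: "r \<ge> 1" using exponent_ge_1[OF False] r_def by simp
  let ?f = "\<lambda>i. norm (x i) powr r"
  have s: "?f summable_on UNIV" using x False by (simp add: lp_def r_def)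
  have N: "lp_norm p x = infsum ?f UNIV powr (1 / r)" using False by (simp add: lp_norm_def r_def)
  show ?thesis
  proof
    assume le: "lp_norm p x \<le> C"
    have "0 \<le> C" using le unfolding N by (rule order_trans[rotated]) simp
    have "sum ?f F \<le> C powr r" if "finite F" for F
    proof -
      have "sum ?f F \<le> infsum ?f UNIV" using that s by (intro finite_sum_le_infsum) auto
      also have "\<dots> = lp_norm p x powr r" using r by (simp add: N powr_powr infsum_nonneg)
      also have "\<dots> \<le> C powr r" using le r by (intro powr_mono2) (auto simp: N)
      finally show ?thesis .
    qed
    then show "lp_bounded p C x" using False \<open>0 \<le> C\<close> unfolding lp_bounded_def r_def by auto
  next
    assume b: "lp_bounded p C x"
    have "infsum ?f UNIV \<le> C powr r"
      using s lp_bounded_sum[OF b False] by (intro infsum_le_finite_sums) (auto simp: r_def)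
    then have "infsum ?f UNIV powr (1 / r) \<le> (C powr r) powr (1 / r)"
      using r by (intro powr_mono2) (auto simp: infsum_nonneg)
    then show "lp_norm p x \<le> C" using r lp_bounded_nonneg[OF b] by (simp add: N powr_powr)
  qed
qed

lemma vanishing_mono: "vanishing p x \<Longrightarrow> (\<And>i. norm (y i) \<le> a * norm (x i)) \<Longrightarrow> 0 \<le> a \<Longrightarrow> vanishing p y"
  unfolding vanishing_def
proof (intro impI allI)
  fix \<epsilon> :: real assume h: "p = 0 \<longrightarrow> (\<forall>\<epsilon>>0. finite {i. \<epsilon> \<le> norm (x i)})"
    and le: "\<And>i. norm (y i) \<le> a * norm (x i)" and a: "0 \<le> a" and "p = 0" and e: "\<epsilon> > 0"
  have "{i. \<epsilon> \<le> norm (y i)} \<subseteq> {i. \<epsilon> / (a + 1) \<le> norm (x i)}"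
  proof (clarify)
    fix i assume "\<epsilon> \<le> norm (y i)"
    also have "\<dots> \<le> (a + 1) * norm (x i)" using le[of i] a by (simp add: distrib_right add_increasing2)
    finally show "\<epsilon> / (a + 1) \<le> norm (x i)" using a by (simp add: field_simps)
  qed
  moreover have "finite {i. \<epsilon> / (a + 1) \<le> norm (x i)}" using h \<open>p = 0\<close> e a by simp
  ultimately show "finite {i. \<epsilon> \<le> norm (y i)}" using finite_subset by blast
qed

lemma lp_norm_attained_bound: "x \<in> lp p \<Longrightarrow> lp_bounded p (lp_norm p x) x"
  by (rule iffD1[OF norm_le_iff order_refl])

lemma lp_norm_nonneg: "x \<in> lp p \<Longrightarrow> 0 \<le> lp_norm p x"
  by (rule lp_bounded_nonneg[OF lp_norm_attained_bound])

lemma lp_coord: "x \<in> lp p \<Longrightarrow> norm (x i) \<le> lp_norm p x"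
  by (rule lp_bounded_coord[OF lp_norm_attained_bound])

text \<open>
  The spaces are solid; the membership of cutoffs, multiples and commutators is deduced from this.
\<close>

lemma lp_dominated:
  assumes "x \<in> lp p" "\<And>i. norm (y i) \<le> a * norm (x i)" "0 \<le> a"
  shows "y \<in> lp p" "lp_norm p y \<le> a * lp_norm p x"
proof -
  have b: "lp_bounded p (a * lp_norm p x) y" using lp_bounded_scale[OF lp_norm_attained_bound] assms by blast
  moreover have "vanishing p y" using vanishing_mono[of x y a] assms unfolding lp_iff by blast
  ultimately show "y \<in> lp p" unfolding lp_iff by blast
  with b show "lp_norm p y \<le> a * lp_norm p x" by (simp add: norm_le_iff)
qed

lemma lp_add:
  assumes x: "x \<in> lp p" and y: "y \<in> lp p"
  shows "x + y \<in> lp p" "lp_norm p (x + y) \<le> lp_norm p x + lp_norm p y"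
proof -
  have b: "lp_bounded p (lp_norm p x + lp_norm p y) (x + y)" using lp_bounded_add[OF lp_norm_attained_bound lp_norm_attained_bound] x y by blast
  have "vanishing p (x + y)" unfolding vanishing_def
  proof (intro impI allI)
    fix \<epsilon> :: real assume "p = 0" and e: "\<epsilon> > 0"
    then have "finite ({i. \<epsilon> / 2 \<le> norm (x i)} \<union> {i. \<epsilon> / 2 \<le> norm (y i)})"
      using x y half_gt_zero[OF e] unfolding lp_iff vanishing_def by blast
    moreover have "{i. \<epsilon> \<le> norm ((x + y) i)} \<subseteq> {i. \<epsilon> / 2 \<le> norm (x i)} \<union> {i. \<epsilon> / 2 \<le> norm (y i)}"
    proof (clarsimp)
      fix i assume "\<epsilon> \<le> norm (x i + y i)" "\<not> \<epsilon> \<le> norm (y i) * 2"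
      then show "\<epsilon> \<le> norm (x i) * 2" using norm_triangle_ineq[of "x i" "y i"] by linarith
    qed
    ultimately show "finite {i. \<epsilon> \<le> norm ((x + y) i)}" using finite_subset by blast
  qed
  with b show "x + y \<in> lp p" unfolding lp_iff by blast
  with b show "lp_norm p (x + y) \<le> lp_norm p x + lp_norm p y" by (simp add: norm_le_iff)
qed

lemma lp_zero [simp]: "0 \<in> lp p" "lp_norm p 0 = 0"
proof -
  have b: "lp_bounded p 0 (0 :: ('n::finite, 'x::complex_banach) seq)" unfolding lp_bounded_def by simp
  moreover have "vanishing p (0 :: ('n::finite, 'x::complex_banach) seq)" unfolding vanishing_def by auto
  ultimately show z: "(0 :: ('n::finite, 'x::complex_banach) seq) \<in> lp p" unfolding lp_iff by blast
  show "lp_norm p (0 :: ('n::finite, 'x::complex_banach) seq) = 0"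
    using iffD2[OF norm_le_iff[OF z] b] lp_norm_nonneg[OF z] by (rule antisym)
qed

lemma lp_cscale:
  assumes "x \<in> lp p"
  shows "cscale c x \<in> lp p" "lp_norm p (cscale c x) = cmod c * lp_norm p x"
proof -
  have le: "cscale c x \<in> lp p \<and> lp_norm p (cscale c x) \<le> cmod c * lp_norm p x" if "x \<in> lp p" for c x
    using lp_dominated[OF that, of "cscale c x" "cmod c"] by (simp add: norm_scaleC)
  show "cscale c x \<in> lp p" using le assms by blast
  show "lp_norm p (cscale c x) = cmod c * lp_norm p x"
  proof (cases "c = 0")
    case True
    then have "cscale c x = 0" by (auto simp: fun_eq_iff)
    then show ?thesis using True by simp
  next
    case False
    have "cscale (inverse c) (cscale c x) = x" using False by (auto simp: fun_eq_iff scaleC_scaleC scaleC_one)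
    then have "lp_norm p x \<le> inverse (cmod c) * lp_norm p (cscale c x)"
      using le[of "cscale c x" "inverse c"] le[OF assms, of c] by (simp add: norm_inverse)
    then have "cmod c * lp_norm p x \<le> lp_norm p (cscale c x)" using False by (simp add: field_simps)
    then show ?thesis using le[OF assms, of c] by simp
  qed
qed

lemma lp_minus:
  assumes "x \<in> lp p"
  shows "- x \<in> lp p" "lp_norm p (- x) = lp_norm p x"
proof -
  have "cscale (- 1) x = - x" by (simp add: fun_eq_iff scaleC_minus1)
  then show "- x \<in> lp p" "lp_norm p (- x) = lp_norm p x" using lp_cscale[OF assms, of "- 1"] by auto
qed

lemma lp_diff:
  assumes "x \<in> lp p" "y \<in> lp p"
  shows "x - y \<in> lp p" "lp_norm p (x - y) \<le> lp_norm p x + lp_norm p y"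
  using lp_add[OF assms(1) lp_minus(1)[OF assms(2)]] lp_minus(2)[OF assms(2)] by auto

lemma lp_norm_eq_0: "x \<in> lp p \<Longrightarrow> lp_norm p x = 0 \<Longrightarrow> x = 0"
  using lp_coord by (fastforce simp: fun_eq_iff)

lemma lp_sum:
  assumes "finite F" "\<And>k. k \<in> F \<Longrightarrow> x k \<in> lp p"
  shows "(\<Sum>k\<in>F. x k) \<in> lp p" "lp_norm p (\<Sum>k\<in>F. x k) \<le> (\<Sum>k\<in>F. lp_norm p (x k))"
proof -
  have "(\<Sum>k\<in>F. x k) \<in> lp p \<and> lp_norm p (\<Sum>k\<in>F. x k) \<le> (\<Sum>k\<in>F. lp_norm p (x k))"
    using assms
  proof (induction F rule: finite_induct)
    case (insert k F)
    have IH: "(\<Sum>k\<in>F. x k) \<in> lp p" "lp_norm p (\<Sum>k\<in>F. x k) \<le> (\<Sum>k\<in>F. lp_norm p (x k))" and k: "x k \<in> lp p"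
      using insert by auto
    show ?case unfolding sum.insert[OF insert(1,2)] using lp_add[OF k IH(1)] IH(2) by linarith
  qed simp
  then show "(\<Sum>k\<in>F. x k) \<in> lp p" "lp_norm p (\<Sum>k\<in>F. x k) \<le> (\<Sum>k\<in>F. lp_norm p (x k))" by auto
qed

lemma lp_cutoff:
  assumes "x \<in> lp p"
  shows "cutoff F x \<in> lp p" "lp_norm p (cutoff F x) \<le> lp_norm p x"
  using lp_dominated[OF assms, of "cutoff F x" 1] by (auto simp: cutoff_apply)

lemma lp_finite_support:
  assumes "finite F" "\<And>i. i \<notin> F \<Longrightarrow> x i = 0"
  shows "x \<in> lp p"
proof -
  define e where "e i = cutoff {i} x" for i
  have "e i \<in> lp p" for i
  proof -
    have "lp_bounded p (norm (x i)) (e i)"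
    proof (cases "p = 0 \<or> p = \<infinity>")
      case False
      have "(\<Sum>j\<in>F. norm (e i j) powr enn2real p) \<le> norm (x i) powr enn2real p" if "finite F" for F
      proof -
        have "(\<Sum>j\<in>F. norm (e i j) powr enn2real p) = (\<Sum>j\<in>F \<inter> {i}. norm (x i) powr enn2real p)"
          using that exponent_ge_1[OF False]
          by (intro sum.mono_neutral_cong_right) (auto simp: e_def cutoff_apply)
        then show ?thesis by (cases "i \<in> F") auto
      qed
      then show ?thesis using False unfolding lp_bounded_def by auto
    qed (auto simp: lp_bounded_def e_def cutoff_apply)
    moreover have "vanishing p (e i)" unfolding vanishing_def
    proof (intro impI allI)
      fix \<epsilon> :: real assume "\<epsilon> > 0"
      then have "{j. \<epsilon> \<le> norm (e i j)} \<subseteq> {i}" by (auto simp: e_def cutoff_apply split: if_splits)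
      then show "finite {j. \<epsilon> \<le> norm (e i j)}" using finite_subset by blast
    qed
    ultimately show ?thesis unfolding lp_iff by blast
  qed
  moreover have "x = (\<Sum>i\<in>F. e i)"
  proof
    fix j
    have "(\<Sum>i\<in>F. e i) j = (\<Sum>i\<in>F. e i j)" by (rule sum_seq_apply)
    also have "\<dots> = x j" using assms by (cases "j \<in> F") (auto simp: e_def cutoff_apply)
    finally show "x j = (\<Sum>i\<in>F. e i) j" by simp
  qed
  ultimately show ?thesis using lp_sum(1)[OF assms(1)] by metis
qed

lemma lp_reindex:
  assumes x: "x \<in> lp p" and inj: "inj \<sigma>"
  shows "(\<lambda>i. x (\<sigma> i)) \<in> lp p" "lp_norm p (\<lambda>i. x (\<sigma> i)) \<le> lp_norm p x"
proof -
  have b: "lp_bounded p (lp_norm p x) (\<lambda>i. x (\<sigma> i))" by (rule lp_bounded_reindex[OF lp_norm_attained_bound[OF x] inj])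
  have "finite {i. \<epsilon> \<le> norm (x (\<sigma> i))}" if "p = 0" "\<epsilon> > 0" for \<epsilon>
  proof -
    have "finite {i. \<epsilon> \<le> norm (x i)}" using x that unfolding lp_iff vanishing_def by simp
    then have "finite (\<sigma> -` {i. \<epsilon> \<le> norm (x i)})" using inj by (rule finite_vimageI)
    then show ?thesis by (simp add: vimage_def)
  qed
  then have "vanishing p (\<lambda>i. x (\<sigma> i))" unfolding vanishing_def by blast
  with b show "(\<lambda>i. x (\<sigma> i)) \<in> lp p" unfolding lp_iff by blast
  with b show "lp_norm p (\<lambda>i. x (\<sigma> i)) \<le> lp_norm p x" by (simp add: norm_le_iff)
qed

text \<open>
  The limit is formed coordinatewise; the tail estimates of the Cauchy property pass to it by
  \<open>lp_bounded_limit\<close>.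
\<close>

lemma lp_complete:
  fixes x :: "nat \<Rightarrow> ('n::finite, 'x::complex_banach) seq"
  assumes x: "\<And>n. x n \<in> lp p"
    and cauchy: "\<And>e. e > 0 \<Longrightarrow> \<exists>M. \<forall>m\<ge>M. \<forall>n\<ge>M. lp_norm p (x m - x n) \<le> e"
  obtains y where "y \<in> lp p" "(\<lambda>n. lp_norm p (x n - y)) \<longlonglongrightarrow> 0"
proof -
  have "Cauchy (\<lambda>n. x n i)" for i
  proof (rule metric_CauchyI)
    fix e :: real assume "e > 0"
    then obtain M where M: "\<forall>m\<ge>M. \<forall>n\<ge>M. lp_norm p (x m - x n) \<le> e / 2" using cauchy[of "e / 2"] by auto
    have "dist (x m i) (x n i) < e" if "m \<ge> M" "n \<ge> M" for m n
      using lp_coord[OF lp_diff(1)[OF x x], of m n i] M[rule_format, OF that] \<open>e > 0\<close>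
      by (simp add: dist_norm)
    then show "\<exists>M. \<forall>m\<ge>M. \<forall>n\<ge>M. dist (x m i) (x n i) < e" by blast
  qed
  then have "\<exists>l. (\<lambda>n. x n i) \<longlonglongrightarrow> l" for i
    using Cauchy_convergent_iff unfolding convergent_def by blast
  then obtain y where lim: "\<And>i. (\<lambda>n. x n i) \<longlonglongrightarrow> y i" by metis
  have close: "\<exists>M. \<forall>m\<ge>M. lp_bounded p e (x m - y)" if e: "e > 0" for e
  proof -
    obtain M where M: "\<forall>m\<ge>M. \<forall>n\<ge>M. lp_norm p (x m - x n) \<le> e" using cauchy[OF e] by blast
    have "lp_bounded p e (x m - y)" if "m \<ge> M" for m
    proof (rule lp_bounded_limit)
      show "lp_bounded p e (x m - x (n + M))" for n
        using M that norm_le_iff[OF lp_diff(1)[OF x x]] by simp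
      show "(\<lambda>n. (x m - x (n + M)) i) \<longlonglongrightarrow> (x m - y) i" for i
        using LIMSEQ_ignore_initial_segment[OF lim, of M] by (auto intro!: tendsto_intros)
    qed
    then show ?thesis by blast
  qed
  have "y \<in> lp p" unfolding lp_iff
  proof
    obtain M where M: "lp_bounded p 1 (x M - y)" using close[of 1] by auto
    have "lp_bounded p 1 (y - x M)" by (rule lp_bounded_mono[OF M]) (auto simp: norm_minus_commute)
    then have "lp_bounded p (lp_norm p (x M) + 1) (x M + (y - x M))" by (rule lp_bounded_add[OF lp_norm_attained_bound[OF x]])
    then show "\<exists>C. lp_bounded p C y" by auto
    show "vanishing p y" unfolding vanishing_def
    proof (intro impI allI)
      fix \<epsilon> :: real assume "p = 0" "\<epsilon> > 0"
      obtain M where M: "lp_bounded p (\<epsilon> / 2) (x M - y)" using close[of "\<epsilon> / 2"] \<open>\<epsilon> > 0\<close> by auto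
      have "finite {i. \<epsilon> / 2 \<le> norm (x M i)}"
      proof -
        have "vanishing p (x M)" using x[of M] lp_iff by blast
        then show ?thesis using \<open>p = 0\<close> half_gt_zero[OF \<open>\<epsilon> > 0\<close>] unfolding vanishing_def by blast
      qed
      moreover have "\<epsilon> / 2 \<le> norm (x M i)" if "\<epsilon> \<le> norm (y i)" for i
      proof -
        have "norm (x M i - y i) \<le> \<epsilon> / 2" using lp_bounded_coord[OF M, of i] by simp
        moreover have "norm (y i) \<le> norm (x M i) + norm (x M i - y i)"
          using norm_triangle_ineq4[of "x M i" "x M i - y i"] by simp
        ultimately show ?thesis using that by linarith
      qed
      then have "{i. \<epsilon> \<le> norm (y i)} \<subseteq> {i. \<epsilon> / 2 \<le> norm (x M i)}" by blast
      ultimately show "finite {i. \<epsilon> \<le> norm (y i)}" by (rule rev_finite_subset)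
    qed
  qed
  moreover have "(\<lambda>n. lp_norm p (x n - y)) \<longlonglongrightarrow> 0"
  proof (rule LIMSEQ_I)
    fix r :: real assume r: "r > 0"
    obtain M where M: "\<forall>m\<ge>M. lp_bounded p (r / 2) (x m - y)" using close[OF half_gt_zero[OF r]] by blast
    have "norm (lp_norm p (x n - y) - 0) < r" if n: "n \<ge> M" for n
    proof -
      note xy = lp_diff(1)[OF x \<open>y \<in> lp p\<close>, of n]
      have "lp_norm p (x n - y) \<le> r / 2" using M n norm_le_iff[OF xy] by blast
      then show ?thesis using lp_norm_nonneg[OF xy] r by simp
    qed
    then show "\<exists>no. \<forall>n\<ge>no. norm (lp_norm p (x n - y) - 0) < r" by blast
  qed
  ultimately show ?thesis by (rule that)
qed

text \<open>
  Block-diagonal estimates in the norm: this turns local bounds on cubes into global operator bounds for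
  every exponent at once.
\<close>

lemma lp_blocks:
  assumes x: "x \<in> lp p" and a: "0 \<le> a"
    and fin: "\<And>k. k \<in> K \<Longrightarrow> finite (B k)" "\<And>k. k \<in> K \<Longrightarrow> finite (D k)"
    and disj: "\<And>k l. k \<in> K \<Longrightarrow> l \<in> K \<Longrightarrow> k \<noteq> l \<Longrightarrow> D k \<inter> D l = {}"
    and supp: "\<And>i. y i \<noteq> 0 \<Longrightarrow> \<exists>k\<in>K. i \<in> B k"
    and le: "\<And>k. k \<in> K \<Longrightarrow> lp_norm p (cutoff (B k) y) \<le> a * lp_norm p (cutoff (D k) x)"
  shows "y \<in> lp p" "lp_norm p y \<le> a * lp_norm p x"
proof -
  have By: "cutoff (B k) y \<in> lp p" if "k \<in> K" for k
    using fin(1)[OF that] by (rule lp_finite_support) (simp add: cutoff_apply)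
  have "lp_bounded p (a * lp_norm p x) y"
  proof (rule lp_bounded_blocks[OF lp_norm_attained_bound[OF x] a fin disj supp])
    fix k t assume k: "k \<in> K" and t: "lp_bounded p t (cutoff (D k) x)"
    have "lp_norm p (cutoff (D k) x) \<le> t" using t norm_le_iff[OF lp_cutoff(1)[OF x]] by blast
    then have "lp_norm p (cutoff (B k) y) \<le> a * t"
      using le[OF k] a by (meson mult_left_mono order_trans)
    then show "lp_bounded p (a * t) (cutoff (B k) y)" using norm_le_iff[OF By[OF k]] by blast
  qed
  moreover have "vanishing p y" unfolding vanishing_def
  proof (intro impI allI)
    fix \<epsilon> :: real assume p0: "p = 0" and e: "\<epsilon> > 0"
    \<comment> \<open>Adding \<open>1\<close> keeps the threshold finite when \<open>a = 0\<close> and gives \<open>a \<eta> < \<epsilon>\<close>.\<close>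
    define \<eta> where "\<eta> = \<epsilon> / (a + 1)"
    define L where "L = {k \<in> K. \<exists>i\<in>D k. \<eta> \<le> norm (x i)}"
    have \<eta>: "\<eta> > 0" "a * \<eta> < \<epsilon>" using e a by (auto simp: \<eta>_def field_simps)
    obtain \<iota> where \<iota>: "\<And>k. k \<in> L \<Longrightarrow> \<iota> k \<in> D k \<and> \<eta> \<le> norm (x (\<iota> k))"
    proof -
      have "\<exists>i. i \<in> D k \<and> \<eta> \<le> norm (x i)" if "k \<in> L" for k using that unfolding L_def by blast
      then show ?thesis using that by metis
    qed
    have "inj_on \<iota> L"
      using \<iota> disj unfolding inj_on_def L_def by (metis (mono_tags, lifting) disjoint_iff mem_Collect_eq)
    moreover have "finite {i. \<eta> \<le> norm (x i)}" using x p0 \<eta>(1) unfolding lp_iff vanishing_def by simp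
    then have "finite (\<iota> ` L)" by (rule rev_finite_subset) (use \<iota> in auto)
    ultimately have "finite L" using finite_image_iff by blast
    moreover have "i \<in> (\<Union>k\<in>L. B k)" if i: "\<epsilon> \<le> norm (y i)" for i
    proof -
      obtain k where k: "k \<in> K" "i \<in> B k" using supp[of i] i e by fastforce
      have "k \<in> L"
      proof (rule ccontr)
        assume "k \<notin> L"
        then have "lp_bounded p \<eta> (cutoff (D k) x)" using k \<eta> p0 unfolding L_def lp_bounded_def by (auto simp: cutoff_apply)
        then have "lp_norm p (cutoff (D k) x) \<le> \<eta>" using norm_le_iff[OF lp_cutoff(1)[OF x]] by blast
        then have "lp_norm p (cutoff (B k) y) \<le> a * \<eta>"
          using le[OF k(1)] a by (meson mult_left_mono order_trans)
        moreover have "norm (y i) \<le> lp_norm p (cutoff (B k) y)"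
          using lp_coord[OF By[OF k(1)], of i] k by (simp add: cutoff_apply)
        ultimately show False using i \<eta> by linarith
      qed
      then show ?thesis using k by blast
    qed
    then have "{i. \<epsilon> \<le> norm (y i)} \<subseteq> (\<Union>k\<in>L. B k)" by blast
    moreover have "finite (\<Union>k\<in>L. B k)" using \<open>finite L\<close> fin(1) unfolding L_def by auto
    ultimately show "finite {i. \<epsilon> \<le> norm (y i)}" using finite_subset by blast
  qed
  ultimately show "y \<in> lp p" unfolding lp_iff by blast
  then show "lp_norm p y \<le> a * lp_norm p x" using \<open>lp_bounded p (a * lp_norm p x) y\<close> by (simp add: norm_le_iff)
qed

end

section \<open>Bounded operators and vanishing tails\<close>

definition cube :: "int ^ 'n \<Rightarrow> int \<Rightarrow> (int ^ 'n::finite) set"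
  where "cube k r = {i. \<forall>j. \<bar>i $ j - k $ j\<bar> \<le> r}"

definition weight :: "(int ^ 'n \<Rightarrow> real) \<Rightarrow> ('n, 'x) seq \<Rightarrow> ('n::finite, 'x::complex_banach) seq"
  where "weight \<phi> x = (\<lambda>i. \<phi> i *\<^sub>R x i)"

lemma weight_apply [simp]: "weight \<phi> x i = \<phi> i *\<^sub>R x i" by (simp add: weight_def)

lemma mem_cube: "i \<in> cube k r \<longleftrightarrow> (\<forall>j. \<bar>i $ j - k $ j\<bar> \<le> r)"
  by (simp add: cube_def)

lemma cube_sym: "i \<in> cube k r \<longleftrightarrow> k \<in> cube i r"
  by (simp add: mem_cube abs_minus_commute)

lemma cube_trans:
  assumes "i \<in> cube j r" "j \<in> cube k s" shows "i \<in> cube k (r + s)"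
  unfolding mem_cube
proof
  fix l
  have "\<bar>i $ l - j $ l\<bar> \<le> r" "\<bar>j $ l - k $ l\<bar> \<le> s" using assms by (auto simp: mem_cube)
  then show "\<bar>i $ l - k $ l\<bar> \<le> r + s" by linarith
qed

lemma cube_mono: "r \<le> s \<Longrightarrow> cube k r \<subseteq> cube k s"
  unfolding cube_def by (auto intro: order_trans[of _ r s])

lemma cube_center: "0 \<le> r \<Longrightarrow> k \<in> cube k r"
  by (simp add: mem_cube)

lemma cube_shift: "i + l \<in> cube (k + l) r \<longleftrightarrow> i \<in> cube k r"
  by (simp add: mem_cube)

lemma finite_cube [simp]: "finite (cube (k :: int ^ 'n::finite) r)"
proof -
  have "cube k r \<subseteq> vec_lambda ` (PiE UNIV (\<lambda>j. {k $ j - r .. k $ j + r}))"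
  proof
    fix i assume i: "i \<in> cube k r"
    have "vec_nth i \<in> PiE UNIV (\<lambda>j. {k $ j - r .. k $ j + r})"
    proof (rule PiE_I)
      fix j
      have "\<bar>i $ j - k $ j\<bar> \<le> r" using i by (simp add: mem_cube)
      then show "i $ j \<in> {k $ j - r .. k $ j + r}" by auto
    qed simp
    moreover have "i = vec_lambda (vec_nth i)" by simp
    ultimately show "i \<in> vec_lambda ` (PiE UNIV (\<lambda>j. {k $ j - r .. k $ j + r}))" by blast
  qed
  moreover have "finite (PiE UNIV (\<lambda>j::'n. {k $ j - r .. k $ j + r}))"
    by (intro finite_PiE) auto
  ultimately show ?thesis by (meson finite_imageI finite_subset)
qed

lemma cutoff_cutoff: "cutoff F (cutoff G x) = cutoff (F \<inter> G) x"
  by (auto simp: cutoff_apply fun_eq_iff)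

lemma cutoff_add: "cutoff F (x + y) = cutoff F x + cutoff F y"
  by (auto simp: cutoff_apply fun_eq_iff)

lemma cutoff_diff: "cutoff F (x - y) = cutoff F x - cutoff F y"
  by (auto simp: cutoff_apply fun_eq_iff)

lemma cutoff_cscale: "cutoff F (cscale c x) = cscale c (cutoff F x)"
  by (auto simp: cutoff_apply fun_eq_iff)

lemma cutoff_split: "cutoff F x + cutoff (- F) x = x"
  by (auto simp: cutoff_apply fun_eq_iff)

lemma cutoff_eq_self: "(\<And>i. i \<notin> F \<Longrightarrow> x i = 0) \<Longrightarrow> cutoff F x = x"
  by (auto simp: cutoff_apply fun_eq_iff)

lemma weight_add: "weight \<phi> (x + y) = weight \<phi> x + weight \<phi> y"
  by (auto simp: fun_eq_iff scaleR_right_distrib)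

lemma weight_diff: "weight \<phi> (x - y) = weight \<phi> x - weight \<phi> y"
  by (auto simp: fun_eq_iff scaleR_right_diff_distrib)

lemma weight_cscale: "weight \<phi> (cscale c x) = cscale c (weight \<phi> x)"
  by (auto simp: fun_eq_iff scaleR_scaleC scaleC_scaleC mult.commute)

context lp_exponent
begin

lemma lp_weight:
  assumes "x \<in> lp p" "\<And>i. \<bar>\<phi> i\<bar> \<le> 1"
  shows "weight \<phi> x \<in> lp p" "lp_norm p (weight \<phi> x) \<le> lp_norm p x"
  using lp_dominated[OF assms(1), of "weight \<phi> x" 1] assms(2) by (auto simp: mult_left_le_one_le)

lemma lp_cutoff_mono:
  assumes "x \<in> lp p" "F \<subseteq> G"
  shows "lp_norm p (cutoff F x) \<le> lp_norm p (cutoff G x)"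
proof -
  have "cutoff F x = cutoff F (cutoff G x)" using assms(2) by (auto simp: cutoff_apply fun_eq_iff)
  then show ?thesis using lp_cutoff(2)[OF lp_cutoff(1)[OF assms(1)]] by metis
qed

lemma bopI:
  assumes "\<And>x. x \<in> lp p \<Longrightarrow> T x \<in> lp p" "\<And>x. x \<notin> lp p \<Longrightarrow> T x = 0"
    "\<And>x y. x \<in> lp p \<Longrightarrow> y \<in> lp p \<Longrightarrow> T (x + y) = T x + T y"
    "\<And>c x. x \<in> lp p \<Longrightarrow> T (cscale c x) = cscale c (T x)"
    "\<And>x. x \<in> lp p \<Longrightarrow> lp_norm p (T x) \<le> C * lp_norm p x"
  shows "T \<in> bounded_ops p"
  using assms unfolding bounded_ops_def cscale_def by blast

lemma bop_maps: "T \<in> bounded_ops p \<Longrightarrow> x \<in> lp p \<Longrightarrow> T x \<in> lp p"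
  and bop_off: "T \<in> bounded_ops p \<Longrightarrow> x \<notin> lp p \<Longrightarrow> T x = 0"
  and bop_add: "T \<in> bounded_ops p \<Longrightarrow> x \<in> lp p \<Longrightarrow> y \<in> lp p \<Longrightarrow> T (x + y) = T x + T y"
  and bop_cscale: "T \<in> bounded_ops p \<Longrightarrow> x \<in> lp p \<Longrightarrow> T (cscale c x) = cscale c (T x)"
  and bop_ex: "T \<in> bounded_ops p \<Longrightarrow> \<exists>C. \<forall>x\<in>lp p. lp_norm p (T x) \<le> C * lp_norm p x"
  unfolding bounded_ops_def cscale_def by blast+

lemma bop_in: "T \<in> bounded_ops p \<Longrightarrow> T x \<in> lp p"
  using bop_maps bop_off lp_zero(1) by metis

lemma bop_zero: "T \<in> bounded_ops p \<Longrightarrow> T 0 = 0"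
  using bop_add[of T 0 0] by simp

lemma bop_minus: "T \<in> bounded_ops p \<Longrightarrow> x \<in> lp p \<Longrightarrow> T (- x) = - T x"
  using bop_add[of T x "- x"] bop_zero[of T] lp_minus(1)[of x] by (simp add: eq_neg_iff_add_eq_0 add.commute)

lemma bop_diff: "T \<in> bounded_ops p \<Longrightarrow> x \<in> lp p \<Longrightarrow> y \<in> lp p \<Longrightarrow> T (x - y) = T x - T y"
  using bop_add[of T x "- y"] bop_minus[of T y] lp_minus(1)[of y] by simp

text \<open>
  Operator norms and norms of functionals are suprema of this kind, with \<open>F x = \<parallel>T x\<parallel>\<close> and \<open>F x = |f x|\<close>.
\<close>

lemma unit_ball_sup:
  fixes F :: "('n::finite, 'x::complex_banach) seq \<Rightarrow> real"
  assumes hom: "\<And>c x. x \<in> lp p \<Longrightarrow> F (cscale c x) = cmod c * F x"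
    and bd: "\<exists>C. \<forall>x\<in>lp p. F x \<le> C * lp_norm p x"
  defines "s \<equiv> SUP x\<in>{x \<in> lp p. lp_norm p x \<le> 1}. F x"
  shows "0 \<le> s" "x \<in> lp p \<Longrightarrow> F x \<le> s * lp_norm p x"
proof -
  obtain C where C: "\<forall>x\<in>lp p. F x \<le> C * lp_norm p x" using bd by blast
  have "F x \<le> \<bar>C\<bar>" if "x \<in> lp p" "lp_norm p x \<le> 1" for x
  proof -
    have "F x \<le> C * lp_norm p x" using C that by blast
    also have "\<dots> \<le> \<bar>C\<bar> * lp_norm p x" using lp_norm_nonneg[OF that(1)] by (intro mult_right_mono) auto
    also have "\<dots> \<le> \<bar>C\<bar>" using that by (simp add: mult_left_le)
    finally show ?thesis .
  qed
  then have bdd: "bdd_above (F ` {x \<in> lp p. lp_norm p x \<le> 1})"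
    by (intro bdd_aboveI2[where M = "\<bar>C\<bar>"]) auto
  have z: "cscale 0 0 = (0 :: ('n, 'x) seq)" by (simp add: fun_eq_iff)
  have F0: "F 0 = 0" using hom[OF lp_zero(1), of 0] unfolding z by simp
  have "F 0 \<le> s" unfolding s_def using lp_zero by (intro cSUP_upper[OF _ bdd]) auto
  then show "0 \<le> s" unfolding F0 .
  show "F x \<le> s * lp_norm p x" if x: "x \<in> lp p"
  proof (cases "lp_norm p x = 0")
    case True
    then show ?thesis using lp_norm_eq_0[OF x] F0 by simp
  next
    case False
    then have pos: "lp_norm p x > 0" using lp_norm_nonneg[OF x] by simp
    define c where "c = complex_of_real (inverse (lp_norm p x))"
    have cn: "cmod c = inverse (lp_norm p x)" using pos by (simp add: c_def norm_inverse)
    have "F (cscale c x) \<le> s"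
      unfolding s_def using pos cn lp_cscale[OF x, of c] by (intro cSUP_upper[OF _ bdd]) auto
    then have "inverse (lp_norm p x) * F x \<le> s" unfolding hom[OF x] cn .
    then show ?thesis using pos by (simp add: field_simps)
  qed
qed

lemma unit_ball_sup_le:
  fixes F :: "('n::finite, 'x::complex_banach) seq \<Rightarrow> real"
  assumes "\<And>x. x \<in> lp p \<Longrightarrow> F x \<le> C * lp_norm p x" "0 \<le> C"
  shows "(SUP x\<in>{x \<in> lp p. lp_norm p x \<le> 1}. F x) \<le> C"
proof (rule cSUP_least)
  show "{x :: ('n, 'x) seq. x \<in> lp p \<and> lp_norm p x \<le> 1} \<noteq> {}" using lp_zero by fastforce
  fix x assume "x \<in> {x :: ('n, 'x) seq. x \<in> lp p \<and> lp_norm p x \<le> 1}"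
  then show "F x \<le> C"
    using assms(1)[of x] mult_left_le[of "lp_norm p x" C] assms(2) by auto
qed

lemma op_norm_hom: "T \<in> bounded_ops p \<Longrightarrow> x \<in> lp p \<Longrightarrow> lp_norm p (T (cscale c x)) = cmod c * lp_norm p (T x)"
  using lp_cscale(2)[OF bop_maps, of T x c] by (simp only: bop_cscale)

lemma op_norm_nonneg: "T \<in> bounded_ops p \<Longrightarrow> 0 \<le> op_norm p T"
  unfolding op_norm_def by (rule unit_ball_sup(1)[OF op_norm_hom bop_ex])

lemma op_bound: "T \<in> bounded_ops p \<Longrightarrow> x \<in> lp p \<Longrightarrow> lp_norm p (T x) \<le> op_norm p T * lp_norm p x"
  unfolding op_norm_def by (rule unit_ball_sup(2)[OF op_norm_hom bop_ex])

lemma op_norm_le: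
  assumes "\<And>x. x \<in> lp p \<Longrightarrow> lp_norm p (T x) \<le> C * lp_norm p x" "0 \<le> C"
  shows "op_norm p T \<le> C"
  unfolding op_norm_def by (rule unit_ball_sup_le[OF assms])

lemma bop_comp:
  assumes S: "S \<in> bounded_ops p" and T: "T \<in> bounded_ops p"
  shows "S \<circ> T \<in> bounded_ops p" "op_norm p (S \<circ> T) \<le> op_norm p S * op_norm p T"
proof -
  have le: "lp_norm p ((S \<circ> T) x) \<le> op_norm p S * op_norm p T * lp_norm p x" if x: "x \<in> lp p" for x
  proof -
    have "lp_norm p (S (T x)) \<le> op_norm p S * lp_norm p (T x)" by (rule op_bound[OF S bop_maps[OF T x]])
    also have "\<dots> \<le> op_norm p S * (op_norm p T * lp_norm p x)"
      by (rule mult_left_mono[OF op_bound[OF T x] op_norm_nonneg[OF S]])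
    finally show ?thesis by (simp add: mult.assoc)
  qed
  show "S \<circ> T \<in> bounded_ops p"
    by (rule bopI[OF _ _ _ _ le]) (simp_all add: bop_maps[OF S] bop_maps[OF T] bop_off[OF T] bop_zero[OF S] bop_add[OF S]
      bop_add[OF T] bop_cscale[OF S] bop_cscale[OF T])
  show "op_norm p (S \<circ> T) \<le> op_norm p S * op_norm p T"
    by (rule op_norm_le[OF le]) (simp_all add: S T op_norm_nonneg)
qed

lemma bop_plus:
  assumes S: "S \<in> bounded_ops p" and T: "T \<in> bounded_ops p"
  shows "S + T \<in> bounded_ops p" "op_norm p (S + T) \<le> op_norm p S + op_norm p T"
proof -
  have le: "lp_norm p ((S + T) x) \<le> (op_norm p S + op_norm p T) * lp_norm p x" if x: "x \<in> lp p" for x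
    using lp_add(2)[OF bop_maps[OF S x] bop_maps[OF T x]] op_bound[OF S x] op_bound[OF T x]
    by (simp add: distrib_right)
  show "S + T \<in> bounded_ops p"
  proof (rule bopI[OF _ _ _ _ le])
    show "(S + T) (cscale c x) = cscale c ((S + T) x)" if "x \<in> lp p" for c x
      using bop_cscale[OF S that, of c] bop_cscale[OF T that, of c] by (auto simp: fun_eq_iff scaleC_add_right)
  qed (simp_all add: bop_maps[OF S] bop_maps[OF T] bop_off[OF S] bop_off[OF T] bop_add[OF S] bop_add[OF T] lp_add)
  show "op_norm p (S + T) \<le> op_norm p S + op_norm p T"
    by (rule op_norm_le[OF le]) (simp_all add: S T op_norm_nonneg)
qed

lemma bop_uminus:
  assumes T: "T \<in> bounded_ops p"
  shows "- T \<in> bounded_ops p"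
proof (rule bopI[where C = "op_norm p T"])
  show "(- T) (cscale c x) = cscale c ((- T) x)" if "x \<in> lp p" for c x
  proof -
    have "cscale (- 1) (T (cscale c x)) = cscale c (cscale (- 1) (T x))"
      using bop_cscale[OF T that, of c] by (simp add: fun_eq_iff scaleC_scaleC mult.commute)
    then show ?thesis by (simp add: fun_eq_iff scaleC_minus1)
  qed
qed (simp_all add: bop_maps[OF T] bop_off[OF T] bop_add[OF T] lp_minus op_bound[OF T])

lemma op_norm_uminus: "T \<in> bounded_ops p \<Longrightarrow> op_norm p (- T) = op_norm p T"
  unfolding op_norm_def by (intro SUP_cong) (auto simp: bop_maps lp_minus)

lemma bop_minus_op:
  assumes S: "S \<in> bounded_ops p" and T: "T \<in> bounded_ops p"
  shows "S - T \<in> bounded_ops p" "op_norm p (S - T) \<le> op_norm p S + op_norm p T"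
  using bop_plus[OF S bop_uminus[OF T]] op_norm_uminus[OF T] by auto

lemma bop_zero_op: "0 \<in> bounded_ops p"
  by (rule bopI[where C = 0]) (auto simp: fun_eq_iff)

lemma on_lp_bop:
  assumes "\<And>x. x \<in> lp p \<Longrightarrow> T x \<in> lp p"
    "\<And>x y. x \<in> lp p \<Longrightarrow> y \<in> lp p \<Longrightarrow> T (x + y) = T x + T y"
    "\<And>c x. x \<in> lp p \<Longrightarrow> T (cscale c x) = cscale c (T x)"
    "\<And>x. x \<in> lp p \<Longrightarrow> lp_norm p (T x) \<le> C * lp_norm p x"
  shows "on_lp p T \<in> bounded_ops p"
  by (rule bopI[where C = C]) (auto simp: on_lp_def assms lp_add lp_cscale)

lemma on_lp_apply: "x \<in> lp p \<Longrightarrow> on_lp p T x = T x" by (simp add: on_lp_def)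

lemma id_apply: "x \<in> lp p \<Longrightarrow> id_op p x = x" by (simp add: id_op_def on_lp_def)

lemma id_bop: "id_op p \<in> bounded_ops p"
  unfolding id_op_def by (rule on_lp_bop[where C = 1]) auto

lemma comp_id: "T \<in> bounded_ops p \<Longrightarrow> T \<circ> id_op p = T" "T \<in> bounded_ops p \<Longrightarrow> id_op p \<circ> T = T"
  by (auto simp: fun_eq_iff id_op_def on_lp_def bop_off bop_zero bop_in)

lemma cutoff_op_bop: "on_lp p (cutoff F) \<in> bounded_ops p"
  by (rule on_lp_bop[where C = 1]) (auto simp: lp_cutoff cutoff_add cutoff_cscale)

lemma P_op_eq: "(P_op p n :: ('a::finite, 'x::complex_banach) seq_op) = on_lp p (cutoff (cube 0 (int n)))"
proof -
  have "(\<forall>j. i $ j \<in> {- int n..int n}) \<longleftrightarrow> i \<in> cube 0 (int n)" for i :: "int ^ 'a::finite"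
    by (auto simp: mem_cube abs_le_iff minus_le_iff)
  then show ?thesis unfolding P_op_def cutoff_def by presburger
qed

lemma P_bop: "P_op p n \<in> bounded_ops p" unfolding P_op_eq by (rule cutoff_op_bop)

lemma P_apply: "x \<in> lp p \<Longrightarrow> P_op p n x = cutoff (cube 0 (int n)) x"
  by (simp add: P_op_eq on_lp_apply)

lemma Q_bop: "Q_op p n \<in> bounded_ops p"
  unfolding Q_op_def by (rule bop_minus_op(1)[OF id_bop P_bop])

lemma Q_apply: "x \<in> lp p \<Longrightarrow> Q_op p n x = cutoff (- cube 0 (int n)) x"
  by (auto simp: Q_op_def id_apply P_apply fun_eq_iff cutoff_apply)

lemma shift_apply: "x \<in> lp p \<Longrightarrow> shift_op p k x = (\<lambda>i. x (i - k))"
  by (simp add: shift_op_def on_lp_apply)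

lemma lp_shift: "x \<in> lp p \<Longrightarrow> (\<lambda>i. x (i - k)) \<in> lp p"
  by (rule lp_reindex(1)) (auto intro: injI)

lemma lp_norm_shift:
  assumes x: "x \<in> lp p" shows "lp_norm p (\<lambda>i. x (i - k)) = lp_norm p x"
proof (rule antisym)
  show "lp_norm p (\<lambda>i. x (i - k)) \<le> lp_norm p x" using x by (rule lp_reindex(2)) (auto intro: injI)
  have "lp_norm p (\<lambda>i. (\<lambda>i. x (i - k)) (i + k)) \<le> lp_norm p (\<lambda>i. x (i - k))"
    using lp_shift[OF x] by (rule lp_reindex(2)) (auto intro: injI)
  then show "lp_norm p x \<le> lp_norm p (\<lambda>i. x (i - k))" by simp
qed

lemma shift_bop: "shift_op p k \<in> bounded_ops p"
  unfolding shift_op_def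
  by (rule on_lp_bop[where C = 1]) (auto simp: lp_shift lp_norm_shift cscale_def)

text \<open>
  \<open>\<parallel>Q\<^sub>n T\<parallel> \<rightarrow> 0\<close>, written on vectors; one \<open>n\<close> is enough because the cubes increase.
\<close>

definition left_tail_null :: "('n::finite, 'x::complex_banach) seq_op \<Rightarrow> bool"
  where "left_tail_null T \<longleftrightarrow> (\<forall>\<epsilon>>0. \<exists>n::nat. \<forall>x\<in>lp p. lp_norm p (cutoff (- cube 0 (int n)) (T x)) \<le> \<epsilon> * lp_norm p x)"

text \<open>
  \<open>\<parallel>T Q\<^sub>n\<parallel> \<rightarrow> 0\<close>, written on vectors.
\<close>

definition right_tail_null :: "('n::finite, 'x::complex_banach) seq_op \<Rightarrow> bool"
  where "right_tail_null T \<longleftrightarrow> (\<forall>\<epsilon>>0. \<exists>n::nat. \<forall>x\<in>lp p. lp_norm p (T (cutoff (- cube 0 (int n)) x)) \<le> \<epsilon> * lp_norm p x)"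

lemma left_tail_null_eventually:
  assumes T: "T \<in> bounded_ops p" "left_tail_null T" and e: "\<epsilon> > 0"
  obtains n0 :: nat where "\<And>n x. n \<ge> n0 \<Longrightarrow> x \<in> lp p \<Longrightarrow> lp_norm p (cutoff (- cube 0 (int n)) (T x)) \<le> \<epsilon> * lp_norm p x"
proof -
  obtain n0 :: nat where n0: "\<forall>x\<in>lp p. lp_norm p (cutoff (- cube 0 (int n0)) (T x)) \<le> \<epsilon> * lp_norm p x"
    using T(2) e unfolding left_tail_null_def by blast
  show ?thesis
  proof (rule that[of n0])
    fix n and x :: "('a, 'b) seq" assume n: "n \<ge> n0" and x: "x \<in> lp p"
    have "lp_norm p (cutoff (- cube 0 (int n)) (T x)) \<le> lp_norm p (cutoff (- cube 0 (int n0)) (T x))"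
      using n by (intro lp_cutoff_mono bop_maps[OF T(1) x] Compl_anti_mono cube_mono) auto
    then show "lp_norm p (cutoff (- cube 0 (int n)) (T x)) \<le> \<epsilon> * lp_norm p x" using n0 x by force
  qed
qed

lemma right_tail_null_eventually:
  assumes T: "T \<in> bounded_ops p" "right_tail_null T" and e: "\<epsilon> > 0"
  obtains n0 :: nat where "\<And>n x. n \<ge> n0 \<Longrightarrow> x \<in> lp p \<Longrightarrow> lp_norm p (T (cutoff (- cube 0 (int n)) x)) \<le> \<epsilon> * lp_norm p x"
proof -
  obtain n0 :: nat where n0: "\<forall>x\<in>lp p. lp_norm p (T (cutoff (- cube 0 (int n0)) x)) \<le> \<epsilon> * lp_norm p x"
    using T(2) e unfolding right_tail_null_def by blast
  show ?thesis
  proof (rule that[of n0])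
    fix n and x :: "('a, 'b) seq" assume n: "n \<ge> n0" and x: "x \<in> lp p"
    have "- cube 0 (int n) \<subseteq> - (cube 0 (int n0) :: (int ^ 'a) set)"
      using n by (intro Compl_anti_mono cube_mono) auto
    then have "cutoff (- cube 0 (int n)) x = cutoff (- cube 0 (int n0)) (cutoff (- cube 0 (int n)) x)"
      unfolding cutoff_cutoff by (simp add: Int_absorb1)
    then have "lp_norm p (T (cutoff (- cube 0 (int n)) x)) \<le> \<epsilon> * lp_norm p (cutoff (- cube 0 (int n)) x)"
      using n0 lp_cutoff(1)[OF x, of "- cube 0 (int n)"] by metis
    also have "\<dots> \<le> \<epsilon> * lp_norm p x" using lp_cutoff(2)[OF x] e by simp
    finally show "lp_norm p (T (cutoff (- cube 0 (int n)) x)) \<le> \<epsilon> * lp_norm p x" .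
  qed
qed

lemma K_iff: "K \<in> K_ops p \<longleftrightarrow> K \<in> bounded_ops p \<and> left_tail_null K \<and> right_tail_null K"
proof
  assume K: "K \<in> K_ops p"
  then have B: "K \<in> bounded_ops p" unfolding K_ops_def by simp
  note QK = bop_comp(1)[OF Q_bop B] and KQ = bop_comp(1)[OF B Q_bop]
  have small: "\<exists>n. op_norm p (Q_op p n \<circ> K) \<le> \<epsilon> \<and> op_norm p (K \<circ> Q_op p n) \<le> \<epsilon>" if "\<epsilon> > 0" for \<epsilon>
  proof -
    have "(\<lambda>n. op_norm p (Q_op p n \<circ> K) + op_norm p (K \<circ> Q_op p n)) \<longlonglongrightarrow> 0"
      using K unfolding K_ops_def by simp
    then have "\<forall>\<^sub>F n in sequentially. op_norm p (Q_op p n \<circ> K) + op_norm p (K \<circ> Q_op p n) < \<epsilon>"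
      using that by (rule order_tendstoD(2))
    then obtain n where "op_norm p (Q_op p n \<circ> K) + op_norm p (K \<circ> Q_op p n) < \<epsilon>"
      using eventually_happens'[OF sequentially_bot] by blast
    then show ?thesis using op_norm_nonneg[OF QK, of n] op_norm_nonneg[OF KQ, of n]
      by (intro exI[of _ n]) linarith
  qed
  have "left_tail_null K" unfolding left_tail_null_def
  proof (intro allI impI)
    fix \<epsilon> :: real assume "\<epsilon> > 0"
    then obtain n where n: "op_norm p (Q_op p n \<circ> K) \<le> \<epsilon>" using small by blast
    have "lp_norm p (cutoff (- cube 0 (int n)) (K x)) \<le> \<epsilon> * lp_norm p x" if "x \<in> lp p" for x
      using op_bound[OF QK that, of n] mult_right_mono[OF n lp_norm_nonneg[OF that]]
      by (simp add: Q_apply bop_maps[OF B that])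
    then show "\<exists>n::nat. \<forall>x\<in>lp p. lp_norm p (cutoff (- cube 0 (int n)) (K x)) \<le> \<epsilon> * lp_norm p x" by blast
  qed
  moreover have "right_tail_null K" unfolding right_tail_null_def
  proof (intro allI impI)
    fix \<epsilon> :: real assume "\<epsilon> > 0"
    then obtain n where n: "op_norm p (K \<circ> Q_op p n) \<le> \<epsilon>" using small by blast
    have "lp_norm p (K (cutoff (- cube 0 (int n)) x)) \<le> \<epsilon> * lp_norm p x" if "x \<in> lp p" for x
      using op_bound[OF KQ that, of n] mult_right_mono[OF n lp_norm_nonneg[OF that]]
      by (simp add: Q_apply that)
    then show "\<exists>n::nat. \<forall>x\<in>lp p. lp_norm p (K (cutoff (- cube 0 (int n)) x)) \<le> \<epsilon> * lp_norm p x" by blast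
  qed
  ultimately show "K \<in> bounded_ops p \<and> left_tail_null K \<and> right_tail_null K" using B by blast
next
  assume "K \<in> bounded_ops p \<and> left_tail_null K \<and> right_tail_null K"
  then have B: "K \<in> bounded_ops p" and L: "left_tail_null K" and R: "right_tail_null K" by auto
  note QK = bop_comp(1)[OF Q_bop B] and KQ = bop_comp(1)[OF B Q_bop]
  have "(\<lambda>n. op_norm p (Q_op p n \<circ> K) + op_norm p (K \<circ> Q_op p n)) \<longlonglongrightarrow> 0"
  proof (rule LIMSEQ_I)
    fix r :: real assume r: "r > 0"
    then have r3: "r / 3 > 0" by simp
    obtain m where m: "\<And>n x. n \<ge> m \<Longrightarrow> x \<in> lp p \<Longrightarrow> lp_norm p (cutoff (- cube 0 (int n)) (K x)) \<le> r / 3 * lp_norm p x"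
      using left_tail_null_eventually[OF B L r3] by metis
    obtain m' where m': "\<And>n x. n \<ge> m' \<Longrightarrow> x \<in> lp p \<Longrightarrow> lp_norm p (K (cutoff (- cube 0 (int n)) x)) \<le> r / 3 * lp_norm p x"
      using right_tail_null_eventually[OF B R r3] by metis
    have "norm (op_norm p (Q_op p n \<circ> K) + op_norm p (K \<circ> Q_op p n) - 0) < r" if n: "n \<ge> max m m'" for n
    proof -
      have "op_norm p (Q_op p n \<circ> K) \<le> r / 3"
        using m[of n] n r by (intro op_norm_le) (auto simp: Q_apply bop_maps[OF B])
      moreover have "op_norm p (K \<circ> Q_op p n) \<le> r / 3"
        using m'[of n] n r by (intro op_norm_le) (auto simp: Q_apply)
      ultimately show ?thesis using op_norm_nonneg[OF QK, of n] op_norm_nonneg[OF KQ, of n] r by simp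
    qed
    then show "\<exists>no. \<forall>n\<ge>no. norm (op_norm p (Q_op p n \<circ> K) + op_norm p (K \<circ> Q_op p n) - 0) < r" by blast
  qed
  then show "K \<in> K_ops p" using B unfolding K_ops_def by simp
qed

lemma left_tail_null_comp_left:
  assumes "A \<in> bounded_ops p" "left_tail_null K"
  shows "left_tail_null (K \<circ> A)"
  unfolding left_tail_null_def
proof (intro allI impI)
  fix \<epsilon> :: real assume e: "\<epsilon> > 0"
  define a where "a = op_norm p A + 1"
  have a: "a > 0" "op_norm p A \<le> a" using op_norm_nonneg[OF assms(1)] by (auto simp: a_def)
  obtain n :: nat where n: "\<forall>x\<in>lp p. lp_norm p (cutoff (- cube 0 (int n)) (K x)) \<le> \<epsilon> / a * lp_norm p x"
    using assms(2) e a unfolding left_tail_null_def by (meson divide_pos_pos)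
  have "lp_norm p (cutoff (- cube 0 (int n)) ((K \<circ> A) x)) \<le> \<epsilon> * lp_norm p x" if x: "x \<in> lp p" for x
  proof -
    have "lp_norm p (cutoff (- cube 0 (int n)) (K (A x))) \<le> \<epsilon> / a * lp_norm p (A x)"
      using n bop_maps[OF assms(1) x] by blast
    also have "\<dots> \<le> \<epsilon> / a * (a * lp_norm p x)"
      using e a op_bound[OF assms(1) x] mult_right_mono[OF a(2) lp_norm_nonneg[OF x]]
      by (intro mult_left_mono) auto
    finally show ?thesis using a by simp
  qed
  then show "\<exists>n::nat. \<forall>x\<in>lp p. lp_norm p (cutoff (- cube 0 (int n)) ((K \<circ> A) x)) \<le> \<epsilon> * lp_norm p x" by blast
qed

lemma right_tail_null_comp_right:
  assumes "A \<in> bounded_ops p" "K \<in> bounded_ops p" "right_tail_null K"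
  shows "right_tail_null (A \<circ> K)"
  unfolding right_tail_null_def
proof (intro allI impI)
  fix \<epsilon> :: real assume e: "\<epsilon> > 0"
  define a where "a = op_norm p A + 1"
  have a: "a > 0" "op_norm p A \<le> a" using op_norm_nonneg[OF assms(1)] by (auto simp: a_def)
  obtain n :: nat where n: "\<forall>x\<in>lp p. lp_norm p (K (cutoff (- cube 0 (int n)) x)) \<le> \<epsilon> / a * lp_norm p x"
    using assms(3) e a unfolding right_tail_null_def by (meson divide_pos_pos)
  have "lp_norm p ((A \<circ> K) (cutoff (- cube 0 (int n)) x)) \<le> \<epsilon> * lp_norm p x" if x: "x \<in> lp p" for x
  proof -
    let ?y = "K (cutoff (- cube 0 (int n)) x)"
    have y: "?y \<in> lp p" using bop_in[OF assms(2)] .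
    have "lp_norm p (A ?y) \<le> a * lp_norm p ?y"
      using op_bound[OF assms(1) y] mult_right_mono[OF a(2) lp_norm_nonneg[OF y]] by linarith
    also have "\<dots> \<le> a * (\<epsilon> / a * lp_norm p x)" using a n x by (intro mult_left_mono) auto
    finally show ?thesis using a by simp
  qed
  then show "\<exists>n::nat. \<forall>x\<in>lp p. lp_norm p ((A \<circ> K) (cutoff (- cube 0 (int n)) x)) \<le> \<epsilon> * lp_norm p x" by blast
qed

lemma left_tail_null_limit:
  assumes T: "T \<in> bounded_ops p"
    and approx: "\<And>\<epsilon>. \<epsilon> > 0 \<Longrightarrow> \<exists>S\<in>bounded_ops p. left_tail_null S \<and> (\<forall>x\<in>lp p. lp_norm p (T x - S x) \<le> \<epsilon> * lp_norm p x)"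
  shows "left_tail_null T"
  unfolding left_tail_null_def
proof (intro allI impI)
  fix \<epsilon> :: real assume e: "\<epsilon> > 0"
  obtain S where S: "S \<in> bounded_ops p" "left_tail_null S" "\<forall>x\<in>lp p. lp_norm p (T x - S x) \<le> \<epsilon> / 2 * lp_norm p x"
    using approx[OF half_gt_zero[OF e]] by blast
  obtain n :: nat where n: "\<forall>x\<in>lp p. lp_norm p (cutoff (- cube 0 (int n)) (S x)) \<le> \<epsilon> / 2 * lp_norm p x"
    using S(2) e unfolding left_tail_null_def by (meson half_gt_zero)
  have "lp_norm p (cutoff (- cube 0 (int n)) (T x)) \<le> \<epsilon> * lp_norm p x" if x: "x \<in> lp p" for x
  proof -
    let ?F = "- cube 0 (int n)"
    have Tx: "T x \<in> lp p" "S x \<in> lp p" using bop_maps T S x by auto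
    have "cutoff ?F (T x) = cutoff ?F (T x - S x) + cutoff ?F (S x)" by (simp add: cutoff_diff)
    then have "lp_norm p (cutoff ?F (T x)) \<le> lp_norm p (T x - S x) + lp_norm p (cutoff ?F (S x))"
      using lp_add(2)[of "cutoff ?F (T x - S x)" "cutoff ?F (S x)"] lp_cutoff[OF lp_diff(1)[OF Tx], of ?F] lp_cutoff(1)[OF Tx(2), of ?F]
      by simp
    also have "\<dots> \<le> \<epsilon> / 2 * lp_norm p x + \<epsilon> / 2 * lp_norm p x" using S(3) n x by (intro add_mono) auto
    finally show ?thesis by simp
  qed
  then show "\<exists>n::nat. \<forall>x\<in>lp p. lp_norm p (cutoff (- cube 0 (int n)) (T x)) \<le> \<epsilon> * lp_norm p x" by blast
qed

lemma right_tail_null_limit: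
  assumes T: "T \<in> bounded_ops p"
    and approx: "\<And>\<epsilon>. \<epsilon> > 0 \<Longrightarrow> \<exists>S\<in>bounded_ops p. right_tail_null S \<and> (\<forall>x\<in>lp p. lp_norm p (T x - S x) \<le> \<epsilon> * lp_norm p x)"
  shows "right_tail_null T"
  unfolding right_tail_null_def
proof (intro allI impI)
  fix \<epsilon> :: real assume e: "\<epsilon> > 0"
  obtain S where S: "S \<in> bounded_ops p" "right_tail_null S" "\<forall>x\<in>lp p. lp_norm p (T x - S x) \<le> \<epsilon> / 2 * lp_norm p x"
    using approx[OF half_gt_zero[OF e]] by blast
  obtain n :: nat where n: "\<forall>x\<in>lp p. lp_norm p (S (cutoff (- cube 0 (int n)) x)) \<le> \<epsilon> / 2 * lp_norm p x"
    using S(2) e unfolding right_tail_null_def by (meson half_gt_zero)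
  have "lp_norm p (T (cutoff (- cube 0 (int n)) x)) \<le> \<epsilon> * lp_norm p x" if x: "x \<in> lp p" for x
  proof -
    let ?y = "cutoff (- cube 0 (int n)) x"
    have y: "?y \<in> lp p" "lp_norm p ?y \<le> lp_norm p x" using lp_cutoff[OF x] by auto
    have "lp_norm p (T ?y) \<le> lp_norm p (T ?y - S ?y) + lp_norm p (S ?y)"
      using lp_add(2)[OF lp_diff(1)[OF bop_maps[OF T y(1)] bop_maps[OF S(1) y(1)]] bop_maps[OF S(1) y(1)]] by simp
    also have "\<dots> \<le> \<epsilon> / 2 * lp_norm p ?y + \<epsilon> / 2 * lp_norm p x" using S(3) n x y by (intro add_mono) auto
    also have "\<dots> \<le> \<epsilon> / 2 * lp_norm p x + \<epsilon> / 2 * lp_norm p x"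
      using y(2) e by (intro add_right_mono mult_left_mono) auto
    finally show ?thesis by simp
  qed
  then show "\<exists>n::nat. \<forall>x\<in>lp p. lp_norm p (T (cutoff (- cube 0 (int n)) x)) \<le> \<epsilon> * lp_norm p x" by blast
qed

end

section \<open>The algebra \<open>L\<close>, its ideal \<open>K\<close>, and band-dominated operators\<close>

context lp_exponent
begin

lemma lp_zero_fun [simp]: "(\<lambda>i. 0) \<in> lp p" "lp_norm p (\<lambda>i. 0) = 0"
  using lp_zero unfolding zero_fun_def by blast+

lemma left_tail_null_add:
  assumes S: "S \<in> bounded_ops p" "left_tail_null S" and T: "T \<in> bounded_ops p" "left_tail_null T"
  shows "left_tail_null (S + T)"
  unfolding left_tail_null_def
proof (intro allI impI)
  fix \<epsilon> :: real assume "\<epsilon> > 0"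
  then have e: "\<epsilon> / 2 > 0" by simp
  obtain m where m: "\<And>n x. n \<ge> m \<Longrightarrow> x \<in> lp p \<Longrightarrow> lp_norm p (cutoff (- cube 0 (int n)) (S x)) \<le> \<epsilon> / 2 * lp_norm p x"
    using left_tail_null_eventually[OF S e] by metis
  obtain m' where m': "\<And>n x. n \<ge> m' \<Longrightarrow> x \<in> lp p \<Longrightarrow> lp_norm p (cutoff (- cube 0 (int n)) (T x)) \<le> \<epsilon> / 2 * lp_norm p x"
    using left_tail_null_eventually[OF T e] by metis
  define n where "n = max m m'"
  have "lp_norm p (cutoff (- cube 0 (int n)) ((S + T) x)) \<le> \<epsilon> * lp_norm p x" if x: "x \<in> lp p" for x
  proof -
    let ?F = "- cube 0 (int n)"
    have "lp_norm p (cutoff ?F (S x) + cutoff ?F (T x)) \<le> lp_norm p (cutoff ?F (S x)) + lp_norm p (cutoff ?F (T x))"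
      by (intro lp_add lp_cutoff bop_maps[OF S(1)] bop_maps[OF T(1)] x)
    also have "\<dots> \<le> \<epsilon> / 2 * lp_norm p x + \<epsilon> / 2 * lp_norm p x"
      using m[of n x] m'[of n x] x by (intro add_mono) (auto simp: n_def)
    finally show ?thesis by (simp add: cutoff_add)
  qed
  then show "\<exists>n::nat. \<forall>x\<in>lp p. lp_norm p (cutoff (- cube 0 (int n)) ((S + T) x)) \<le> \<epsilon> * lp_norm p x" by blast
qed

lemma right_tail_null_add:
  assumes S: "S \<in> bounded_ops p" "right_tail_null S" and T: "T \<in> bounded_ops p" "right_tail_null T"
  shows "right_tail_null (S + T)"
  unfolding right_tail_null_def
proof (intro allI impI)
  fix \<epsilon> :: real assume "\<epsilon> > 0"
  then have e: "\<epsilon> / 2 > 0" by simp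
  obtain m where m: "\<And>n x. n \<ge> m \<Longrightarrow> x \<in> lp p \<Longrightarrow> lp_norm p (S (cutoff (- cube 0 (int n)) x)) \<le> \<epsilon> / 2 * lp_norm p x"
    using right_tail_null_eventually[OF S e] by metis
  obtain m' where m': "\<And>n x. n \<ge> m' \<Longrightarrow> x \<in> lp p \<Longrightarrow> lp_norm p (T (cutoff (- cube 0 (int n)) x)) \<le> \<epsilon> / 2 * lp_norm p x"
    using right_tail_null_eventually[OF T e] by metis
  define n where "n = max m m'"
  have "lp_norm p ((S + T) (cutoff (- cube 0 (int n)) x)) \<le> \<epsilon> * lp_norm p x" if x: "x \<in> lp p" for x
  proof -
    let ?y = "cutoff (- cube 0 (int n)) x"
    have "lp_norm p (S ?y + T ?y) \<le> lp_norm p (S ?y) + lp_norm p (T ?y)"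
      by (intro lp_add bop_in S(1) T(1))
    also have "\<dots> \<le> \<epsilon> / 2 * lp_norm p x + \<epsilon> / 2 * lp_norm p x"
      using m[of n x] m'[of n x] x by (intro add_mono) (auto simp: n_def)
    finally show ?thesis by simp
  qed
  then show "\<exists>n::nat. \<forall>x\<in>lp p. lp_norm p ((S + T) (cutoff (- cube 0 (int n)) x)) \<le> \<epsilon> * lp_norm p x" by blast
qed

lemma cutoff_uminus: "cutoff F (- x) = - cutoff F x"
  by (auto simp: fun_eq_iff cutoff_apply)

lemma tail_uminus:
  assumes T: "T \<in> bounded_ops p"
  shows "left_tail_null T \<Longrightarrow> left_tail_null (- T)" "right_tail_null T \<Longrightarrow> right_tail_null (- T)"
  unfolding left_tail_null_def right_tail_null_def
  by (simp_all add: cutoff_uminus lp_minus lp_cutoff bop_in[OF T])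

lemma K_bop: "K \<in> K_ops p \<Longrightarrow> K \<in> bounded_ops p" by (simp add: K_iff)

lemma K_add: "S \<in> K_ops p \<Longrightarrow> T \<in> K_ops p \<Longrightarrow> S + T \<in> K_ops p"
  unfolding K_iff using bop_plus(1) left_tail_null_add right_tail_null_add by blast

lemma K_uminus: "T \<in> K_ops p \<Longrightarrow> - T \<in> K_ops p"
  unfolding K_iff using bop_uminus tail_uminus by blast

lemma K_diff: "S \<in> K_ops p \<Longrightarrow> T \<in> K_ops p \<Longrightarrow> S - T \<in> K_ops p"
  by (metis K_add K_uminus diff_conv_add_uminus)

text \<open>
  A finite set of indices lies in some cube, beyond which both tails are zero.
\<close>

lemma cutoff_finite_K:
  assumes "finite F"
  shows "on_lp p (cutoff F) \<in> K_ops p"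
proof -
  obtain n :: nat where n: "F \<subseteq> cube 0 (int n)"
  proof -
    have "\<exists>n::nat. F \<subseteq> cube 0 (int n)" using assms
    proof (induction F rule: finite_induct)
      case (insert i F)
      then obtain n :: nat where n: "F \<subseteq> cube 0 (int n)" by blast
      define m where "m = nat (Max (range (\<lambda>j. \<bar>i $ j\<bar>)))"
      have "\<bar>i $ j\<bar> \<le> int m" for j
      proof -
        have "\<bar>i $ j\<bar> \<le> Max (range (\<lambda>j. \<bar>i $ j\<bar>))" by (rule Max_ge) auto
        then show ?thesis unfolding m_def by linarith
      qed
      then have "i \<in> cube 0 (int (max m n))" unfolding mem_cube
        by (metis diff_zero max.cobounded1 of_nat_mono order_trans zero_index)
      moreover have "F \<subseteq> cube 0 (int (max m n))" using n cube_mono[of "int n" "int (max m n)" 0] by auto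
      ultimately show ?case by blast
    qed simp
    then show ?thesis using that by blast
  qed
  then have z: "cutoff (- cube 0 (int n)) (cutoff F x) = 0" "cutoff F (cutoff (- cube 0 (int n)) x) = 0"
    for x :: "('a, 'b) seq"
    by (auto simp: fun_eq_iff cutoff_apply)
  have "left_tail_null (on_lp p (cutoff F) :: ('a, 'b) seq_op)" unfolding left_tail_null_def
    by (intro allI impI exI[of _ n]) (simp add: on_lp_apply z lp_norm_nonneg)
  moreover have "right_tail_null (on_lp p (cutoff F) :: ('a, 'b) seq_op)" unfolding right_tail_null_def
    by (intro allI impI exI[of _ n]) (simp add: on_lp_apply z lp_norm_nonneg lp_cutoff)
  ultimately show ?thesis unfolding K_iff using cutoff_op_bop by blast
qed

lemma P_K: "P_op p n \<in> K_ops p"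
  unfolding P_op_eq by (rule cutoff_finite_K) simp

lemma K_limit:
  assumes T: "T \<in> bounded_ops p"
    and approx: "\<And>\<epsilon>. \<epsilon> > 0 \<Longrightarrow> \<exists>S\<in>K_ops p. \<forall>x\<in>lp p. lp_norm p (T x - S x) \<le> \<epsilon> * lp_norm p x"
  shows "T \<in> K_ops p"
proof -
  have "left_tail_null T" by (rule left_tail_null_limit[OF T]) (use approx K_iff in blast)
  moreover have "right_tail_null T" by (rule right_tail_null_limit[OF T]) (use approx K_iff in blast)
  ultimately show ?thesis using T K_iff by blast
qed

lemma comp_add_right: "A \<in> bounded_ops p \<Longrightarrow> S \<in> bounded_ops p \<Longrightarrow> T \<in> bounded_ops p \<Longrightarrow> A \<circ> (S + T) = (A \<circ> S) + (A \<circ> T)"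
  by (rule ext) (simp add: bop_add[of A] bop_in)

lemma comp_diff_right: "A \<in> bounded_ops p \<Longrightarrow> S \<in> bounded_ops p \<Longrightarrow> T \<in> bounded_ops p \<Longrightarrow> A \<circ> (S - T) = (A \<circ> S) - (A \<circ> T)"
  by (rule ext) (simp add: bop_diff[of A] bop_in)

lemma comp_add_left: "(S + T) \<circ> A = (S \<circ> A) + (T \<circ> A)" for A S T :: "('n::finite, 'x::complex_banach) seq_op"
  by (rule ext) simp

lemma comp_diff_left: "(S - T) \<circ> A = (S \<circ> A) - (T \<circ> A)" for A S T :: "('n::finite, 'x::complex_banach) seq_op"
  by (rule ext) simp

text \<open>
  Membership in \<open>L\<close> need only be tested on the projections \<open>P\<^sub>m\<close>: an element of \<open>K\<close> is a norm limit of its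
  compressions on either side, which reduces \<open>A K\<close> to \<open>A P\<^sub>m K\<close> and \<open>K A\<close> to \<open>K P\<^sub>m A\<close>.
\<close>

lemma L_iff: "A \<in> L_ops p \<longleftrightarrow> A \<in> bounded_ops p \<and> (\<forall>m. left_tail_null (A \<circ> P_op p m) \<and> right_tail_null (P_op p m \<circ> A))"
proof
  assume "A \<in> L_ops p"
  then show "A \<in> bounded_ops p \<and> (\<forall>m. left_tail_null (A \<circ> P_op p m) \<and> right_tail_null (P_op p m \<circ> A))"
    unfolding L_ops_def using P_K K_iff by blast
next
  assume "A \<in> bounded_ops p \<and> (\<forall>m. left_tail_null (A \<circ> P_op p m) \<and> right_tail_null (P_op p m \<circ> A))"
  then have A: "A \<in> bounded_ops p" and l: "\<And>m. left_tail_null (A \<circ> P_op p m)" and r: "\<And>m. right_tail_null (P_op p m \<circ> A)" by auto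
  have "A \<circ> K \<in> K_ops p \<and> K \<circ> A \<in> K_ops p" if K: "K \<in> K_ops p" for K
  proof -
    have KB: "K \<in> bounded_ops p" and KL: "left_tail_null K" and KR: "right_tail_null K" using K K_iff by auto
    have AK: "A \<circ> K \<in> bounded_ops p" and KA: "K \<circ> A \<in> bounded_ops p" using A KB bop_comp by auto
    have "left_tail_null (A \<circ> K)"
    proof (rule left_tail_null_limit[OF AK])
      fix \<epsilon> :: real assume e: "\<epsilon> > 0"
      define a where "a = op_norm p A + 1"
      have a: "a > 0" "op_norm p A \<le> a" using op_norm_nonneg[OF A] by (auto simp: a_def)
      obtain m :: nat where m: "\<forall>x\<in>lp p. lp_norm p (cutoff (- cube 0 (int m)) (K x)) \<le> \<epsilon> / a * lp_norm p x"
        using KL e a unfolding left_tail_null_def by (meson divide_pos_pos)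
      let ?S = "(A \<circ> P_op p m) \<circ> K"
      have "lp_norm p ((A \<circ> K) x - ?S x) \<le> \<epsilon> * lp_norm p x" if x: "x \<in> lp p" for x
      proof -
        have Kx: "K x \<in> lp p" using bop_maps[OF KB x] .
        let ?y = "cutoff (- cube 0 (int m)) (K x)"
        have y: "?y \<in> lp p" using lp_cutoff(1)[OF Kx] .
        have "K x - cutoff (cube 0 (int m)) (K x) = ?y" by (auto simp: fun_eq_iff cutoff_apply)
        then have "(A \<circ> K) x - ?S x = A ?y"
          using bop_diff[OF A Kx lp_cutoff(1)[OF Kx, of "cube 0 (int m)"]] by (simp add: P_apply Kx)
        then have "lp_norm p ((A \<circ> K) x - ?S x) = lp_norm p (A ?y)" by (rule arg_cong)
        also have "\<dots> \<le> a * lp_norm p ?y"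
          using op_bound[OF A y] mult_right_mono[OF a(2) lp_norm_nonneg[OF y]] by linarith
        also have "\<dots> \<le> a * (\<epsilon> / a * lp_norm p x)" using a m x by (intro mult_left_mono) auto
        finally show ?thesis using a by simp
      qed
      moreover have "left_tail_null ?S" by (rule left_tail_null_comp_left[OF KB l])
      moreover have "?S \<in> bounded_ops p" using bop_comp(1) A KB P_bop by blast
      ultimately show "\<exists>S\<in>bounded_ops p. left_tail_null S \<and> (\<forall>x\<in>lp p. lp_norm p ((A \<circ> K) x - S x) \<le> \<epsilon> * lp_norm p x)" by blast
    qed
    moreover have "right_tail_null (K \<circ> A)"
    proof (rule right_tail_null_limit[OF KA])
      fix \<epsilon> :: real assume e: "\<epsilon> > 0"
      define a where "a = op_norm p A + 1"
      have a: "a > 0" "op_norm p A \<le> a" using op_norm_nonneg[OF A] by (auto simp: a_def)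
      obtain m :: nat where m: "\<forall>x\<in>lp p. lp_norm p (K (cutoff (- cube 0 (int m)) x)) \<le> \<epsilon> / a * lp_norm p x"
        using KR e a unfolding right_tail_null_def by (meson divide_pos_pos)
      let ?S = "K \<circ> (P_op p m \<circ> A)"
      have "lp_norm p ((K \<circ> A) x - ?S x) \<le> \<epsilon> * lp_norm p x" if x: "x \<in> lp p" for x
      proof -
        have Ax: "A x \<in> lp p" using bop_maps[OF A x] .
        have "A x - cutoff (cube 0 (int m)) (A x) = cutoff (- cube 0 (int m)) (A x)" by (auto simp: fun_eq_iff cutoff_apply)
        then have "(K \<circ> A) x - ?S x = K (cutoff (- cube 0 (int m)) (A x))"
          using bop_diff[OF KB Ax lp_cutoff(1)[OF Ax, of "cube 0 (int m)"]] by (simp add: P_apply Ax)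
        then have "lp_norm p ((K \<circ> A) x - ?S x) = lp_norm p (K (cutoff (- cube 0 (int m)) (A x)))" by (rule arg_cong)
        also have "\<dots> \<le> \<epsilon> / a * lp_norm p (A x)" using m Ax by blast
        also have "\<dots> \<le> \<epsilon> / a * (a * lp_norm p x)"
          using e a op_bound[OF A x] mult_right_mono[OF a(2) lp_norm_nonneg[OF x]]
          by (intro mult_left_mono) auto
        finally show ?thesis using a by simp
      qed
      moreover have "right_tail_null ?S" by (rule right_tail_null_comp_right[OF KB bop_comp(1)[OF P_bop A] r])
      moreover have "?S \<in> bounded_ops p" using bop_comp(1) A KB P_bop by blast
      ultimately show "\<exists>S\<in>bounded_ops p. right_tail_null S \<and> (\<forall>x\<in>lp p. lp_norm p ((K \<circ> A) x - S x) \<le> \<epsilon> * lp_norm p x)" by blast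
    qed
    ultimately show ?thesis
      using AK KA right_tail_null_comp_right[OF A KB KR] left_tail_null_comp_left[OF A KL] K_iff by blast
  qed
  then show "A \<in> L_ops p" using A unfolding L_ops_def by blast
qed

lemma L_bop: "A \<in> L_ops p \<Longrightarrow> A \<in> bounded_ops p" by (simp add: L_ops_def)

lemma L_K: "A \<in> L_ops p \<Longrightarrow> K \<in> K_ops p \<Longrightarrow> A \<circ> K \<in> K_ops p"
  and K_L: "A \<in> L_ops p \<Longrightarrow> K \<in> K_ops p \<Longrightarrow> K \<circ> A \<in> K_ops p"
  unfolding L_ops_def by blast+

lemma L_comp: "A \<in> L_ops p \<Longrightarrow> B \<in> L_ops p \<Longrightarrow> A \<circ> B \<in> L_ops p"
proof -
  assume A: "A \<in> L_ops p" and B: "B \<in> L_ops p"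
  have "(A \<circ> B) \<circ> K \<in> K_ops p \<and> K \<circ> (A \<circ> B) \<in> K_ops p" if K: "K \<in> K_ops p" for K
    using L_K[OF A L_K[OF B K]] K_L[OF B K_L[OF A K]] unfolding o_assoc by blast
  then show "A \<circ> B \<in> L_ops p" using bop_comp(1)[OF L_bop[OF A] L_bop[OF B]] unfolding L_ops_def by blast
qed

lemma L_add: "A \<in> L_ops p \<Longrightarrow> B \<in> L_ops p \<Longrightarrow> A + B \<in> L_ops p"
proof -
  assume A: "A \<in> L_ops p" and B: "B \<in> L_ops p"
  have "(A + B) \<circ> K \<in> K_ops p \<and> K \<circ> (A + B) \<in> K_ops p" if K: "K \<in> K_ops p" for K
    unfolding comp_add_left comp_add_right[OF K_bop[OF K] L_bop[OF A] L_bop[OF B]]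
    using K_add L_K[OF A K] L_K[OF B K] K_L[OF A K] K_L[OF B K] by blast
  then show "A + B \<in> L_ops p" using bop_plus(1)[OF L_bop[OF A] L_bop[OF B]] unfolding L_ops_def by blast
qed

lemma L_uminus: "A \<in> L_ops p \<Longrightarrow> - A \<in> L_ops p"
proof -
  assume A: "A \<in> L_ops p"
  have "- A \<circ> K = - (A \<circ> K)" for K by (rule ext) simp
  moreover have "K \<circ> - A = - (K \<circ> A)" if "K \<in> K_ops p" for K
    by (rule ext) (simp add: bop_minus[OF K_bop[OF that]] bop_in[OF L_bop[OF A]])
  ultimately have "- A \<circ> K \<in> K_ops p \<and> K \<circ> - A \<in> K_ops p" if "K \<in> K_ops p" for K
    using that K_uminus L_K[OF A that] K_L[OF A that] by metis
  then show "- A \<in> L_ops p"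
    using bop_uminus[OF L_bop[OF A]] unfolding L_ops_def by blast
qed

lemma L_id: "id_op p \<in> L_ops p"
  unfolding L_ops_def using id_bop by (auto simp: comp_id K_bop)

lemma K_subset_L: "K \<in> K_ops p \<Longrightarrow> K \<in> L_ops p"
  unfolding L_iff K_iff using left_tail_null_comp_left[OF P_bop] right_tail_null_comp_right[OF P_bop] by blast

lemma L_sum:
  fixes T :: "'k \<Rightarrow> ('n::finite, 'x::complex_banach) seq_op"
  shows "(\<And>k. k \<in> F \<Longrightarrow> T k \<in> L_ops p) \<Longrightarrow> (\<Sum>k\<in>F. T k) \<in> L_ops p"
proof (induction F rule: infinite_finite_induct)
  case (insert k F)
  then show ?case unfolding sum.insert[OF insert(1,2)] using L_add by blast
next
  have "id_op p + - id_op p = (0 :: ('n, 'x) seq_op)" by (rule right_minus)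
  then have z: "(0 :: ('n, 'x) seq_op) \<in> L_ops p" using L_add[OF L_id L_uminus[OF L_id]] by metis
  show "sum T {} \<in> L_ops p" unfolding sum.empty by (rule z)
  show "sum T F \<in> L_ops p" if "infinite F" for F unfolding sum.infinite[OF that] by (rule z)
qed

lemma L_limit:
  assumes T: "T \<in> bounded_ops p"
    and approx: "\<And>\<epsilon>. \<epsilon> > 0 \<Longrightarrow> \<exists>S\<in>L_ops p. \<forall>x\<in>lp p. lp_norm p (T x - S x) \<le> \<epsilon> * lp_norm p x"
  shows "T \<in> L_ops p"
  unfolding L_iff
proof (intro conjI allI T)
  fix m
  show "left_tail_null (T \<circ> P_op p m)"
  proof (rule left_tail_null_limit[OF bop_comp(1)[OF T P_bop]])
    fix \<epsilon> :: real assume e: "\<epsilon> > 0"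
    then obtain S where S: "S \<in> L_ops p" "\<forall>x\<in>lp p. lp_norm p (T x - S x) \<le> \<epsilon> * lp_norm p x"
      using approx by blast
    have "lp_norm p ((T \<circ> P_op p m) x - (S \<circ> P_op p m) x) \<le> \<epsilon> * lp_norm p x" if x: "x \<in> lp p" for x
      using bspec[OF S(2) bop_maps[OF P_bop x, of m]] lp_cutoff(2)[OF x] e
      by (simp add: P_apply x) (smt (verit) mult_left_mono)
    then show "\<exists>S\<in>bounded_ops p. left_tail_null S \<and> (\<forall>x\<in>lp p. lp_norm p ((T \<circ> P_op p m) x - S x) \<le> \<epsilon> * lp_norm p x)"
      using S(1) L_iff bop_comp(1) P_bop by blast
  qed
  show "right_tail_null (P_op p m \<circ> T)"
  proof (rule right_tail_null_limit[OF bop_comp(1)[OF P_bop T]])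
    fix \<epsilon> :: real assume e: "\<epsilon> > 0"
    then obtain S where S: "S \<in> L_ops p" "\<forall>x\<in>lp p. lp_norm p (T x - S x) \<le> \<epsilon> * lp_norm p x"
      using approx by blast
    have "lp_norm p ((P_op p m \<circ> T) x - (P_op p m \<circ> S) x) \<le> \<epsilon> * lp_norm p x" if x: "x \<in> lp p" for x
    proof -
      have i: "T x \<in> lp p" "S x \<in> lp p" using bop_maps x T L_bop[OF S(1)] by auto
      have "(P_op p m \<circ> T) x - (P_op p m \<circ> S) x = cutoff (cube 0 (int m)) (T x - S x)"
        using i by (simp add: P_apply cutoff_diff)
      then show ?thesis using lp_cutoff(2)[OF lp_diff(1)[OF i], of "cube 0 (int m)"] S(2) x by force
    qed
    then show "\<exists>S\<in>bounded_ops p. right_tail_null S \<and> (\<forall>x\<in>lp p. lp_norm p ((P_op p m \<circ> T) x - S x) \<le> \<epsilon> * lp_norm p x)"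
      using S(1) L_iff bop_comp(1) P_bop by blast
  qed
qed

text \<open>
  Finite propagation as a property of the operator: its value at \<open>i\<close> depends only on the cube of radius
  \<open>b\<close> around \<open>i\<close>. Unlike the explicit form of a band operator this is immediate for patched operators too.
\<close>

definition propagates :: "int \<Rightarrow> ('n::finite, 'x::complex_banach) seq_op \<Rightarrow> bool"
  where "propagates b T \<longleftrightarrow> (\<forall>x\<in>lp p. \<forall>i. (\<forall>j\<in>cube i b. x j = 0) \<longrightarrow> T x i = 0)"

lemma propagates_mono: "propagates b T \<Longrightarrow> b \<le> c \<Longrightarrow> propagates c T"
  unfolding propagates_def using cube_mono[of b c] by blast

lemma propagates_L:
  assumes T: "T \<in> bounded_ops p" and b: "propagates b T"
  shows "T \<in> L_ops p"
  unfolding L_iff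
proof (intro conjI allI T)
  fix m
  define n where "n = m + nat b"
  have far: "j \<notin> cube 0 (int m)" if "i \<notin> cube 0 (int n)" "j \<in> cube i b" for i j :: "int ^ 'a"
  proof
    assume "j \<in> cube 0 (int m)"
    with that(2) have "i \<in> cube 0 (b + int m)" using cube_trans cube_sym by blast
    moreover have "cube 0 (b + int m) \<subseteq> (cube 0 (int n) :: (int ^ 'a) set)"
      by (rule cube_mono) (simp add: n_def)
    ultimately show False using that(1) by blast
  qed
  have "cutoff (- cube 0 (int n)) (T (cutoff (cube 0 (int m)) x)) = 0" if x: "x \<in> lp p" for x
  proof
    fix i
    show "cutoff (- cube 0 (int n)) (T (cutoff (cube 0 (int m)) x)) i = 0 i"
    proof (cases "i \<in> cube 0 (int n)")
      case False
      then have "\<forall>j\<in>cube i b. cutoff (cube 0 (int m)) x j = 0" using far by (simp add: cutoff_apply)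
      then have "T (cutoff (cube 0 (int m)) x) i = 0"
        using b lp_cutoff(1)[OF x] unfolding propagates_def by blast
      then show ?thesis by (simp add: cutoff_apply)
    qed (simp add: cutoff_apply)
  qed
  then show "left_tail_null (T \<circ> P_op p m)" unfolding left_tail_null_def
    by (intro allI impI exI[of _ n]) (simp add: P_apply lp_norm_nonneg)
  have far': "j \<in> cube 0 (int n)" if "i \<in> cube 0 (int m)" "j \<in> cube i b" for i j :: "int ^ 'a"
    using far cube_sym that by blast
  have "cutoff (cube 0 (int m)) (T (cutoff (- cube 0 (int n)) x)) = 0" if x: "x \<in> lp p" for x
  proof
    fix i
    show "cutoff (cube 0 (int m)) (T (cutoff (- cube 0 (int n)) x)) i = 0 i"
    proof (cases "i \<in> cube 0 (int m)")
      case True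
      then have "\<forall>j\<in>cube i b. cutoff (- cube 0 (int n)) x j = 0" using far' by (simp add: cutoff_apply)
      then have "T (cutoff (- cube 0 (int n)) x) i = 0"
        using b lp_cutoff(1)[OF x] unfolding propagates_def by blast
      then show ?thesis by (simp add: cutoff_apply)
    qed (simp add: cutoff_apply)
  qed
  then show "right_tail_null (P_op p m \<circ> T)" unfolding right_tail_null_def
    by (intro allI impI exI[of _ n]) (simp add: P_apply lp_norm_nonneg bop_in[OF T])
qed

text \<open>
  The cubes play the role of metric balls, so this is a Lipschitz condition in the maximum norm, for
  functions with values in the unit interval.
\<close>

definition slow :: "real \<Rightarrow> (int ^ 'n::finite \<Rightarrow> real) \<Rightarrow> bool"
  where "slow L \<phi> \<longleftrightarrow> (\<forall>i. 0 \<le> \<phi> i \<and> \<phi> i \<le> 1) \<and> (\<forall>i r j. j \<in> cube i r \<longrightarrow> \<bar>\<phi> i - \<phi> j\<bar> \<le> L * real_of_int r)"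

text \<open>
  Commutators with slowly varying functions are small. This is the only consequence of band-domination
  that is needed to localise solutions, and it passes to norm limits.
\<close>

definition nearly_local :: "('n::finite, 'x::complex_banach) seq_op \<Rightarrow> bool"
  where "nearly_local T \<longleftrightarrow> (\<forall>\<epsilon>>0. \<exists>L>0. \<forall>\<phi>. slow L \<phi> \<longrightarrow>
    (\<forall>x\<in>lp p. lp_norm p (T (weight \<phi> x) - weight \<phi> (T x)) \<le> \<epsilon> * lp_norm p x))"

lemma slow_abs: "slow L \<phi> \<Longrightarrow> \<bar>\<phi> i\<bar> \<le> 1" unfolding slow_def by (simp add: abs_le_iff)

lemma slow_mono:
  assumes "slow L \<phi>" "L \<le> M"
  shows "slow M \<phi>"
  unfolding slow_def
proof (intro conjI allI impI)
  fix i j :: "int ^ 'a" and r assume j: "j \<in> cube i r"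
  have "0 \<le> r" using j unfolding mem_cube by (meson abs_ge_zero order_trans)
  then have "L * real_of_int r \<le> M * real_of_int r" using assms(2) by (intro mult_right_mono) auto
  then show "\<bar>\<phi> i - \<phi> j\<bar> \<le> M * real_of_int r" using assms(1) j unfolding slow_def by (meson order_trans)
qed (use assms(1) in \<open>auto simp: slow_def\<close>)

lemma slow_lp_weight: "slow L \<phi> \<Longrightarrow> x \<in> lp p \<Longrightarrow> weight \<phi> x \<in> lp p \<and> lp_norm p (weight \<phi> x) \<le> lp_norm p x"
  using lp_weight slow_abs by blast

lemma nearly_local_add:
  assumes S: "S \<in> bounded_ops p" "nearly_local S" and T: "T \<in> bounded_ops p" "nearly_local T"
  shows "nearly_local (S + T)"
  unfolding nearly_local_def
proof (intro allI impI)
  fix \<epsilon> :: real assume "\<epsilon> > 0"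
  then have e: "\<epsilon> / 2 > 0" by simp
  obtain L where L: "L > 0" "\<And>\<phi> x. slow L \<phi> \<Longrightarrow> x \<in> lp p \<Longrightarrow> lp_norm p (S (weight \<phi> x) - weight \<phi> (S x)) \<le> \<epsilon> / 2 * lp_norm p x"
    using S(2) e unfolding nearly_local_def by meson
  obtain M where M: "M > 0" "\<And>\<phi> x. slow M \<phi> \<Longrightarrow> x \<in> lp p \<Longrightarrow> lp_norm p (T (weight \<phi> x) - weight \<phi> (T x)) \<le> \<epsilon> / 2 * lp_norm p x"
    using T(2) e unfolding nearly_local_def by meson
  have "lp_norm p ((S + T) (weight \<phi> x) - weight \<phi> ((S + T) x)) \<le> \<epsilon> * lp_norm p x"
    if \<phi>: "slow (min L M) \<phi>" and x: "x \<in> lp p" for \<phi> x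
  proof -
    have sl: "slow L \<phi>" "slow M \<phi>" using slow_mono[OF \<phi>] by auto
    have "(S + T) (weight \<phi> x) - weight \<phi> ((S + T) x) = (S (weight \<phi> x) - weight \<phi> (S x)) + (T (weight \<phi> x) - weight \<phi> (T x))"
      by (simp add: weight_add)
    then have "lp_norm p ((S + T) (weight \<phi> x) - weight \<phi> ((S + T) x)) =
        lp_norm p ((S (weight \<phi> x) - weight \<phi> (S x)) + (T (weight \<phi> x) - weight \<phi> (T x)))" by (rule arg_cong)
    also have "\<dots> \<le> lp_norm p (S (weight \<phi> x) - weight \<phi> (S x)) + lp_norm p (T (weight \<phi> x) - weight \<phi> (T x))"
    proof (rule lp_add(2))
      show "S (weight \<phi> x) - weight \<phi> (S x) \<in> lp p"
        using lp_diff(1)[OF bop_in[OF S(1)]] slow_lp_weight[OF \<phi> bop_in[OF S(1)]] by blast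
      show "T (weight \<phi> x) - weight \<phi> (T x) \<in> lp p"
        using lp_diff(1)[OF bop_in[OF T(1)]] slow_lp_weight[OF \<phi> bop_in[OF T(1)]] by blast
    qed
    also have "\<dots> \<le> \<epsilon> / 2 * lp_norm p x + \<epsilon> / 2 * lp_norm p x"
      by (rule add_mono[OF L(2)[OF sl(1) x] M(2)[OF sl(2) x]])
    finally show ?thesis by simp
  qed
  then show "\<exists>L>0. \<forall>\<phi>. slow L \<phi> \<longrightarrow> (\<forall>x\<in>lp p. lp_norm p ((S + T) (weight \<phi> x) - weight \<phi> ((S + T) x)) \<le> \<epsilon> * lp_norm p x)"
    using L(1) M(1) by (intro exI[of _ "min L M"]) auto
qed

lemma nearly_local_limit:
  assumes T: "T \<in> bounded_ops p"
    and approx: "\<And>\<epsilon>. \<epsilon> > 0 \<Longrightarrow> \<exists>S\<in>bounded_ops p. nearly_local S \<and> (\<forall>x\<in>lp p. lp_norm p (T x - S x) \<le> \<epsilon> * lp_norm p x)"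
  shows "nearly_local T"
  unfolding nearly_local_def
proof (intro allI impI)
  fix \<epsilon> :: real assume "\<epsilon> > 0"
  then have e: "\<epsilon> / 3 > 0" by simp
  obtain S where S: "S \<in> bounded_ops p" "nearly_local S" "\<And>x. x \<in> lp p \<Longrightarrow> lp_norm p (T x - S x) \<le> \<epsilon> / 3 * lp_norm p x"
    using approx[OF e] by blast
  obtain L where L: "L > 0" "\<And>\<phi> x. slow L \<phi> \<Longrightarrow> x \<in> lp p \<Longrightarrow> lp_norm p (S (weight \<phi> x) - weight \<phi> (S x)) \<le> \<epsilon> / 3 * lp_norm p x"
    using S(2) e unfolding nearly_local_def by meson
  have "lp_norm p (T (weight \<phi> x) - weight \<phi> (T x)) \<le> \<epsilon> * lp_norm p x"
    if \<phi>: "slow L \<phi>" and x: "x \<in> lp p" for \<phi> x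
  proof -
    have w: "weight \<phi> x \<in> lp p" "lp_norm p (weight \<phi> x) \<le> lp_norm p x" using slow_lp_weight[OF \<phi> x] by auto
    have Tx: "T x - S x \<in> lp p" using lp_diff(1) bop_maps x S(1) T by blast
    let ?a = "T (weight \<phi> x) - S (weight \<phi> x)" and ?b = "S (weight \<phi> x) - weight \<phi> (S x)" and ?c = "weight \<phi> (T x - S x)"
    have abc: "?a \<in> lp p" "?b \<in> lp p" "?c \<in> lp p"
      using lp_diff(1) bop_in S(1) T slow_lp_weight[OF \<phi>] Tx by blast+
    have eq: "T (weight \<phi> x) - weight \<phi> (T x) = (?a + ?b) - ?c" by (simp add: weight_diff)
    have "lp_norm p (T (weight \<phi> x) - weight \<phi> (T x)) \<le> lp_norm p ?a + lp_norm p ?b + lp_norm p ?c"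
      unfolding eq using lp_diff(2)[OF lp_add(1)[OF abc(1,2)] abc(3)] lp_add(2)[OF abc(1,2)] by linarith
    moreover have "lp_norm p ?a \<le> \<epsilon> / 3 * lp_norm p x"
      using S(3)[OF w(1)] mult_left_mono[OF w(2), of "\<epsilon> / 3"] e by linarith
    moreover have "lp_norm p ?c \<le> \<epsilon> / 3 * lp_norm p x"
      using S(3)[OF x] slow_lp_weight[OF \<phi> Tx] by linarith
    moreover note L(2)[OF \<phi> x]
    ultimately show ?thesis by linarith
  qed
  then show "\<exists>L>0. \<forall>\<phi>. slow L \<phi> \<longrightarrow> (\<forall>x\<in>lp p. lp_norm p (T (weight \<phi> x) - weight \<phi> (T x)) \<le> \<epsilon> * lp_norm p x)"
    using L(1) by blast
qed

text \<open>
  For a single diagonal the commutator with \<open>\<phi>\<close> is multiplication by \<open>\<phi> (i - \<alpha>) - \<phi> i\<close> after the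
  shift, and \<open>i - \<alpha>\<close> lies within distance \<open>|\<alpha>|\<close> of \<open>i\<close>.
\<close>

lemma band_term:
  fixes a :: "int ^ 'n::finite \<Rightarrow> 'x::complex_banach \<Rightarrow>\<^sub>L 'x" and \<alpha> :: "int ^ 'n"
  assumes a: "a \<in> linf_coeff"
  defines "T \<equiv> mult_op p a \<circ> shift_op p \<alpha>"
  shows "T \<in> bounded_ops p" "\<exists>b\<ge>0. propagates b T" "nearly_local T"
proof -
  obtain C0 where "\<forall>i. norm (a i) \<le> C0" using a unfolding linf_coeff_def bounded_iff by auto
  then obtain C where C: "C > 0" "\<And>i. norm (a i) \<le> C"
    by (metis linorder_not_le max.coboundedI1 max.strict_coboundedI2 zero_less_one)
  have ah: "blinfun_apply (a i) (c *\<^sub>C v) = c *\<^sub>C blinfun_apply (a i) v" for i c v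
    using a unfolding linf_coeff_def by blast
  define M where "M x = (\<lambda>i. blinfun_apply (a i) (x i))" for x
  have Mb: "M x \<in> lp p \<and> lp_norm p (M x) \<le> C * lp_norm p x" if "x \<in> lp p" for x
  proof -
    have "norm (M x i) \<le> C * norm (x i)" for i
      unfolding M_def using norm_blinfun[of "a i" "x i"] mult_right_mono[OF C(2)[of i] norm_ge_zero[of "x i"]] by linarith
    then show ?thesis using lp_dominated[OF that, of "M x" C] C(1) by simp
  qed
  have "mult_op p a \<in> bounded_ops p" unfolding mult_op_def M_def[symmetric]
    by (rule on_lp_bop[where C = C]) (use Mb in \<open>auto simp: M_def fun_eq_iff blinfun.add_right ah\<close>)
  then show T: "T \<in> bounded_ops p" unfolding T_def using bop_comp(1) shift_bop by blast
  have T_apply: "T x i = blinfun_apply (a i) (x (i - \<alpha>))" if "x \<in> lp p" for x i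
    using that lp_shift[OF that, of \<alpha>] by (simp add: T_def mult_op_def shift_apply on_lp_apply)
  define b where "b = Max (range (\<lambda>j. \<bar>\<alpha> $ j\<bar>))"
  have ab: "\<bar>\<alpha> $ j\<bar> \<le> b" for j unfolding b_def by (rule Max_ge) auto
  then have b0: "b \<ge> 0" using abs_ge_zero order_trans by blast
  have near: "i - \<alpha> \<in> cube i b" for i using ab by (simp add: mem_cube)
  have "propagates b T" unfolding propagates_def using near T_apply by simp
  then show "\<exists>b\<ge>0. propagates b T" using b0 by blast
  show "nearly_local T" unfolding nearly_local_def
  proof (intro allI impI)
    fix \<epsilon> :: real assume e: "\<epsilon> > 0"
    \<comment> \<open>\<open>b + 1\<close> rather than \<open>b\<close>, which is \<open>0\<close> on the main diagonal.\<close>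
    define L where "L = \<epsilon> / (C * (b + 1))"
    have L: "L > 0" using e C(1) b0 by (simp add: L_def)
    have "lp_norm p (T (weight \<phi> x) - weight \<phi> (T x)) \<le> \<epsilon> * lp_norm p x" if \<phi>: "slow L \<phi>" and x: "x \<in> lp p" for \<phi> x
    proof -
      have w: "weight \<phi> x \<in> lp p" using slow_lp_weight[OF \<phi> x] by simp
      have "norm ((T (weight \<phi> x) - weight \<phi> (T x)) i) \<le> \<epsilon> * norm (x (i - \<alpha>))" for i
      proof -
        have "(T (weight \<phi> x) - weight \<phi> (T x)) i = (\<phi> (i - \<alpha>) - \<phi> i) *\<^sub>R blinfun_apply (a i) (x (i - \<alpha>))"
          using w x by (simp add: T_apply blinfun.scaleR_right scaleR_left_diff_distrib)
        then have "norm ((T (weight \<phi> x) - weight \<phi> (T x)) i) = \<bar>\<phi> (i - \<alpha>) - \<phi> i\<bar> * norm (blinfun_apply (a i) (x (i - \<alpha>)))"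
          by simp
        also have "\<dots> \<le> (L * b) * (C * norm (x (i - \<alpha>)))"
        proof (rule mult_mono)
          show "\<bar>\<phi> (i - \<alpha>) - \<phi> i\<bar> \<le> L * b"
            using \<phi> near unfolding slow_def by (metis abs_minus_commute)
          show "norm (blinfun_apply (a i) (x (i - \<alpha>))) \<le> C * norm (x (i - \<alpha>))"
            using norm_blinfun[of "a i" "x (i - \<alpha>)"] mult_right_mono[OF C(2)[of i] norm_ge_zero[of "x (i - \<alpha>)"]] by linarith
        qed (use L b0 in auto)
        also have "\<dots> = (L * b * C) * norm (x (i - \<alpha>))" by simp
        also have "\<dots> \<le> \<epsilon> * norm (x (i - \<alpha>))"
        proof (rule mult_right_mono)
          have "L * b * C \<le> L * (b + 1) * C" using L C(1) by (intro mult_right_mono mult_left_mono) auto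
          also have "\<dots> = \<epsilon>" using C(1) b0 by (simp add: L_def)
          finally show "L * b * C \<le> \<epsilon>" .
        qed simp
        finally show ?thesis .
      qed
      then show ?thesis
        using lp_dominated(2)[OF lp_shift[OF x, of \<alpha>], of "T (weight \<phi> x) - weight \<phi> (T x)" \<epsilon>] e
        unfolding lp_norm_shift[OF x] by simp
    qed
    then show "\<exists>L>0. \<forall>\<phi>. slow L \<phi> \<longrightarrow> (\<forall>x\<in>lp p. lp_norm p (T (weight \<phi> x) - weight \<phi> (T x)) \<le> \<epsilon> * lp_norm p x)"
      using L by blast
  qed
qed

lemma propagates_add: "propagates b S \<Longrightarrow> propagates c T \<Longrightarrow> propagates (max b c) (S + T)"
  using propagates_mono[of b S "max b c"] propagates_mono[of c T "max b c"] unfolding propagates_def by simp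

lemma band_ops_properties:
  assumes "T \<in> band_ops p"
  shows "T \<in> bounded_ops p" "\<exists>b\<ge>0. propagates b T" "nearly_local T"
proof -
  obtain F a where F: "finite F" "\<forall>\<alpha>\<in>F. a \<alpha> \<in> linf_coeff"
    and T: "T = (\<Sum>\<alpha>\<in>F. mult_op p (a \<alpha>) \<circ> shift_op p \<alpha>)"
    using assms unfolding band_ops_def by blast
  have "T \<in> bounded_ops p \<and> (\<exists>b\<ge>0. propagates b T) \<and> nearly_local T"
    unfolding T using F
  proof (induction F rule: finite_induct)
    case empty
    have "nearly_local (0 :: ('a, 'b) seq_op)" unfolding nearly_local_def
      by (intro allI impI exI[of _ 1]) (simp add: fun_eq_iff zero_fun_def[symmetric] lp_norm_nonneg weight_def)
    moreover have "propagates 0 (0 :: ('a, 'b) seq_op)" unfolding propagates_def by simp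
    ultimately show ?case unfolding sum.empty using bop_zero_op by blast
  next
    case (insert \<alpha> F)
    then have a: "a \<alpha> \<in> linf_coeff" by blast
    note t = band_term[OF a, of \<alpha>]
    from insert.prems have "\<forall>\<alpha>\<in>F. a \<alpha> \<in> linf_coeff" by blast
    note IH = insert.IH[OF this, THEN conjunct1] insert.IH[OF this, THEN conjunct2, THEN conjunct1]
      insert.IH[OF this, THEN conjunct2, THEN conjunct2]
    obtain b c where "b \<ge> 0" "propagates b (mult_op p (a \<alpha>) \<circ> shift_op p \<alpha>)"
      "propagates c (\<Sum>\<alpha>\<in>F. mult_op p (a \<alpha>) \<circ> shift_op p \<alpha>)" using t(2) IH(2) by blast
    then have "\<exists>b\<ge>0. propagates b ((mult_op p (a \<alpha>) \<circ> shift_op p \<alpha>) + (\<Sum>\<alpha>\<in>F. mult_op p (a \<alpha>) \<circ> shift_op p \<alpha>))"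
      using propagates_add le_max_iff_disj by blast
    then show ?case unfolding sum.insert[OF insert(1,2)]
      using bop_plus(1)[OF t(1) IH(1)] nearly_local_add[OF t(1,3) IH(1,3)] by blast
  qed
  then show "T \<in> bounded_ops p" "\<exists>b\<ge>0. propagates b T" "nearly_local T" by auto
qed

lemma band_dominated_approx:
  assumes A: "A \<in> band_dominated p" and e: "\<epsilon> > 0"
  obtains B b where "B \<in> bounded_ops p" "b \<ge> 0" "propagates b B" "nearly_local B"
    "\<And>x. x \<in> lp p \<Longrightarrow> lp_norm p (A x - B x) \<le> \<epsilon> * lp_norm p x"
proof -
  have AB: "A \<in> bounded_ops p" using A unfolding band_dominated_def by blast
  obtain B where B: "B \<in> band_ops p" "op_norm p (A - B) < \<epsilon>" using A e unfolding band_dominated_def by blast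
  note P = band_ops_properties[OF B(1)]
  have "lp_norm p (A x - B x) \<le> \<epsilon> * lp_norm p x" if x: "x \<in> lp p" for x
    using op_bound[OF bop_minus_op(1)[OF AB P(1)] x] mult_right_mono[OF less_imp_le[OF B(2)] lp_norm_nonneg[OF x]]
    by simp
  then show ?thesis using that P by blast
qed

lemma band_dominated_nearly_local:
  assumes A: "A \<in> band_dominated p" shows "nearly_local A"
proof (rule nearly_local_limit)
  show "A \<in> bounded_ops p" using A unfolding band_dominated_def by blast
  fix \<epsilon> :: real assume "\<epsilon> > 0"
  then show "\<exists>S\<in>bounded_ops p. nearly_local S \<and> (\<forall>x\<in>lp p. lp_norm p (A x - S x) \<le> \<epsilon> * lp_norm p x)"
    using band_dominated_approx[OF A] by metis
qed

lemma band_dominated_L: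
  assumes A: "A \<in> band_dominated p" shows "A \<in> L_ops p"
proof (rule L_limit)
  show "A \<in> bounded_ops p" using A unfolding band_dominated_def by blast
  fix \<epsilon> :: real assume "\<epsilon> > 0"
  then show "\<exists>S\<in>L_ops p. \<forall>x\<in>lp p. lp_norm p (A x - S x) \<le> \<epsilon> * lp_norm p x"
    using band_dominated_approx[OF A] propagates_L by metis
qed

end

section \<open>Functionals and approximate solvability\<close>

lemma cscale_diff: "cscale c (x - y) = cscale c x - cscale c y"
proof
  fix i
  have "c *\<^sub>C (x i - y i) + c *\<^sub>C y i = c *\<^sub>C x i" by (simp add: scaleC_add_right[symmetric])
  then show "cscale c (x - y) i = (cscale c x - cscale c y) i" by (simp add: eq_diff_eq)
qed

context lp_exponent
begin

lemma dualI:
  assumes "\<And>x. x \<notin> lp p \<Longrightarrow> f x = 0" "\<And>x y. x \<in> lp p \<Longrightarrow> y \<in> lp p \<Longrightarrow> f (x + y) = f x + f y"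
    "\<And>c x. x \<in> lp p \<Longrightarrow> f (cscale c x) = c * f x" "\<And>x. x \<in> lp p \<Longrightarrow> cmod (f x) \<le> C * lp_norm p x"
  shows "f \<in> dual p"
  using assms unfolding dual_def cscale_def by blast

lemma dual_off: "f \<in> dual p \<Longrightarrow> x \<notin> lp p \<Longrightarrow> f x = 0"
  and dual_add: "f \<in> dual p \<Longrightarrow> x \<in> lp p \<Longrightarrow> y \<in> lp p \<Longrightarrow> f (x + y) = f x + f y"
  and dual_cscale: "f \<in> dual p \<Longrightarrow> x \<in> lp p \<Longrightarrow> f (cscale c x) = c * f x"
  and dual_ex: "f \<in> dual p \<Longrightarrow> \<exists>C. \<forall>x\<in>lp p. cmod (f x) \<le> C * lp_norm p x"
  unfolding dual_def cscale_def by blast+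

lemma dual_zero: "f \<in> dual p \<Longrightarrow> f 0 = 0"
  using dual_add[of f 0 0] lp_zero(1) by simp

lemma dual_norm_hom: "f \<in> dual p \<Longrightarrow> x \<in> lp p \<Longrightarrow> cmod (f (cscale c x)) = cmod c * cmod (f x)"
  by (simp add: dual_cscale norm_mult)

lemma dual_norm_nonneg: "f \<in> dual p \<Longrightarrow> 0 \<le> dual_norm p f"
  unfolding dual_norm_def by (rule unit_ball_sup(1)[OF dual_norm_hom dual_ex])

lemma dual_bound: "f \<in> dual p \<Longrightarrow> x \<in> lp p \<Longrightarrow> cmod (f x) \<le> dual_norm p f * lp_norm p x"
  unfolding dual_norm_def by (rule unit_ball_sup(2)[OF dual_norm_hom dual_ex])

lemma dual_norm_le:
  assumes "\<And>x. x \<in> lp p \<Longrightarrow> cmod (f x) \<le> C * lp_norm p x" "0 \<le> C"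
  shows "dual_norm p f \<le> C"
  unfolding dual_norm_def by (rule unit_ball_sup_le[OF assms])

lemma dual_comp:
  assumes f: "f \<in> dual p" and T: "T \<in> bounded_ops p"
  shows "f \<circ> T \<in> dual p" "dual_norm p (f \<circ> T) \<le> dual_norm p f * op_norm p T"
proof -
  have le: "cmod ((f \<circ> T) x) \<le> dual_norm p f * op_norm p T * lp_norm p x" if x: "x \<in> lp p" for x
  proof -
    have "cmod (f (T x)) \<le> dual_norm p f * lp_norm p (T x)" by (rule dual_bound[OF f bop_maps[OF T x]])
    also have "\<dots> \<le> dual_norm p f * (op_norm p T * lp_norm p x)"
      by (rule mult_left_mono[OF op_bound[OF T x] dual_norm_nonneg[OF f]])
    finally show ?thesis by (simp add: mult.assoc)
  qed
  show "f \<circ> T \<in> dual p"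
  proof (rule dualI[OF _ _ _ le])
    show "(f \<circ> T) x = 0" if "x \<notin> lp p" for x using bop_off[OF T that] dual_zero[OF f] by simp
    show "(f \<circ> T) (x + y) = (f \<circ> T) x + (f \<circ> T) y" if "x \<in> lp p" "y \<in> lp p" for x y
      using bop_add[OF T that] dual_add[OF f bop_maps[OF T that(1)] bop_maps[OF T that(2)]] by simp
    show "(f \<circ> T) (cscale c x) = c * (f \<circ> T) x" if "x \<in> lp p" for c x
      using bop_cscale[OF T that] dual_cscale[OF f bop_maps[OF T that]] by simp
  qed
  show "dual_norm p (f \<circ> T) \<le> dual_norm p f * op_norm p T"
    by (rule dual_norm_le[OF le]) (simp_all add: dual_norm_nonneg[OF f] op_norm_nonneg[OF T])
qed

lemma lp_complex_subspace: "complex_subspace cscale (lp p :: ('n::finite, 'x::complex_banach) seq set)"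
proof -
  interpret vector_space "cscale :: complex \<Rightarrow> ('n::finite, 'x::complex_banach) seq \<Rightarrow> _" by (rule cscale_vector_space)
  show ?thesis by unfold_locales (auto intro!: subspaceI lp_add(1) lp_cscale(1))
qed

lemma dominated_functional:
  assumes tri: "\<And>x y. x \<in> lp p \<Longrightarrow> y \<in> lp p \<Longrightarrow> q (x + y) \<le> q x + q y"
    and hom: "\<And>c x. x \<in> lp p \<Longrightarrow> q (cscale c x) = cmod c * q x"
    and le: "\<And>x. x \<in> lp p \<Longrightarrow> q x \<le> C * lp_norm p x"
    and y: "y \<in> lp p"
  obtains f where "f \<in> dual p" "\<And>x. x \<in> lp p \<Longrightarrow> cmod (f x) \<le> q x" "f y = complex_of_real (q y)"
proof -
  interpret complex_subspace cscale "lp p" by (rule lp_complex_subspace)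
  obtain f :: "_ \<Rightarrow> complex" where f: "\<And>x z. x \<in> lp p \<Longrightarrow> z \<in> lp p \<Longrightarrow> f (x + z) = f x + f z"
    "\<And>c x. x \<in> lp p \<Longrightarrow> f (cscale c x) = c * f x"
    "\<And>x. x \<in> lp p \<Longrightarrow> cmod (f x) \<le> q x" "f y = complex_of_real (q y)"
    using complex_Hahn_Banach[OF tri hom y] by blast
  define g where "g x = (if x \<in> lp p then f x else 0)" for x
  have "g \<in> dual p"
  proof (rule dualI)
    show "cmod (g x) \<le> C * lp_norm p x" if "x \<in> lp p" for x
      using order_trans[OF f(3)[OF that] le[OF that]] that by (simp add: g_def)
  qed (auto simp: g_def f lp_add lp_cscale)
  then show ?thesis using that[of g] f(3,4) y by (simp add: g_def)
qed

text \<open>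
  The infimal convolution \<open>q z = inf (\<parallel>z - Q A x\<parallel> / s + \<parallel>x\<parallel>)\<close> is a seminorm. A functional \<open>f\<close> dominated by
  \<open>q\<close> satisfies \<open>|f (Q A x)| \<le> \<parallel>x\<parallel>\<close>, so the dual lower bound gives \<open>\<parallel>f Q\<parallel> \<le> 1 / \<delta>\<close>. If \<open>f\<close> is chosen with
  \<open>f y = q y\<close>, then \<open>q y \<le> \<parallel>y\<parallel> / \<delta>\<close>, and an almost optimal \<open>x\<close> in the infimum is the approximate solution.
  The weight \<open>s\<close> controls the error independently of the bound on \<open>x\<close>.
\<close>

lemma approximately_onto:
  fixes A :: "('n::finite, 'x::complex_banach) seq_op"
  assumes A: "A \<in> bounded_ops p" and Q: "Q \<in> bounded_ops p" and d: "\<delta> > 0"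
    and low: "\<And>f. f \<in> dual p \<Longrightarrow> \<delta> * dual_norm p (f \<circ> Q) \<le> dual_norm p (f \<circ> Q \<circ> A)"
    and y: "y \<in> lp p" "Q y = y" and r: "r > 0"
  obtains x where "x \<in> lp p" "lp_norm p (y - Q (A x)) \<le> r * lp_norm p y" "lp_norm p x \<le> 2 / \<delta> * lp_norm p y"
proof (cases "lp_norm p y = 0")
  case True
  then have "y = 0" using y lp_norm_eq_0 by blast
  then show ?thesis using that[of 0] bop_zero[OF A] bop_zero[OF Q] by simp
next
  case False
  then have Ny: "lp_norm p y > 0" using lp_norm_nonneg[OF y(1)] by simp
  \<comment> \<open>The weight for which \<open>q y < 2 \<parallel>y\<parallel> / \<delta>\<close> yields an error of at most \<open>r \<parallel>y\<parallel>\<close>.\<close>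
  define s where "s = r * \<delta> / 2"
  have s: "s > 0" using r d by (simp add: s_def)
  define t where "t z x = lp_norm p (z - Q (A x)) / s + lp_norm p x" for z x
  define q where "q z = (INF x\<in>lp p. t z x)" for z
  have QA: "Q (A x) \<in> lp p" for x using bop_in[OF Q] .
  have t0: "0 \<le> t z x" if "z \<in> lp p" "x \<in> lp p" for z x
    unfolding t_def using lp_norm_nonneg[OF that(2)] lp_norm_nonneg[OF lp_diff(1)[OF that(1) QA]] s by simp
  have qle: "q z \<le> t z x" if "z \<in> lp p" "x \<in> lp p" for z x
    unfolding q_def using that t0 by (intro cINF_lower bdd_belowI2[where m = 0]) auto
  have qge: "m \<le> q z" if "\<And>x. x \<in> lp p \<Longrightarrow> m \<le> t z x" for m z
    unfolding q_def by (rule cINF_greatest[OF _ that]) (use lp_zero(1) in blast)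
  have tri: "q (z + w) \<le> q z + q w" if z: "z \<in> lp p" and w: "w \<in> lp p" for z w
  proof -
    have "q (z + w) - t z x \<le> t w x'" if x: "x \<in> lp p" and x': "x' \<in> lp p" for x x'
    proof -
      have eq: "z + w - Q (A (x + x')) = (z - Q (A x)) + (w - Q (A x'))"
        using bop_add[OF A x x'] bop_add[OF Q bop_maps[OF A x] bop_maps[OF A x']] by simp
      have "lp_norm p (z + w - Q (A (x + x'))) \<le> lp_norm p (z - Q (A x)) + lp_norm p (w - Q (A x'))"
        unfolding eq by (rule lp_add(2)[OF lp_diff(1)[OF z QA] lp_diff(1)[OF w QA]])
      then have "lp_norm p (z + w - Q (A (x + x'))) / s \<le> lp_norm p (z - Q (A x)) / s + lp_norm p (w - Q (A x')) / s"
        using s by (simp add: divide_right_mono add_divide_distrib[symmetric])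
      then have "t (z + w) (x + x') \<le> t z x + t w x'" unfolding t_def using lp_add(2)[OF x x'] by linarith
      then show ?thesis using qle[OF lp_add(1)[OF z w] lp_add(1)[OF x x']] by linarith
    qed
    then have "q (z + w) - t z x \<le> q w" if "x \<in> lp p" for x using qge that by blast
    then have "q (z + w) - q w \<le> t z x" if "x \<in> lp p" for x using that by (simp add: algebra_simps)
    then have "q (z + w) - q w \<le> q z" using qge by blast
    then show ?thesis by simp
  qed
  have t_cscale: "t (cscale c z) (cscale c x) = cmod c * t z x" if "z \<in> lp p" "x \<in> lp p" for c z x
  proof -
    have "cscale c z - Q (A (cscale c x)) = cscale c (z - Q (A x))"
      unfolding bop_cscale[OF A that(2)] bop_cscale[OF Q bop_maps[OF A that(2)]] cscale_diff ..
    then show ?thesis unfolding t_def using lp_cscale(2)[OF that(2)] lp_cscale(2)[OF lp_diff(1)[OF that(1) QA]]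
      by (simp add: algebra_simps)
  qed
  have hom_le: "q (cscale c z) \<le> cmod c * q z" if z: "z \<in> lp p" for c z
  proof (cases "c = 0")
    case True
    have "cscale c z = 0" using True by (auto simp: fun_eq_iff)
    then have "q (cscale c z) \<le> t 0 0" using qle[OF lp_zero(1) lp_zero(1)] by simp
    then show ?thesis using True bop_zero[OF A] bop_zero[OF Q] by (simp add: t_def)
  next
    case False
    then have "q (cscale c z) / cmod c \<le> t z x" if "x \<in> lp p" for x
      using qle[OF lp_cscale(1)[OF z] lp_cscale(1)[OF that], of c c] t_cscale[OF z that] by (simp add: divide_le_eq mult.commute)
    then have "q (cscale c z) / cmod c \<le> q z" using qge by blast
    then show ?thesis using False by (simp add: field_simps)
  qed
  have q0: "0 \<le> q z" if "z \<in> lp p" for z using qge t0 that by blast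
  have hom: "q (cscale c z) = cmod c * q z" if z: "z \<in> lp p" for c z
  proof (cases "c = 0")
    case True
    then show ?thesis using hom_le[OF z, of c] q0[OF lp_cscale(1)[OF z], of c] by simp
  next
    case False
    have "cscale (inverse c) (cscale c z) = z" using False by (auto simp: fun_eq_iff scaleC_scaleC scaleC_one)
    then have "q z \<le> inverse (cmod c) * q (cscale c z)"
      using hom_le[OF lp_cscale(1)[OF z], of "inverse c" c] by (simp add: norm_inverse)
    then have "cmod c * q z \<le> q (cscale c z)" using False by (simp add: field_simps)
    then show ?thesis using hom_le[OF z, of c] by simp
  qed
  have q_bd: "q z \<le> 1 / s * lp_norm p z" if "z \<in> lp p" for z
    using qle[OF that lp_zero(1)] bop_zero[OF A] bop_zero[OF Q] by (simp add: t_def)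
  obtain f where f: "f \<in> dual p" "\<And>x. x \<in> lp p \<Longrightarrow> cmod (f x) \<le> q x" "f y = complex_of_real (q y)"
    using dominated_functional[OF tri hom q_bd y(1)] by blast
  have "dual_norm p (f \<circ> Q \<circ> A) \<le> 1"
  proof (rule dual_norm_le)
    fix x :: "('n, 'x) seq" assume x: "x \<in> lp p"
    have "cmod (f (Q (A x))) \<le> t (Q (A x)) x" using f(2)[OF QA] qle[OF QA x] by (rule order_trans)
    then show "cmod ((f \<circ> Q \<circ> A) x) \<le> 1 * lp_norm p x" by (simp add: t_def)
  qed simp
  then have "\<delta> * dual_norm p (f \<circ> Q) \<le> 1" using low[OF f(1)] by linarith
  then have dn: "dual_norm p (f \<circ> Q) \<le> 1 / \<delta>" using d by (simp add: field_simps)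
  have "q y = cmod ((f \<circ> Q) y)" using y f(3) q0[OF y(1)] by simp
  also have "\<dots> \<le> dual_norm p (f \<circ> Q) * lp_norm p y" by (rule dual_bound[OF dual_comp(1)[OF f(1) Q] y(1)])
  also have "\<dots> \<le> 1 / \<delta> * lp_norm p y" using dn Ny by (intro mult_right_mono) auto
  also have "\<dots> < 2 / \<delta> * lp_norm p y" using Ny d by (intro mult_strict_right_mono divide_strict_right_mono) auto
  finally have "\<exists>x\<in>lp p. t y x < 2 / \<delta> * lp_norm p y"
    using qge[of "2 / \<delta> * lp_norm p y" y] by (meson linorder_not_less)
  then obtain x where x: "x \<in> lp p" "t y x < 2 / \<delta> * lp_norm p y" by blast
  have n1: "0 \<le> lp_norm p (y - Q (A x)) / s" using lp_norm_nonneg[OF lp_diff(1)[OF y(1) QA]] s by simp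
  have "lp_norm p (y - Q (A x)) / s \<le> 2 / \<delta> * lp_norm p y"
    using x(2) lp_norm_nonneg[OF x(1)] unfolding t_def by linarith
  then have "lp_norm p (y - Q (A x)) \<le> s * (2 / \<delta> * lp_norm p y)" using s by (simp add: field_simps)
  also have "\<dots> = r * lp_norm p y" using d by (simp add: s_def)
  finally have "lp_norm p (y - Q (A x)) \<le> r * lp_norm p y" .
  moreover have "lp_norm p x \<le> 2 / \<delta> * lp_norm p y" using x(2) n1 unfolding t_def by linarith
  ultimately show ?thesis using that x(1) by blast
qed

end

section \<open>Limit operators are invertible on finitely supported data\<close>

definition shifted :: "int ^ 'n \<Rightarrow> ('n, 'x) seq \<Rightarrow> ('n::finite, 'x::complex_banach) seq"
  where "shifted k x = (\<lambda>i. x (i - k))"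

lemma shifted_apply [simp]: "shifted k x i = x (i - k)" by (simp add: shifted_def)

lemma shifted_shifted [simp]: "shifted k (shifted l x) = shifted (k + l) x"
  by (simp add: fun_eq_iff diff_diff_eq)

lemma shifted_0 [simp]: "shifted 0 x = x"
  by (simp add: fun_eq_iff)

lemma shifted_add: "shifted k (x + y) = shifted k x + shifted k y" by (simp add: fun_eq_iff)
lemma shifted_diff: "shifted k (x - y) = shifted k x - shifted k y" by (simp add: fun_eq_iff)
lemma shifted_cscale: "shifted k (cscale c x) = cscale c (shifted k x)" by (simp add: fun_eq_iff)
lemma mem_cube_diff: "i - k \<in> cube l r \<longleftrightarrow> i \<in> cube (l + k) r"
  using cube_shift[of "i - k" k l r] by simp

definition supported :: "(int ^ 'n) set \<Rightarrow> ('n::finite, 'x::complex_banach) seq \<Rightarrow> bool"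
  where "supported F x \<longleftrightarrow> (\<forall>i. i \<notin> F \<longrightarrow> x i = 0)"

lemma supported_cutoff: "supported F (cutoff F x)" by (simp add: supported_def cutoff_apply)

lemma supported_mono: "supported F x \<Longrightarrow> F \<subseteq> G \<Longrightarrow> supported G x" by (auto simp: supported_def)

lemma supported_add: "supported F x \<Longrightarrow> supported F y \<Longrightarrow> supported F (x + y)"
  and supported_diff: "supported F x \<Longrightarrow> supported F y \<Longrightarrow> supported F (x - y)"
  and supported_cscale: "supported F x \<Longrightarrow> supported F (cscale c x)"
  by (auto simp: supported_def)

lemma cutoff_supported: "supported F x \<Longrightarrow> cutoff F x = x"
  by (rule cutoff_eq_self) (simp add: supported_def)

lemma supported_shifted: "supported (cube l r) x \<Longrightarrow> supported (cube (l + k) r) (shifted k x)"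
  by (auto simp: supported_def mem_cube_diff)

definition cube_dist :: "int ^ 'n::finite \<Rightarrow> int ^ 'n \<Rightarrow> int"
  where "cube_dist k i = Max (range (\<lambda>j. \<bar>i $ j - k $ j\<bar>))"

lemma cube_dist_le_iff: "cube_dist k i \<le> r \<longleftrightarrow> i \<in> cube k r"
  unfolding cube_dist_def mem_cube by (subst Max_le_iff) auto

text \<open>
  Equal to \<open>1\<close> on the cube of radius \<open>R\<close> and \<open>0\<close> outside the cube of radius \<open>2 R\<close>, with slope \<open>1 / R\<close>.
\<close>

definition bump :: "int \<Rightarrow> int ^ 'n::finite \<Rightarrow> int ^ 'n \<Rightarrow> real"
  where "bump R k i = max 0 (min 1 (2 - real_of_int (cube_dist k i) / real_of_int R))"

lemma bump_1:
  assumes "0 < R" "i \<in> cube k R"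
  shows "bump R k i = 1"
proof -
  have "cube_dist k i \<le> R" using assms(2) by (simp add: cube_dist_le_iff)
  then have "real_of_int (cube_dist k i) / real_of_int R \<le> 1" using assms(1) by (simp add: divide_le_eq)
  then show ?thesis by (simp add: bump_def)
qed

lemma bump_0:
  assumes "0 < R" "i \<notin> cube k (2 * R)"
  shows "bump R k i = 0"
proof -
  have "2 * R < cube_dist k i" using assms(2) cube_dist_le_iff[of k i "2 * R"] by linarith
  then have "2 * real_of_int R \<le> real_of_int (cube_dist k i)" by (metis less_imp_le of_int_le_iff of_int_mult of_int_numeral)
  then have "2 \<le> real_of_int (cube_dist k i) / real_of_int R" using assms(1) by (simp add: le_divide_eq)
  then show ?thesis by (simp add: bump_def)
qed

lemma bump_shift: "bump R k (i - l) = bump R (k + l) i"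
  by (simp add: bump_def cube_dist_def algebra_simps)

context lp_exponent
begin

lemma bump_slow:
  assumes R: "0 < R" shows "slow (1 / real_of_int R) (bump R k)"
  unfolding slow_def
proof (intro conjI allI impI)
  fix i j :: "int ^ 'a" and r assume j: "j \<in> cube i r"
  have "i \<in> cube j r" using j cube_sym by blast
  then have "cube_dist k i \<le> r + cube_dist k j"
    using cube_trans[of i j r k "cube_dist k j"] by (simp add: cube_dist_le_iff[symmetric])
  moreover have "cube_dist k j \<le> r + cube_dist k i"
    using cube_trans[OF j, of k "cube_dist k i"] by (simp add: cube_dist_le_iff[symmetric])
  ultimately have "\<bar>real_of_int (cube_dist k i) - real_of_int (cube_dist k j)\<bar> \<le> real_of_int r" by linarith
  then have "\<bar>real_of_int (cube_dist k i) - real_of_int (cube_dist k j)\<bar> / real_of_int R \<le> real_of_int r / real_of_int R"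
    using R by (intro divide_right_mono) auto
  then have "\<bar>real_of_int (cube_dist k i) / real_of_int R - real_of_int (cube_dist k j) / real_of_int R\<bar> \<le> real_of_int r / real_of_int R"
    using R by (simp add: diff_divide_distrib[symmetric])
  then show "\<bar>bump R k i - bump R k j\<bar> \<le> 1 / real_of_int R * real_of_int r"
    unfolding bump_def by simp
qed (auto simp: bump_def)

lemma lp_shifted: "x \<in> lp p \<Longrightarrow> shifted k x \<in> lp p" unfolding shifted_def by (rule lp_shift)

lemma lp_norm_shifted: "x \<in> lp p \<Longrightarrow> lp_norm p (shifted k x) = lp_norm p x" unfolding shifted_def by (rule lp_norm_shift)

lemma lp_supported_cube: "supported (cube k r) x \<Longrightarrow> x \<in> lp p"
  by (rule lp_finite_support[OF finite_cube]) (auto simp: supported_def)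

lemma weight_bump_supported: "0 < R \<Longrightarrow> supported (cube k (2 * R)) (weight (bump R k) x)"
  by (simp add: supported_def bump_0)

lemma weight_bump_id:
  assumes "0 < R" "supported (cube k R) y" shows "weight (bump R k) y = y"
proof
  fix i show "weight (bump R k) y i = y i"
    using assms bump_1[OF assms(1), of i k] by (cases "i \<in> cube k R") (auto simp: supported_def)
qed

lemma lp_bump:
  assumes "0 < R" "x \<in> lp p"
  shows "weight (bump R k) x \<in> lp p" "lp_norm p (weight (bump R k) x) \<le> lp_norm p x"
  using slow_lp_weight[OF bump_slow[OF assms(1)] assms(2)] by auto

lemma lp_bump_cutoff:
  assumes "0 < R" "x \<in> lp p"
  shows "lp_norm p (weight (bump R k) x) \<le> lp_norm p (cutoff (cube k (2 * R)) x)"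
proof -
  have "weight (bump R k) x = weight (bump R k) (cutoff (cube k (2 * R)) x)"
    using bump_0[OF assms(1)] by (auto simp: fun_eq_iff cutoff_apply)
  then show ?thesis using lp_bump(2)[OF assms(1) lp_cutoff(1)[OF assms(2)]] by metis
qed

lemma tends_to_infinity_iff:
  "tends_to_infinity h \<longleftrightarrow> (\<forall>M::nat. \<forall>\<^sub>F n in sequentially. h n \<notin> cube 0 (int M))"
proof -
  have eq: "h n \<notin> cube 0 r \<longleftrightarrow> r + 1 \<le> Max (range (\<lambda>j. \<bar>h n $ j\<bar>))" for n r
  proof -
    have "Max (range (\<lambda>j. \<bar>h n $ j\<bar>)) = cube_dist 0 (h n)" by (simp add: cube_dist_def)
    then show ?thesis using cube_dist_le_iff[of 0 "h n" r] by linarith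
  qed
  show ?thesis
    unfolding tends_to_infinity_def filterlim_at_top eq
  proof (intro iffI allI)
    fix Z :: int assume *: "\<forall>M::nat. \<forall>\<^sub>F n in sequentially. int M + 1 \<le> Max (range (\<lambda>j. \<bar>h n $ j\<bar>))"
    show "\<forall>\<^sub>F n in sequentially. Z \<le> Max (range (\<lambda>j. \<bar>h n $ j\<bar>))"
      using spec[OF *, of "nat Z"] by (rule eventually_mono) linarith
  qed blast
qed

definition translate :: "('n::finite, 'x::complex_banach) seq_op \<Rightarrow> int ^ 'n \<Rightarrow> ('n, 'x) seq \<Rightarrow> ('n, 'x) seq"
  where "translate A k x = shifted (- k) (A (shifted k x))"

lemma translate_eq:
  assumes A: "A \<in> bounded_ops p" and x: "x \<in> lp p"
  shows "(shift_op p (- k) \<circ> A \<circ> shift_op p k) x = translate A k x"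
  using lp_shift[OF x, of k] bop_in[OF A, of "\<lambda>i. x (i - k)"] x
  by (simp add: shift_apply translate_def shifted_def)

text \<open>
  The two halves of \<open>P\<close>-strong convergence against the projections, written on vectors.
\<close>

definition locally_converges ::
    "(nat \<Rightarrow> ('n::finite, 'x::complex_banach) seq \<Rightarrow> ('n, 'x) seq) \<Rightarrow> ('n, 'x) seq_op \<Rightarrow> bool"
  where "locally_converges As B \<longleftrightarrow> (\<forall>(R::nat) \<epsilon>. \<epsilon> > 0 \<longrightarrow> (\<forall>\<^sub>F n in sequentially. \<forall>x\<in>lp p.
     lp_norm p (cutoff (cube 0 (int R)) (As n x - B x)) \<le> \<epsilon> * lp_norm p x \<and>
     (supported (cube 0 (int R)) x \<longrightarrow> lp_norm p (As n x - B x) \<le> \<epsilon> * lp_norm p x)))"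

lemma limit_op_locally_converges:
  assumes A: "A \<in> bounded_ops p" and lim: "is_limit_op p A h B"
  shows "B \<in> bounded_ops p" "locally_converges (\<lambda>n. translate A (h n)) B"
proof -
  let ?As = "\<lambda>n. shift_op p (- h n) \<circ> A \<circ> shift_op p (h n)"
  show B: "B \<in> bounded_ops p" using lim unfolding is_limit_op_def P_strong_lim_def by blast
  have As: "?As n \<in> bounded_ops p" for n using bop_comp(1) shift_bop A by blast
  have D: "?As n - B \<in> bounded_ops p" for n by (rule bop_minus_op(1)[OF As B])
  show "locally_converges (\<lambda>n. translate A (h n)) B"
    unfolding locally_converges_def
  proof (intro allI impI)
    fix R :: nat and \<epsilon> :: real assume e: "\<epsilon> > 0"
    have "(\<lambda>n. op_norm p (P_op p R \<circ> (?As n - B)) + op_norm p ((?As n - B) \<circ> P_op p R)) \<longlonglongrightarrow> 0"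
      using lim P_K unfolding is_limit_op_def P_strong_lim_def by blast
    then have "\<forall>\<^sub>F n in sequentially. op_norm p (P_op p R \<circ> (?As n - B)) + op_norm p ((?As n - B) \<circ> P_op p R) < \<epsilon>"
      using e by (rule order_tendstoD(2))
    then show "\<forall>\<^sub>F n in sequentially. \<forall>x\<in>lp p.
       lp_norm p (cutoff (cube 0 (int R)) (translate A (h n) x - B x)) \<le> \<epsilon> * lp_norm p x \<and>
       (supported (cube 0 (int R)) x \<longrightarrow> lp_norm p (translate A (h n) x - B x) \<le> \<epsilon> * lp_norm p x)"
    proof (rule eventually_mono)
      fix n assume n: "op_norm p (P_op p R \<circ> (?As n - B)) + op_norm p ((?As n - B) \<circ> P_op p R) < \<epsilon>"
      note PD = bop_comp(1)[OF P_bop D, of R n] and DP = bop_comp(1)[OF D P_bop, of n R]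
      have le: "op_norm p (P_op p R \<circ> (?As n - B)) \<le> \<epsilon>" "op_norm p ((?As n - B) \<circ> P_op p R) \<le> \<epsilon>"
        using n op_norm_nonneg[OF PD] op_norm_nonneg[OF DP] by linarith+
      show "\<forall>x\<in>lp p.
       lp_norm p (cutoff (cube 0 (int R)) (translate A (h n) x - B x)) \<le> \<epsilon> * lp_norm p x \<and>
       (supported (cube 0 (int R)) x \<longrightarrow> lp_norm p (translate A (h n) x - B x) \<le> \<epsilon> * lp_norm p x)"
      proof (intro ballI conjI impI)
        fix x :: "('a, 'b) seq" assume x: "x \<in> lp p"
        have Dx: "(?As n - B) x = translate A (h n) x - B x" using translate_eq[OF A x] by simp
        have "(P_op p R \<circ> (?As n - B)) x = cutoff (cube 0 (int R)) (translate A (h n) x - B x)"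
          using P_apply[OF bop_maps[OF D x, of n]] Dx by simp
        then show "lp_norm p (cutoff (cube 0 (int R)) (translate A (h n) x - B x)) \<le> \<epsilon> * lp_norm p x"
          using op_bound[OF PD x] mult_right_mono[OF le(1) lp_norm_nonneg[OF x]] by simp
        assume "supported (cube 0 (int R)) x"
        then have "P_op p R x = x" using P_apply[OF x] cutoff_supported by metis
        then have "((?As n - B) \<circ> P_op p R) x = translate A (h n) x - B x" using Dx by simp
        then show "lp_norm p (translate A (h n) x - B x) \<le> \<epsilon> * lp_norm p x"
          using op_bound[OF DP x] mult_right_mono[OF le(2) lp_norm_nonneg[OF x]] by simp
      qed
    qed
  qed
qed

end

text \<open>
  An operator that is bounded below at infinity and approximately onto at infinity. The second condition
  is the form in which the lower bound for the adjoint is used.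
\<close>

locale far_bounded = lp_exponent +
  fixes A :: "('n::finite, 'x::complex_banach) seq_op" and \<delta> :: real and m :: nat
  assumes A: "A \<in> bounded_ops p" and local: "nearly_local A" and \<delta>: "\<delta> > 0"
    and low: "\<And>x. x \<in> lp p \<Longrightarrow> supported (- cube 0 (int m)) x \<Longrightarrow> \<delta> * lp_norm p x \<le> lp_norm p (A x)"
    and onto: "\<And>y r. y \<in> lp p \<Longrightarrow> supported (- cube 0 (int m)) y \<Longrightarrow> r > 0 \<Longrightarrow>
      \<exists>x\<in>lp p. lp_norm p (y - cutoff (- cube 0 (int m)) (A x)) \<le> r * lp_norm p y \<and> lp_norm p x \<le> 2 / \<delta> * lp_norm p y"
begin

text \<open>
  A cube of radius \<open>R\<close> whose centre is outside the cube of radius \<open>m + R\<close> around the origin misses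
  the cube of radius \<open>m\<close>.
\<close>

lemma cube_far:
  assumes "k \<notin> cube 0 (int (m + nat R))" "supported (cube k R) x"
  shows "supported (- cube 0 (int m)) x"
proof -
  have "cube k R \<subseteq> - cube 0 (int m)"
  proof
    fix i assume "i \<in> cube k R"
    then have "k \<in> cube i R" using cube_sym by blast
    then have "k \<in> cube 0 (int (m + nat R))" if "i \<in> cube 0 (int m)"
      using cube_trans[OF _ that] cube_mono[of "R + int m" "int (m + nat R)" 0] by force
    then show "i \<in> - cube 0 (int m)" using assms(1) by blast
  qed
  then show ?thesis using assms(2) supported_mono by blast
qed

lemma commutator_scale:
  assumes "\<epsilon> > 0"
  obtains R where "R > 0" "R \<ge> R0" "\<And>k x. x \<in> lp p \<Longrightarrow> lp_norm p (A (weight (bump R k) x) - weight (bump R k) (A x)) \<le> \<epsilon> * lp_norm p x"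
proof -
  obtain L where L: "L > 0" "\<And>\<phi> x. slow L \<phi> \<Longrightarrow> x \<in> lp p \<Longrightarrow> lp_norm p (A (weight \<phi> x) - weight \<phi> (A x)) \<le> \<epsilon> * lp_norm p x"
    using local assms unfolding nearly_local_def by meson
  define R where "R = max (max 1 R0) \<lceil>1 / L\<rceil>"
  have R: "R > 0" "R \<ge> R0" by (auto simp: R_def)
  have "1 / L \<le> real_of_int R" unfolding R_def by linarith
  then have "1 / real_of_int R \<le> L" using L(1) R(1) by (simp add: field_simps)
  then have "slow L (bump R k)" for k using slow_mono[OF bump_slow[OF R(1)]] by blast
  then show ?thesis using that[OF R] L(2) by blast
qed

text \<open>
  Take a global approximate solution \<open>z\<close> and multiply it by a bump \<open>\<phi>\<close> around the cube that carries \<open>y\<close>: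
  \<open>A (\<phi> z) = \<phi> A z + [A, \<phi>] z\<close>, the commutator is small, and \<open>\<phi> A z\<close> is close to \<open>\<phi> y = y\<close>. Far away
  the projection \<open>Q\<^sub>m\<close> is invisible under \<open>\<phi>\<close>.
\<close>

lemma local_solution:
  assumes \<eta>: "\<eta> > 0"
  shows "\<exists>R (M::nat). \<forall>k y. k \<notin> cube 0 (int M) \<longrightarrow> supported (cube k R1) y \<longrightarrow>
    (\<exists>x. supported (cube k R) x \<and> lp_norm p (A x - y) \<le> \<eta> * lp_norm p y \<and> lp_norm p x \<le> 2 / \<delta> * lp_norm p y)"
proof -
  have e: "\<eta> * \<delta> / 4 > 0" using \<eta> \<delta> by simp
  obtain R where R: "R > 0" "R \<ge> R1"
    "\<And>k x. x \<in> lp p \<Longrightarrow> lp_norm p (A (weight (bump R k) x) - weight (bump R k) (A x)) \<le> \<eta> * \<delta> / 4 * lp_norm p x"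
    using commutator_scale[OF e, of R1] by blast
  have "\<exists>x. supported (cube k (2 * R)) x \<and> lp_norm p (A x - y) \<le> \<eta> * lp_norm p y \<and> lp_norm p x \<le> 2 / \<delta> * lp_norm p y"
    if k: "k \<notin> cube 0 (int (m + nat (2 * R)))" and y1: "supported (cube k R1) y" for k y
  proof -
    have y: "y \<in> lp p" using lp_supported_cube[OF y1] .
    have yR: "supported (cube k R) y" using supported_mono[OF y1 cube_mono[OF R(2)]] .
    have y2: "supported (cube k (2 * R)) y" using supported_mono[OF yR cube_mono] R(1) by simp
    have "\<eta> / 2 > 0" using \<eta> by simp
    from onto[OF y cube_far[OF k y2] this] obtain z where z: "z \<in> lp p"
      "lp_norm p (y - cutoff (- cube 0 (int m)) (A z)) \<le> \<eta> / 2 * lp_norm p y" "lp_norm p z \<le> 2 / \<delta> * lp_norm p y" by blast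
    let ?w = "weight (bump R k)"
    have Az: "A z \<in> lp p" using bop_in[OF A] .
    let ?u = "y - cutoff (- cube 0 (int m)) (A z)"
    have u: "?u \<in> lp p" using lp_diff(1)[OF y lp_cutoff(1)[OF Az]] .
    have "?w (A z) = ?w (cutoff (- cube 0 (int m)) (A z))"
    proof
      fix i
      have "supported (- cube 0 (int m)) (?w (A z))" by (rule cube_far[OF k weight_bump_supported[OF R(1)]])
      then have "i \<in> cube 0 (int m) \<Longrightarrow> ?w (A z) i = 0" unfolding supported_def by blast
      then show "?w (A z) i = ?w (cutoff (- cube 0 (int m)) (A z)) i"
        by (cases "i \<in> cube 0 (int m)") (simp_all add: cutoff_apply)
    qed
    then have eq: "A (?w z) - y = (A (?w z) - ?w (A z)) - ?w ?u"
      unfolding weight_diff weight_bump_id[OF R(1) yR] by simp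
    have wz: "?w z \<in> lp p" "lp_norm p (?w z) \<le> lp_norm p z" using lp_bump[OF R(1) z(1)] by auto
    have "lp_norm p (A (?w z) - y) \<le> lp_norm p (A (?w z) - ?w (A z)) + lp_norm p (?w ?u)"
      unfolding eq by (rule lp_diff(2)[OF lp_diff(1)[OF bop_in[OF A] lp_bump(1)[OF R(1) Az]] lp_bump(1)[OF R(1) u]])
    moreover have "lp_norm p (A (?w z) - ?w (A z)) \<le> \<eta> * \<delta> / 4 * lp_norm p z" by (rule R(3)[OF z(1)])
    moreover have "lp_norm p (?w ?u) \<le> \<eta> / 2 * lp_norm p y"
      using lp_bump(2)[OF R(1) u] z(2) by (rule order_trans)
    moreover have "\<eta> * \<delta> / 4 * lp_norm p z \<le> \<eta> * \<delta> / 4 * (2 / \<delta> * lp_norm p y)"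
      using e z(3) by (intro mult_left_mono) auto
    moreover have "\<eta> * \<delta> / 4 * (2 / \<delta> * lp_norm p y) = \<eta> / 2 * lp_norm p y" using \<delta> by simp
    ultimately have "lp_norm p (A (?w z) - y) \<le> \<eta> / 2 * lp_norm p y + \<eta> / 2 * lp_norm p y" by linarith
    then have "lp_norm p (A (?w z) - y) \<le> \<eta> * lp_norm p y" by simp
    then show ?thesis using weight_bump_supported[OF R(1), of k z] wz(2) z(3) by (intro exI[of _ "?w z"]) auto
  qed
  then show ?thesis by blast
qed

end

locale limit_operator = far_bounded p A \<delta> m
  for p and A :: "('n::finite, 'x::complex_banach) seq_op" and \<delta> m +
  fixes h :: "nat \<Rightarrow> int ^ 'n" and B :: "('n, 'x) seq_op"
  assumes h: "tends_to_infinity h" and B: "B \<in> bounded_ops p"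
    and conv: "locally_converges (\<lambda>n. translate A (h n)) B"
begin

lemma far: "\<forall>\<^sub>F n in sequentially. h n \<notin> cube 0 (int M)"
  using h unfolding tends_to_infinity_iff by blast

lemma conv_eventually:
  assumes "\<epsilon> > 0"
  shows "\<forall>\<^sub>F n in sequentially. h n \<notin> cube 0 (int M) \<and> (\<forall>x\<in>lp p.
     lp_norm p (cutoff (cube 0 (int R)) (translate A (h n) x - B x)) \<le> \<epsilon> * lp_norm p x \<and>
     (supported (cube 0 (int R)) x \<longrightarrow> lp_norm p (translate A (h n) x - B x) \<le> \<epsilon> * lp_norm p x))"
  using eventually_conj[OF far conv[unfolded locally_converges_def, rule_format, OF assms]] .

lemma conv_far:
  assumes "\<epsilon> > 0"
  obtains n where "h n \<notin> cube 0 (int M)"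
    "\<And>x. supported (cube 0 R) x \<Longrightarrow> lp_norm p (translate A (h n) x - B x) \<le> \<epsilon> * lp_norm p x"
proof -
  obtain n where n: "h n \<notin> cube 0 (int M)" "\<forall>x\<in>lp p.
     lp_norm p (cutoff (cube 0 (int (nat R))) (translate A (h n) x - B x)) \<le> \<epsilon> * lp_norm p x \<and>
     (supported (cube 0 (int (nat R))) x \<longrightarrow> lp_norm p (translate A (h n) x - B x) \<le> \<epsilon> * lp_norm p x)"
    using eventually_happens'[OF sequentially_bot conv_eventually[OF assms, of M "nat R"]] by blast
  have "lp_norm p (translate A (h n) x - B x) \<le> \<epsilon> * lp_norm p x" if "supported (cube 0 R) x" for x
    using n(2) lp_supported_cube[OF that] supported_mono[OF that cube_mono, of "int (nat R)"] by simp
  then show ?thesis using that n(1) by blast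
qed

text \<open>
  A finitely supported \<open>x\<close> translated by \<open>h n\<close> is eventually far out, where the lower bound of \<open>A\<close>
  applies; on a fixed cube the translates of \<open>A\<close> converge in norm.
\<close>

lemma limit_low:
  assumes x: "supported (cube 0 R) x"
  shows "\<delta> * lp_norm p x \<le> lp_norm p (B x)"
proof (rule field_le_epsilon)
  fix e :: real assume e: "e > 0"
  have xl: "x \<in> lp p" using lp_supported_cube[OF x] .
  define \<epsilon> where "\<epsilon> = e / (lp_norm p x + 1)"
  have Nx: "0 \<le> lp_norm p x" using lp_norm_nonneg[OF xl] .
  have \<epsilon>: "\<epsilon> > 0" "\<epsilon> * lp_norm p x \<le> e" using e Nx by (auto simp: \<epsilon>_def field_simps)
  obtain n where n: "h n \<notin> cube 0 (int (m + nat R))"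
    "lp_norm p (translate A (h n) x - B x) \<le> \<epsilon> * lp_norm p x" using conv_far[OF \<epsilon>(1)] x by metis
  have Asx: "A (shifted (h n) x) \<in> lp p" using bop_in[OF A] .
  have t: "translate A (h n) x \<in> lp p" unfolding translate_def by (rule lp_shifted[OF Asx])
  have "\<delta> * lp_norm p x = \<delta> * lp_norm p (shifted (h n) x)" by (simp add: lp_norm_shifted[OF xl])
  also have "\<dots> \<le> lp_norm p (A (shifted (h n) x))"
    using supported_shifted[OF x, of "h n"] by (intro low lp_shifted[OF xl] cube_far[OF n(1)]) simp
  also have "\<dots> = lp_norm p (translate A (h n) x)" unfolding translate_def by (simp add: lp_norm_shifted[OF Asx])
  also have "\<dots> \<le> lp_norm p (B x) + lp_norm p (translate A (h n) x - B x)"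
    using lp_add(2)[OF bop_in[OF B, of x] lp_diff(1)[OF t bop_in[OF B, of x]]] by simp
  also have "\<dots> \<le> lp_norm p (B x) + e" using n(2) \<epsilon>(2) by linarith
  finally show "\<delta> * lp_norm p x \<le> lp_norm p (B x) + e" .
qed

text \<open>
  The cube that carries the local solution has a radius independent of the position, so the
  translates of \<open>A\<close> may be replaced by the limit operator there.
\<close>

lemma limit_approximately_onto:
  assumes y: "supported (cube 0 R1) y" and \<eta>: "\<eta> > 0"
  obtains R x where "supported (cube 0 R) x" "lp_norm p (B x - y) \<le> \<eta> * lp_norm p y"
proof -
  have e: "\<eta> / 2 > 0" "\<eta> * \<delta> / 4 > 0" using \<eta> \<delta> by auto
  obtain R and M :: nat where RM: "\<forall>k y. k \<notin> cube 0 (int M) \<longrightarrow> supported (cube k R1) y \<longrightarrow>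
    (\<exists>x. supported (cube k R) x \<and> lp_norm p (A x - y) \<le> \<eta> / 2 * lp_norm p y \<and> lp_norm p x \<le> 2 / \<delta> * lp_norm p y)"
    using local_solution[OF e(1), of R1] by (elim exE) (rule that)
  obtain n where n: "h n \<notin> cube 0 (int M)"
    "\<And>x. supported (cube 0 R) x \<Longrightarrow> lp_norm p (translate A (h n) x - B x) \<le> \<eta> * \<delta> / 4 * lp_norm p x"
    using conv_far[OF e(2)] by metis
  have yl: "y \<in> lp p" using lp_supported_cube[OF y] .
  obtain x where x: "supported (cube (h n) R) x" "lp_norm p (A x - shifted (h n) y) \<le> \<eta> / 2 * lp_norm p y"
      "lp_norm p x \<le> 2 / \<delta> * lp_norm p y"
    using RM[rule_format, OF n(1), of "shifted (h n) y"] supported_shifted[OF y, of "h n"] by (auto simp: lp_norm_shifted[OF yl])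
  have xl: "x \<in> lp p" using lp_supported_cube[OF x(1)] .
  define w where "w = shifted (- h n) x"
  have w: "supported (cube 0 R) w" using supported_shifted[OF x(1), of "- h n"] by (simp add: w_def)
  have t: "translate A (h n) w = shifted (- h n) (A x)" unfolding translate_def w_def by simp
  have Ax: "A x \<in> lp p" using bop_in[OF A] .
  have ty: "translate A (h n) w - y = shifted (- h n) (A x - shifted (h n) y)" unfolding t shifted_diff by simp
  have ty': "lp_norm p (translate A (h n) w - y) \<le> \<eta> / 2 * lp_norm p y"
    unfolding ty using x(2) lp_norm_shifted[OF lp_diff(1)[OF Ax lp_shifted[OF yl]]] by simp
  have tl: "translate A (h n) w \<in> lp p" unfolding t using lp_shifted[OF Ax] .
  have eq: "B w - y = (translate A (h n) w - y) - (translate A (h n) w - B w)" by simp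
  have "lp_norm p (B w - y) \<le> lp_norm p (translate A (h n) w - y) + lp_norm p (translate A (h n) w - B w)"
    unfolding eq by (rule lp_diff(2)[OF lp_diff(1)[OF tl yl] lp_diff(1)[OF tl bop_in[OF B]]])
  moreover have "\<eta> * \<delta> / 4 * lp_norm p w \<le> \<eta> * \<delta> / 4 * (2 / \<delta> * lp_norm p y)"
    using e(2) x(3) lp_norm_shifted[OF xl] unfolding w_def by (intro mult_left_mono) auto
  moreover have "\<eta> * \<delta> / 4 * (2 / \<delta> * lp_norm p y) = \<eta> / 2 * lp_norm p y" using \<delta> by simp
  ultimately have "lp_norm p (B w - y) \<le> \<eta> / 2 * lp_norm p y + \<eta> / 2 * lp_norm p y"
    using ty' n(2)[OF w] by linarith
  then have "lp_norm p (B w - y) \<le> \<eta> * lp_norm p y" by simp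
  then show ?thesis using that w by blast
qed

text \<open>
  The closure of the finitely supported families. For \<open>p = \<infinity>\<close> it is in general a proper subspace, yet it
  is large enough to contain the exact solutions for finitely supported data.
\<close>

definition finite_closure :: "('n, 'x) seq set"
  where "finite_closure = {x \<in> lp p. \<forall>\<epsilon>>0. \<exists>R z. supported (cube 0 R) z \<and> lp_norm p (x - z) \<le> \<epsilon>}"

lemma finite_closure_diff:
  assumes x: "x \<in> finite_closure" and y: "y \<in> finite_closure"
  shows "x - y \<in> finite_closure"
proof -
  have l: "x \<in> lp p" "y \<in> lp p" using x y by (auto simp: finite_closure_def)
  have "\<exists>R z. supported (cube 0 R) z \<and> lp_norm p (x - y - z) \<le> \<epsilon>" if e: "\<epsilon> > 0" for \<epsilon>
  proof -
    obtain R z where z: "supported (cube 0 R) z" "lp_norm p (x - z) \<le> \<epsilon> / 2"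
      using x half_gt_zero[OF e] unfolding finite_closure_def by blast
    obtain S w where w: "supported (cube 0 S) w" "lp_norm p (y - w) \<le> \<epsilon> / 2"
      using y half_gt_zero[OF e] unfolding finite_closure_def by blast
    have "supported (cube 0 (max R S)) (z - w)"
      using supported_mono[OF z(1) cube_mono, of "max R S"] supported_mono[OF w(1) cube_mono, of "max R S"]
      by (intro supported_diff) auto
    moreover have eq: "x - y - (z - w) = (x - z) - (y - w)" by simp
    have "lp_norm p (x - y - (z - w)) \<le> lp_norm p (x - z) + lp_norm p (y - w)"
      unfolding eq using l lp_supported_cube[OF z(1)] lp_supported_cube[OF w(1)] by (intro lp_diff) auto
    ultimately show ?thesis using z(2) w(2) by (intro exI[of _ "max R S"] exI[of _ "z - w"]) auto
  qed
  then show ?thesis using lp_diff(1)[OF l] by (simp add: finite_closure_def)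
qed

lemma finite_closure_cscale:
  assumes x: "x \<in> finite_closure"
  shows "cscale c x \<in> finite_closure"
proof -
  have l: "x \<in> lp p" using x by (auto simp: finite_closure_def)
  have "\<exists>R z. supported (cube 0 R) z \<and> lp_norm p (cscale c x - z) \<le> \<epsilon>" if e: "\<epsilon> > 0" for \<epsilon>
  proof -
    have "\<epsilon> / (cmod c + 1) > 0" using e by (simp add: add_nonneg_pos)
    then obtain R z where z: "supported (cube 0 R) z" "lp_norm p (x - z) \<le> \<epsilon> / (cmod c + 1)"
      using x unfolding finite_closure_def by blast
    have "lp_norm p (cscale c x - cscale c z) = cmod c * lp_norm p (x - z)"
      unfolding cscale_diff[symmetric] by (rule lp_cscale(2)[OF lp_diff(1)[OF l lp_supported_cube[OF z(1)]]])
    also have "\<dots> \<le> cmod c * (\<epsilon> / (cmod c + 1))" using z(2) by (intro mult_left_mono) auto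
    also have "\<dots> = cmod c / (cmod c + 1) * \<epsilon>" by simp
    also have "\<dots> \<le> 1 * \<epsilon>" using e by (intro mult_right_mono) (auto simp: divide_le_eq add_nonneg_pos)
    also have "\<dots> = \<epsilon>" by simp
    finally show ?thesis using supported_cscale[OF z(1)] by blast
  qed
  then show ?thesis using lp_cscale(1)[OF l] by (simp add: finite_closure_def)
qed

lemma finite_closure_low:
  assumes x: "x \<in> finite_closure"
  shows "\<delta> * lp_norm p x \<le> lp_norm p (B x)"
proof (rule field_le_epsilon)
  fix e :: real assume e: "e > 0"
  define b where "b = op_norm p B + \<delta>"
  have b: "b > 0" using op_norm_nonneg[OF B] \<delta> by (simp add: b_def)
  have l: "x \<in> lp p" using x by (auto simp: finite_closure_def)
  obtain R z where z: "supported (cube 0 R) z" "lp_norm p (x - z) \<le> e / b"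
    using x divide_pos_pos[OF e b] unfolding finite_closure_def by blast
  have zl: "z \<in> lp p" using lp_supported_cube[OF z(1)] .
  have xz: "x - z \<in> lp p" using lp_diff(1)[OF l zl] .
  have "lp_norm p x \<le> lp_norm p z + lp_norm p (x - z)" using lp_add(2)[OF zl xz] by simp
  then have "\<delta> * lp_norm p x \<le> \<delta> * lp_norm p z + \<delta> * lp_norm p (x - z)"
    using mult_left_mono[of _ _ \<delta>] \<delta> by (simp add: distrib_left[symmetric])
  moreover have "\<delta> * lp_norm p z \<le> lp_norm p (B z)" by (rule limit_low[OF z(1)])
  moreover have "lp_norm p (B z) \<le> lp_norm p (B x) + lp_norm p (B (x - z))"
    using lp_diff(2)[OF bop_in[OF B, of x] bop_in[OF B, of "x - z"]] bop_diff[OF B l zl] by simp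
  moreover have "lp_norm p (B (x - z)) \<le> op_norm p B * lp_norm p (x - z)" by (rule op_bound[OF B xz])
  moreover have "b * lp_norm p (x - z) \<le> e" using z(2) b by (simp add: field_simps)
  ultimately show "\<delta> * lp_norm p x \<le> lp_norm p (B x) + e" unfolding b_def distrib_right by linarith
qed

lemma finite_closure_inj:
  assumes "x \<in> finite_closure" "y \<in> finite_closure" "B x = B y"
  shows "x = y"
proof -
  have l: "x \<in> lp p" "y \<in> lp p" using assms by (auto simp: finite_closure_def)
  have "\<delta> * lp_norm p (x - y) \<le> lp_norm p (B (x - y))"
    by (rule finite_closure_low[OF finite_closure_diff[OF assms(1,2)]])
  moreover have "B (x - y) = 0" using bop_diff[OF B l] assms(3) by simp
  ultimately have "\<delta> * lp_norm p (x - y) \<le> 0" using lp_zero(2) by metis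
  then have "lp_norm p (x - y) \<le> 0" using \<delta> by (metis mult_le_0_iff not_less)
  then have "lp_norm p (x - y) = 0" using lp_norm_nonneg[OF lp_diff(1)[OF l]] by simp
  then show ?thesis using lp_norm_eq_0[OF lp_diff(1)[OF l]] by simp
qed

text \<open>
  Approximate solutions with errors tending to \<open>0\<close> form a Cauchy sequence by the lower bound of \<open>B\<close>,
  and their limit is an exact solution.
\<close>

lemma finite_closure_onto:
  assumes y: "supported (cube 0 R1) y"
  obtains x where "x \<in> finite_closure" "B x = y"
proof -
  have yl: "y \<in> lp p" using lp_supported_cube[OF y] .
  have "\<exists>x. (\<exists>R. supported (cube 0 R) x) \<and> lp_norm p (B x - y) \<le> inverse (real (Suc j)) * lp_norm p y" for j :: nat
  proof -
    have "inverse (real (Suc j)) > 0" by (simp del: of_nat_Suc)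
    from limit_approximately_onto[OF y this] show ?thesis by metis
  qed
  then obtain x where x: "\<And>j. \<exists>R. supported (cube 0 R) (x j)"
    "\<And>j. lp_norm p (B (x j) - y) \<le> inverse (real (Suc j)) * lp_norm p y" by metis
  have xl: "x j \<in> lp p" for j using x(1)[of j] lp_supported_cube by blast
  have xc: "x j \<in> finite_closure" for j
    unfolding finite_closure_def using xl x(1)[of j] by (auto intro!: exI[of _ "x j"])
  have Bx: "B (x j) - y \<in> lp p" for j using lp_diff(1)[OF bop_in[OF B] yl] .
  have diff: "\<delta> * lp_norm p (x i - x j) \<le> lp_norm p (B (x i) - y) + lp_norm p (B (x j) - y)" for i j
  proof -
    have le: "\<delta> * lp_norm p (x i - x j) \<le> lp_norm p (B (x i - x j))"
      by (rule finite_closure_low[OF finite_closure_diff[OF xc xc]])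
    have eq: "B (x i - x j) = (B (x i) - y) - (B (x j) - y)" using bop_diff[OF B xl xl] by simp
    show ?thesis using le lp_diff(2)[OF Bx Bx, of i j] unfolding eq by (rule order_trans)
  qed
  have bound0: "(\<lambda>j. inverse (real (Suc j)) * lp_norm p y) \<longlonglongrightarrow> 0"
    by (rule tendsto_mult_left_zero[OF LIMSEQ_inverse_real_of_nat])
  have lim0: "(\<lambda>j. lp_norm p (B (x j) - y)) \<longlonglongrightarrow> 0"
  proof (rule tendsto_sandwich[OF _ _ tendsto_const bound0])
    show "\<forall>\<^sub>F j in sequentially. 0 \<le> lp_norm p (B (x j) - y)"
      by (intro always_eventually allI lp_norm_nonneg Bx)
    show "\<forall>\<^sub>F j in sequentially. lp_norm p (B (x j) - y) \<le> inverse (real (Suc j)) * lp_norm p y"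
      by (intro always_eventually allI x(2))
  qed
  obtain z where z: "z \<in> lp p" "(\<lambda>n. lp_norm p (x n - z)) \<longlonglongrightarrow> 0"
  proof (rule lp_complete[of x])
    fix e :: real assume e: "e > 0"
    then have "\<forall>\<^sub>F j in sequentially. lp_norm p (B (x j) - y) < \<delta> * e / 2"
      using \<delta> by (intro order_tendstoD(2)[OF lim0]) simp
    then obtain M where M: "\<And>j. j \<ge> M \<Longrightarrow> lp_norm p (B (x j) - y) < \<delta> * e / 2"
      unfolding eventually_sequentially by blast
    have "lp_norm p (x i - x j) \<le> e" if "i \<ge> M" "j \<ge> M" for i j
    proof -
      have "\<delta> * lp_norm p (x i - x j) \<le> \<delta> * e" using diff[of i j] M[OF that(1)] M[OF that(2)] by linarith
      then show ?thesis using \<delta> by simp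
    qed
    then show "\<exists>M. \<forall>m\<ge>M. \<forall>n\<ge>M. lp_norm p (x m - x n) \<le> e" by blast
  qed (use xl in auto)
  have "z \<in> finite_closure" unfolding finite_closure_def
  proof (intro CollectI conjI z(1) allI impI)
    fix \<epsilon> :: real assume "\<epsilon> > 0"
    then obtain j where j: "lp_norm p (x j - z) < \<epsilon>"
      using eventually_happens'[OF sequentially_bot order_tendstoD(2)[OF z(2)]] by blast
    have "lp_norm p (z - x j) = lp_norm p (x j - z)" using lp_minus(2)[OF lp_diff(1)[OF xl z(1)], of j] by simp
    moreover obtain R where "supported (cube 0 R) (x j)" using x(1)[of j] by blast
    ultimately show "\<exists>R w. supported (cube 0 R) w \<and> lp_norm p (z - w) \<le> \<epsilon>"
      using j by (intro exI[of _ R] exI[of _ "x j"]) linarith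
  qed
  moreover have "B z = y"
  proof -
    have Bz: "B z - y \<in> lp p" using lp_diff(1)[OF bop_in[OF B] yl] .
    have le: "lp_norm p (B z - y) \<le> lp_norm p (B (x j) - y) + op_norm p B * lp_norm p (x j - z)" for j
    proof -
      have eq: "B z - y = (B (x j) - y) - B (x j - z)" using bop_diff[OF B xl z(1)] by simp
      have "lp_norm p (B z - y) \<le> lp_norm p (B (x j) - y) + lp_norm p (B (x j - z))"
        unfolding eq by (rule lp_diff(2)[OF Bx bop_in[OF B]])
      then show ?thesis using op_bound[OF B lp_diff(1)[OF xl z(1)], of j] by linarith
    qed
    have "(\<lambda>j. lp_norm p (B (x j) - y) + op_norm p B * lp_norm p (x j - z)) \<longlonglongrightarrow> 0 + op_norm p B * 0"
      by (intro tendsto_intros lim0 z(2))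
    then have "lp_norm p (B z - y) \<le> 0 + op_norm p B * 0"
      by (rule LIMSEQ_le_const) (use le in blast)
    then have "lp_norm p (B z - y) = 0" using lp_norm_nonneg[OF Bz] by simp
    then show ?thesis using lp_norm_eq_0[OF Bz] by simp
  qed
  ultimately show ?thesis using that by blast
qed

text \<open>
  The inverse of the limit operator on finitely supported data.
\<close>

definition solve :: "('n, 'x) seq \<Rightarrow> ('n, 'x) seq"
  where "solve y = (THE x. x \<in> finite_closure \<and> B x = y)"

lemma solve:
  assumes y: "supported (cube 0 R) y"
  shows "solve y \<in> finite_closure" "B (solve y) = y" "solve y \<in> lp p" "lp_norm p (solve y) \<le> 1 / \<delta> * lp_norm p y"
proof -
  have "\<exists>!x. x \<in> finite_closure \<and> B x = y" using finite_closure_onto[OF y] finite_closure_inj by metis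
  from theI'[OF this] show *: "solve y \<in> finite_closure" "B (solve y) = y" unfolding solve_def by auto
  then show "solve y \<in> lp p" by (simp add: finite_closure_def)
  show "lp_norm p (solve y) \<le> 1 / \<delta> * lp_norm p y"
    using finite_closure_low[OF *(1)] *(2) \<delta> by (simp add: field_simps)
qed

lemma solve_add:
  assumes x: "supported (cube 0 R) x" and y: "supported (cube 0 R) y"
  shows "solve (x + y) = solve x + solve y"
proof (rule finite_closure_inj)
  note xy = solve[OF supported_add[OF x y]] and x = solve[OF x] and y = solve[OF y]
  show "solve (x + y) \<in> finite_closure" by (rule xy(1))
  have "0 - solve y \<in> finite_closure"
  proof -
    have "cscale 0 (solve y) = 0" by (simp add: fun_eq_iff)
    then show ?thesis using finite_closure_diff[OF finite_closure_cscale[OF y(1), of 0] y(1)] by metis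
  qed
  then have "solve x - (0 - solve y) \<in> finite_closure" by (rule finite_closure_diff[OF x(1)])
  then show "solve x + solve y \<in> finite_closure" by simp
  show "B (solve (x + y)) = B (solve x + solve y)" using bop_add[OF B x(3) y(3)] xy(2) x(2) y(2) by simp
qed

lemma solve_cscale:
  assumes x: "supported (cube 0 R) x"
  shows "solve (cscale c x) = cscale c (solve x)"
proof (rule finite_closure_inj)
  note cx = solve[OF supported_cscale[OF x]] and x = solve[OF x]
  show "solve (cscale c x) \<in> finite_closure" by (rule cx(1))
  show "cscale c (solve x) \<in> finite_closure" by (rule finite_closure_cscale[OF x(1)])
  show "B (solve (cscale c x)) = B (cscale c (solve x))" using bop_cscale[OF B x(3)] cx(2) x(2) by simp
qed

end

section \<open>Patching local inverses\<close>

context far_bounded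
begin

text \<open>
  \<open>T\<close> inverts \<open>A\<close> from the right, up to the relative error \<open>\<epsilon>\<close>, on data in the cube of radius \<open>R\<close> around
  \<open>k\<close>, and its values live in the cube of radius \<open>2 R\<close>.
\<close>

definition local_right_inverse :: "int \<Rightarrow> real \<Rightarrow> int ^ 'n \<Rightarrow> (('n, 'x) seq \<Rightarrow> ('n, 'x) seq) \<Rightarrow> bool"
  where "local_right_inverse R \<epsilon> k T \<longleftrightarrow>
    (\<forall>y z. supported (cube k R) y \<longrightarrow> supported (cube k R) z \<longrightarrow> T (y + z) = T y + T z) \<and>
    (\<forall>c y. supported (cube k R) y \<longrightarrow> T (cscale c y) = cscale c (T y)) \<and>
    (\<forall>y. supported (cube k R) y \<longrightarrow> supported (cube k (2 * R)) (T y) \<and>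
      lp_norm p (T y) \<le> 1 / \<delta> * lp_norm p y \<and> lp_norm p (A (T y) - y) \<le> \<epsilon> * lp_norm p y)"

end

text \<open>
  The inverse of the limit operator is translated to \<open>h n\<close> and cut off by a bump. The commutator of
  \<open>A\<close> with the bump and the distance of the translate of \<open>A\<close> from its limit each account for half of the
  error.
\<close>

lemma (in limit_operator) local_inverse_from_limit:
  assumes R: "R > 0" and \<epsilon>: "\<epsilon> > 0"
    and comm: "\<And>k x. x \<in> lp p \<Longrightarrow>
      lp_norm p (A (weight (bump R k) x) - weight (bump R k) (A x)) \<le> \<epsilon> * \<delta> / 2 * lp_norm p x"
  shows "\<exists>n T. local_right_inverse R \<epsilon> (h n) T"
proof -
  have e: "\<epsilon> * \<delta> / 2 > 0" using \<epsilon> \<delta> by simp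
  obtain n where n: "\<forall>x\<in>lp p.
     lp_norm p (cutoff (cube 0 (int (nat (2 * R)))) (translate A (h n) x - B x)) \<le> \<epsilon> * \<delta> / 2 * lp_norm p x"
    using eventually_happens'[OF sequentially_bot conv_eventually[OF e, of 0 "nat (2 * R)"]] by blast
  define k where "k = h n"
  define T where "T y = shifted k (weight (bump R 0) (solve (shifted (- k) y)))" for y
  have sup0: "supported (cube 0 R) (shifted (- k) y)" if "supported (cube k R) y" for y
    using supported_shifted[OF that, of "- k"] by simp
  have T_eq: "T y = weight (bump R k) (shifted k (solve (shifted (- k) y)))" for y
    unfolding T_def by (auto simp: fun_eq_iff bump_shift)
  have "local_right_inverse R \<epsilon> k T" unfolding local_right_inverse_def
  proof (intro conjI allI impI)
    fix y z :: "('n, 'x) seq" assume y: "supported (cube k R) y" and z: "supported (cube k R) z"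
    show "T (y + z) = T y + T z" unfolding T_def shifted_add solve_add[OF sup0[OF y] sup0[OF z]] weight_add shifted_add ..
  next
    fix c and y :: "('n, 'x) seq" assume y: "supported (cube k R) y"
    show "T (cscale c y) = cscale c (T y)" unfolding T_def shifted_cscale solve_cscale[OF sup0[OF y]] weight_cscale shifted_cscale ..
  next
    fix y :: "('n, 'x) seq" assume y: "supported (cube k R) y"
    show "supported (cube k (2 * R)) (T y)" unfolding T_eq by (rule weight_bump_supported[OF R])
    have yl: "y \<in> lp p" using lp_supported_cube[OF y] .
    define x where "x = solve (shifted (- k) y)"
    have x: "B x = shifted (- k) y" "x \<in> lp p" "lp_norm p x \<le> 1 / \<delta> * lp_norm p y"
      using solve[OF sup0[OF y]] lp_norm_shifted[OF yl] unfolding x_def by auto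
    note sx = lp_shifted[OF x(2), of k]
    show "lp_norm p (T y) \<le> 1 / \<delta> * lp_norm p y"
      unfolding T_eq x_def[symmetric] using lp_bump(2)[OF R sx, of k] x(3) lp_norm_shifted[OF x(2)] by simp
    have Ax: "A (shifted k x) \<in> lp p" using bop_in[OF A] .
    have t: "translate A k x \<in> lp p" unfolding translate_def by (rule lp_shifted[OF Ax])
    have tB: "translate A k x - B x \<in> lp p" using lp_diff(1)[OF t bop_in[OF B]] .
    let ?w = "weight (bump R k)"
    have eq0: "?w (A (shifted k x)) - y = shifted k (weight (bump R 0) (translate A k x - B x))"
    proof -
      have "shifted k (weight (bump R 0) (translate A k x)) = ?w (A (shifted k x))"
        unfolding translate_def by (auto simp: fun_eq_iff bump_shift)
      moreover have "shifted k (weight (bump R 0) (B x)) = y"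
        unfolding x(1) weight_bump_id[OF R sup0[OF y]] by simp
      ultimately show ?thesis unfolding weight_diff shifted_diff by simp
    qed
    have "A (T y) - y = (A (?w (shifted k x)) - ?w (A (shifted k x))) + (?w (A (shifted k x)) - y)"
      unfolding T_eq x_def[symmetric] by simp
    then have eq: "A (T y) - y = (A (?w (shifted k x)) - ?w (A (shifted k x))) + shifted k (weight (bump R 0) (translate A k x - B x))"
      unfolding eq0 .
    have 1: "lp_norm p (A (?w (shifted k x)) - ?w (A (shifted k x))) \<le> \<epsilon> * \<delta> / 2 * lp_norm p x"
      using comm[OF sx, of k] lp_norm_shifted[OF x(2)] by simp
    have 2: "lp_norm p (shifted k (weight (bump R 0) (translate A k x - B x))) \<le> \<epsilon> * \<delta> / 2 * lp_norm p x"
      unfolding lp_norm_shifted[OF lp_bump(1)[OF R tB]]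
      using lp_bump_cutoff[OF R tB, of 0] n x(2) R unfolding k_def by force
    have 3: "\<epsilon> * \<delta> / 2 * lp_norm p x \<le> \<epsilon> * \<delta> / 2 * (1 / \<delta> * lp_norm p y)"
      using e x(3) by (intro mult_left_mono) auto
    have 4: "\<epsilon> * \<delta> / 2 * (1 / \<delta> * lp_norm p y) = \<epsilon> / 2 * lp_norm p y" using \<delta> by simp
    have "lp_norm p (A (T y) - y) \<le> lp_norm p (A (?w (shifted k x)) - ?w (A (shifted k x)))
        + lp_norm p (shifted k (weight (bump R 0) (translate A k x - B x)))"
      unfolding eq by (rule lp_add(2)[OF lp_diff(1)[OF bop_in[OF A] lp_bump(1)[OF R Ax]] lp_shifted[OF lp_bump(1)[OF R tB]]])
    then have "lp_norm p (A (T y) - y) \<le> \<epsilon> / 2 * lp_norm p y + \<epsilon> / 2 * lp_norm p y"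
      using 1 2 3 4 by linarith
    then show "lp_norm p (A (T y) - y) \<le> \<epsilon> * lp_norm p y" by simp
  qed
  then show ?thesis unfolding k_def by blast
qed

text \<open>
  Otherwise there would be positions tending to infinity without local inverse; by richness a
  subsequence has a limit operator, which provides one.
\<close>

lemma (in far_bounded) local_inverses:
  assumes rich: "rich p A" and R: "R > 0" and \<epsilon>: "\<epsilon> > 0"
    and comm: "\<And>k x. x \<in> lp p \<Longrightarrow>
      lp_norm p (A (weight (bump R k) x) - weight (bump R k) (A x)) \<le> \<epsilon> * \<delta> / 2 * lp_norm p x"
  shows "\<exists>M::nat. \<forall>k. k \<notin> cube 0 (int M) \<longrightarrow> (\<exists>T. local_right_inverse R \<epsilon> k T)"
proof (rule ccontr)
  assume "\<not> ?thesis"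
  then have "\<forall>M::nat. \<exists>k. k \<notin> cube 0 (int M) \<and> \<not> (\<exists>T. local_right_inverse R \<epsilon> k T)" by blast
  then obtain g where g: "\<And>M. g M \<notin> cube 0 (int M)" "\<And>M. \<not> (\<exists>T. local_right_inverse R \<epsilon> (g M) T)" by metis
  have inf: "\<forall>\<^sub>F n in sequentially. g n \<notin> cube 0 (int M)" for M
    using eventually_ge_at_top[of M]
  proof (rule eventually_mono)
    fix n assume "n \<ge> M"
    then show "g n \<notin> cube 0 (int M)" using g(1)[of n] cube_mono[of "int M" "int n" 0] by auto
  qed
  then have "tends_to_infinity g" unfolding tends_to_infinity_iff by blast
  then obtain r B where r: "strict_mono r" and B: "is_limit_op p A (g \<circ> r) B"
    using rich unfolding rich_def by blast
  have "tends_to_infinity (g \<circ> r)" unfolding tends_to_infinity_iff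
    using eventually_subseq[OF r inf] by simp
  moreover note limit_op_locally_converges[OF A B]
  ultimately interpret limit_operator p A \<delta> m "g \<circ> r" B
    by unfold_locales (simp_all add: o_def)
  show False using local_inverse_from_limit[OF R \<epsilon> comm] g(2) by auto
qed

context far_bounded
begin

text \<open>
  The map \<open>\<kappa>\<close> sends an index to the centre of its tile, of radius \<open>3 R + 1\<close>. Data are read from the inner
  cube of radius \<open>R\<close>, the local inverse spreads them to radius \<open>2 R\<close>, and an operator \<open>A'\<close> of propagation
  \<open>R\<close> close to \<open>A\<close> spreads them to radius \<open>3 R\<close>: everything stays inside the tile, so the blockwise
  estimates add up by \<open>lp_blocks\<close>. The factor \<open>2\<close> in the error comes from replacing \<open>A\<close> by \<open>A'\<close> and
  back.
\<close>

lemma patch_one_colour: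
  fixes \<kappa> :: "int ^ 'n \<Rightarrow> int ^ 'n" and M :: nat
  assumes R: "R > 0" and \<epsilon>: "\<epsilon> > 0" and \<epsilon>': "\<epsilon>' > 0"
    and tile: "\<And>i. i \<in> cube (\<kappa> i) (3 * R + 1)"
    and tile_unique: "\<And>i j. i \<in> cube (\<kappa> j) (3 * R + 1) \<Longrightarrow> \<kappa> i = \<kappa> j"
    and T: "\<And>k. k \<notin> cube 0 (int M) \<Longrightarrow> local_right_inverse R \<epsilon> k (T k)"
    and A': "A' \<in> bounded_ops p" "propagates R A'" "\<And>x. x \<in> lp p \<Longrightarrow> lp_norm p (A x - A' x) \<le> \<epsilon>' * lp_norm p x"
  defines "U \<equiv> {i. i \<in> cube (\<kappa> i) R \<and> \<kappa> i \<notin> cube 0 (int M)}"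
  shows "\<exists>B\<in>L_ops p. \<forall>y\<in>lp p. lp_norm p (A (B y) - cutoff U y) \<le> (\<epsilon> + 2 * \<epsilon>' / \<delta>) * lp_norm p y"
proof -
  define S where "S k y = (if k \<notin> cube 0 (int M) then T k (cutoff (cube k R) y) else 0)" for k y
  define G where "G y = (\<lambda>i. S (\<kappa> i) y i)" for y
  define K where "K = {k \<in> range \<kappa>. k \<notin> cube 0 (int M)}"
  have S_add: "S k (y + z) = S k y + S k z" for k y z
  proof (cases "k \<in> cube 0 (int M)")
    case False
    have "T k (cutoff (cube k R) y + cutoff (cube k R) z) = T k (cutoff (cube k R) y) + T k (cutoff (cube k R) z)"
      using T[OF False] supported_cutoff[of "cube k R" y] supported_cutoff[of "cube k R" z]
      unfolding local_right_inverse_def by blast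
    then show ?thesis using False unfolding S_def by (simp add: cutoff_add)
  qed (simp add: S_def)
  have S_cscale: "S k (cscale c y) = cscale c (S k y)" for k c y
    using T[of k] supported_cutoff[of "cube k R" y] unfolding S_def local_right_inverse_def by (auto simp: cutoff_cscale fun_eq_iff)
  have S_sup: "supported (cube k (2 * R)) (S k y)" for k y
    using T[of k] supported_cutoff[of "cube k R" y] unfolding S_def local_right_inverse_def by (auto simp: supported_def)
  have S_lp: "S k y \<in> lp p" for k y using lp_supported_cube[OF S_sup] .
  have S_norm: "lp_norm p (S k y) \<le> 1 / \<delta> * lp_norm p (cutoff (cube k R) y)" if "k \<in> K" for k y
    using T[of k] supported_cutoff[of "cube k R" y] that unfolding S_def local_right_inverse_def K_def by simp
  have S_inv: "lp_norm p (A (S k y) - cutoff (cube k R) y) \<le> \<epsilon> * lp_norm p (cutoff (cube k R) y)" if "k \<in> K" for k y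
    using T[of k] supported_cutoff[of "cube k R" y] that unfolding S_def local_right_inverse_def K_def by simp
  have S_off: "S (\<kappa> i) y = 0" if "\<kappa> i \<notin> K" for i y
    using that unfolding S_def K_def by auto
  have big: "cube k R \<subseteq> cube k (3 * R + 1)" "cube k (2 * R) \<subseteq> cube k (3 * R + 1)" "cube k (3 * R) \<subseteq> cube k (3 * R + 1)"
    for k :: "int ^ 'n" by (rule cube_mono, use R in simp)+
  have tileK: "\<kappa> i = k" if "i \<in> cube k (3 * R + 1)" "k \<in> K" for i k
    using that tile_unique unfolding K_def by blast
  \<comment> \<open>Within distance \<open>R\<close> of a point only the piece of the tile of that point is nonzero.\<close>
  have sees: "S (\<kappa> j) y j = S (\<kappa> i) y j" if j: "j \<in> cube i R" for i j y
  proof (cases "\<kappa> j = \<kappa> i")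
    case False
    have "S (\<kappa> j) y j = 0"
    proof (rule ccontr)
      assume "S (\<kappa> j) y j \<noteq> 0"
      then have "j \<in> cube (\<kappa> j) (2 * R)" using S_sup unfolding supported_def by blast
      moreover have "i \<in> cube j R" using j cube_sym by blast
      ultimately have "i \<in> cube (\<kappa> j) (R + 2 * R)" using cube_trans by blast
      then have "i \<in> cube (\<kappa> j) (3 * R + 1)" using big(3) by auto
      then show False using tile_unique False by metis
    qed
    moreover have "S (\<kappa> i) y j = 0"
    proof (rule ccontr)
      assume "S (\<kappa> i) y j \<noteq> 0"
      then have "j \<in> cube (\<kappa> i) (2 * R)" using S_sup unfolding supported_def by blast
      then show False using tile_unique big(2) False by blast
    qed
    ultimately show ?thesis by simp
  qed simp
  have disj: "cube k R \<inter> cube l R = {}" if "k \<in> K" "l \<in> K" "k \<noteq> l" for k l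
    using tileK[OF _ that(1)] tileK[OF _ that(2)] big(1) that(3) by blast
  have G_block: "cutoff (cube k (3 * R + 1)) (G y) = S k y" if k: "k \<in> K" for k y
  proof
    fix i
    show "cutoff (cube k (3 * R + 1)) (G y) i = S k y i"
    proof (cases "i \<in> cube k (3 * R + 1)")
      case True
      then show ?thesis using tileK[OF True k] by (simp add: cutoff_apply G_def)
    next
      case False
      then have "i \<notin> cube k (2 * R)" using big(2) by blast
      then show ?thesis using False S_sup[of k y] by (simp add: cutoff_apply supported_def)
    qed
  qed
  have Gy: "G y \<in> lp p \<and> lp_norm p (G y) \<le> 1 / \<delta> * lp_norm p y" if y: "y \<in> lp p" for y
  proof -
    have supp: "\<exists>k\<in>K. i \<in> cube k (3 * R + 1)" if "G y i \<noteq> 0" for i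
      using that S_off[of i y] tile[of i] unfolding G_def by fastforce
    have le: "lp_norm p (cutoff (cube k (3 * R + 1)) (G y)) \<le> 1 / \<delta> * lp_norm p (cutoff (cube k R) y)" if "k \<in> K" for k
      unfolding G_block[OF that] by (rule S_norm[OF that])
    have "0 \<le> 1 / \<delta>" using \<delta> by simp
    from lp_blocks[OF y this finite_cube finite_cube disj supp le] show ?thesis by blast
  qed
  define B where "B = on_lp p G"
  have G_add: "G (y + z) = G y + G z" for y z unfolding G_def S_add by (simp add: fun_eq_iff)
  have G_cscale: "G (cscale c y) = cscale c (G y)" for c y unfolding G_def S_cscale by (simp add: fun_eq_iff)
  have Bb: "B \<in> bounded_ops p" unfolding B_def
    by (rule on_lp_bop[where C = "1 / \<delta>"]) (use Gy G_add G_cscale in auto)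
  have "propagates (4 * R + 1) B" unfolding propagates_def
  proof (intro ballI allI impI)
    fix y :: "('n, 'x) seq" and i assume y: "y \<in> lp p" and z: "\<forall>j\<in>cube i (4 * R + 1). y j = 0"
    have "y j = 0" if "j \<in> cube (\<kappa> i) R" for j
    proof -
      have "\<kappa> i \<in> cube i (3 * R + 1)" using tile cube_sym by blast
      from cube_trans[OF that this] have "j \<in> cube i (4 * R + 1)" by (simp add: algebra_simps)
      then show ?thesis using z by blast
    qed
    then have "cutoff (cube (\<kappa> i) R) y = 0" by (auto simp: cutoff_apply fun_eq_iff)
    then have "S (\<kappa> i) y = S (\<kappa> i) 0" unfolding S_def by (simp add: cutoff_def zero_fun_def)
    also have "\<dots> = 0" using S_add[of "\<kappa> i" 0 0] by simp
    finally show "B y i = 0" using y by (simp add: B_def on_lp_apply G_def)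
  qed
  then have BL: "B \<in> L_ops p" by (rule propagates_L[OF Bb])
  have main: "lp_norm p (A' (G y) - cutoff U y) \<le> (\<epsilon> + \<epsilon>' / \<delta>) * lp_norm p y" if y: "y \<in> lp p" for y
  proof -
    have local: "A' (G y) i = A' (S (\<kappa> i) y) i" for i
    proof -
      have d: "G y - S (\<kappa> i) y \<in> lp p" using lp_diff(1) Gy[OF y] S_lp by blast
      have "\<forall>j\<in>cube i R. (G y - S (\<kappa> i) y) j = 0" using sees by (simp add: G_def)
      then have "A' (G y - S (\<kappa> i) y) i = 0" using A'(2) d unfolding propagates_def by blast
      then show ?thesis using bop_diff[OF A'(1), of "G y" "S (\<kappa> i) y"] Gy[OF y] S_lp by simp
    qed
    have supp: "\<exists>k\<in>K. i \<in> cube k (3 * R + 1)" if "(A' (G y) - cutoff U y) i \<noteq> 0" for i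
    proof (rule ccontr)
      assume "\<not> ?thesis"
      then have "\<kappa> i \<notin> K" using tile by blast
      then have "A' (G y) i = 0" "i \<notin> U"
        using local[of i] S_off[of i y] bop_zero[OF A'(1)] unfolding U_def K_def by auto
      then show False using that by (simp add: cutoff_apply)
    qed
    have le: "lp_norm p (cutoff (cube k (3 * R + 1)) (A' (G y) - cutoff U y)) \<le> (\<epsilon> + \<epsilon>' / \<delta>) * lp_norm p (cutoff (cube k R) y)"
      if k: "k \<in> K" for k
    proof -
      let ?z = "cutoff (cube k R) y"
      have zl: "?z \<in> lp p" using lp_cutoff(1)[OF y] .
      have "cutoff (cube k (3 * R + 1)) (A' (G y) - cutoff U y) = A' (S k y) - ?z"
      proof
        fix i
        show "cutoff (cube k (3 * R + 1)) (A' (G y) - cutoff U y) i = (A' (S k y) - ?z) i"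
        proof (cases "i \<in> cube k (3 * R + 1)")
          case True
          have ki: "\<kappa> i = k" using tileK[OF True k] .
          then have "i \<in> U \<longleftrightarrow> i \<in> cube k R" using k unfolding U_def K_def by auto
          then show ?thesis using True local[of i] ki by (simp add: cutoff_apply)
        next
          case False
          have "S k y j = 0" if "j \<in> cube i R" for j
          proof (rule ccontr)
            assume "S k y j \<noteq> 0"
            then have "j \<in> cube k (2 * R)" using S_sup unfolding supported_def by blast
            moreover have "i \<in> cube j R" using that cube_sym by blast
            ultimately have "i \<in> cube k (R + 2 * R)" using cube_trans by blast
            then show False using False big(3) by auto
          qed
          then have "A' (S k y) i = 0" using A'(2) S_lp unfolding propagates_def by blast
          moreover have "i \<notin> cube k R" using False big(1) by blast
          ultimately show ?thesis using False by (simp add: cutoff_apply)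
        qed
      qed
      moreover have eq: "A' (S k y) - ?z = (A (S k y) - ?z) - (A (S k y) - A' (S k y))" by simp
      have "lp_norm p (A' (S k y) - ?z) \<le> lp_norm p (A (S k y) - ?z) + lp_norm p (A (S k y) - A' (S k y))"
        unfolding eq
        by (rule lp_diff(2)[OF lp_diff(1)[OF bop_in[OF A] zl] lp_diff(1)[OF bop_in[OF A] bop_in[OF A'(1)]]])
      moreover have "lp_norm p (A (S k y) - A' (S k y)) \<le> \<epsilon>' / \<delta> * lp_norm p ?z"
      proof -
        have "lp_norm p (A (S k y) - A' (S k y)) \<le> \<epsilon>' * lp_norm p (S k y)" by (rule A'(3)[OF S_lp])
        also have "\<dots> \<le> \<epsilon>' * (1 / \<delta> * lp_norm p ?z)" using S_norm[OF k] \<epsilon>' by (intro mult_left_mono) auto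
        finally show ?thesis by simp
      qed
      ultimately show ?thesis using S_inv[OF k, of y] by (simp add: distrib_right)
    qed
    have "0 \<le> \<epsilon> + \<epsilon>' / \<delta>" using \<epsilon> \<epsilon>' \<delta> by simp
    from lp_blocks(2)[OF y this finite_cube finite_cube disj supp le] show ?thesis by blast
  qed
  have "lp_norm p (A (B y) - cutoff U y) \<le> (\<epsilon> + 2 * \<epsilon>' / \<delta>) * lp_norm p y" if y: "y \<in> lp p" for y
  proof -
    have By: "B y = G y" using y by (simp add: B_def on_lp_apply)
    have G1: "G y \<in> lp p" "lp_norm p (G y) \<le> 1 / \<delta> * lp_norm p y" using Gy[OF y] by auto
    have eq: "A (G y) - cutoff U y = (A (G y) - A' (G y)) + (A' (G y) - cutoff U y)" by simp
    have 1: "lp_norm p (A (G y) - cutoff U y) \<le> lp_norm p (A (G y) - A' (G y)) + lp_norm p (A' (G y) - cutoff U y)"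
      unfolding eq
      by (rule lp_add(2)[OF lp_diff(1)[OF bop_in[OF A] bop_in[OF A'(1)]] lp_diff(1)[OF bop_in[OF A'(1)] lp_cutoff(1)[OF y]]])
    have 2: "lp_norm p (A (G y) - A' (G y)) \<le> \<epsilon>' * lp_norm p (G y)" by (rule A'(3)[OF G1(1)])
    have 3: "\<epsilon>' * lp_norm p (G y) \<le> \<epsilon>' * (1 / \<delta> * lp_norm p y)" using G1(2) \<epsilon>' by (intro mult_left_mono) auto
    have 4: "\<epsilon>' * (1 / \<delta> * lp_norm p y) + (\<epsilon> + \<epsilon>' / \<delta>) * lp_norm p y = (\<epsilon> + 2 * \<epsilon>' / \<delta>) * lp_norm p y"
      by (simp add: algebra_simps)
    show ?thesis unfolding By using 1 2 3 4 main[OF y] by linarith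
  qed
  then show ?thesis using BL by blast
qed

end

text \<open>
  The centres of colour \<open>c\<close> form the lattice \<open>(2 R + 1) (c + 3 \<int>\<^sup>N)\<close>; the tiles of radius \<open>3 R + 1\<close> around them
  have side \<open>6 R + 3\<close> and fill the whole lattice without overlap.
\<close>

definition tile_centre :: "int \<Rightarrow> int ^ 'n \<Rightarrow> int ^ 'n::finite \<Rightarrow> int ^ 'n"
  where "tile_centre R c i = (\<chi> j. (2 * R + 1) * c $ j +
    (6 * R + 3) * ((i $ j - (2 * R + 1) * c $ j + (3 * R + 1)) div (6 * R + 3)))"

lemma int_tile:
  fixes R t :: int
  assumes "R > 0"
  shows "\<bar>t - (6 * R + 3) * ((t + (3 * R + 1)) div (6 * R + 3))\<bar> \<le> 3 * R + 1"
proof -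
  let ?s = "6 * R + 3" and ?u = "t + (3 * R + 1)"
  have "?s * (?u div ?s) + ?u mod ?s = ?u" by simp
  moreover have "0 \<le> ?u mod ?s" "?u mod ?s < ?s" using assms by (simp_all add: pos_mod_bound)
  ultimately show ?thesis by linarith
qed

lemma int_tile_unique:
  fixes R t g :: int
  assumes "R > 0" "\<bar>t - (6 * R + 3) * g\<bar> \<le> 3 * R + 1"
  shows "(t + (3 * R + 1)) div (6 * R + 3) = g"
proof -
  have "t + (3 * R + 1) = (6 * R + 3) * g + (t - (6 * R + 3) * g + (3 * R + 1))" by simp
  moreover have "0 \<le> t - (6 * R + 3) * g + (3 * R + 1)" "t - (6 * R + 3) * g + (3 * R + 1) < 6 * R + 3"
    using assms(2) by linarith+
  ultimately show ?thesis by (metis div_pos_pos_trivial div_mult_self4 add.right_neutral add.commute assms(1) not_less add_pos_pos mult_pos_pos zero_less_numeral less_irrefl)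
qed

lemma tile_centre_mem: "R > 0 \<Longrightarrow> i \<in> cube (tile_centre R c i) (3 * R + 1)"
  unfolding mem_cube tile_centre_def using int_tile[of R "i $ j - (2 * R + 1) * c $ j" for j]
  by (simp add: algebra_simps)

lemma tile_centre_unique:
  assumes R: "R > 0" and i: "i \<in> cube (tile_centre R c j) (3 * R + 1)"
  shows "tile_centre R c i = tile_centre R c j"
proof -
  have "(i $ l - (2 * R + 1) * c $ l + (3 * R + 1)) div (6 * R + 3) =
    (j $ l - (2 * R + 1) * c $ l + (3 * R + 1)) div (6 * R + 3)" for l
    by (rule int_tile_unique[OF R]) (use i in \<open>simp add: mem_cube tile_centre_def algebra_simps\<close>)
  then show ?thesis unfolding tile_centre_def by simp
qed

text \<open>
  The inner cubes of all colours together are the tiling by cubes of side \<open>2 R + 1\<close>, each of which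
  belongs to one colour, the residue of its position modulo \<open>3\<close>.
\<close>

lemma tile_colour:
  fixes i :: "int ^ 'n::finite"
  assumes R: "R > 0"
  shows "\<exists>!c. c \<in> cube 0 1 \<and> i \<in> cube (tile_centre R c i) R"
proof
  define g where "g l = (i $ l + R) div (2 * R + 1)" for l
  define c :: "int ^ 'n" where "c = (\<chi> l. (g l + 1) mod 3 - 1)"
  have gb: "\<bar>i $ l - (2 * R + 1) * g l\<bar> \<le> R" for l
  proof -
    let ?s = "2 * R + 1" and ?u = "i $ l + R"
    have "?s * (?u div ?s) + ?u mod ?s = ?u" by simp
    moreover have "0 \<le> ?u mod ?s" "?u mod ?s < ?s" using R pos_mod_bound[of ?s ?u] by simp_all
    ultimately show ?thesis unfolding g_def by linarith
  qed
  have gc: "g l = c $ l + 3 * ((g l + 1) div 3)" for l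
  proof -
    have "c $ l = (g l + 1) mod 3 - 1" by (simp add: c_def)
    then show ?thesis using mult_div_mod_eq[of 3 "g l + 1"] by linarith
  qed
  have "tile_centre R c i $ l = (2 * R + 1) * g l" for l
  proof -
    have e: "(2 * R + 1) * g l = (2 * R + 1) * c $ l + (6 * R + 3) * ((g l + 1) div 3)"
      using arg_cong[OF gc[of l], of "\<lambda>z. (2 * R + 1) * z"] by (simp add: algebra_simps)
    have "(i $ l - (2 * R + 1) * c $ l + (3 * R + 1)) div (6 * R + 3) = (g l + 1) div 3"
    proof (rule int_tile_unique[OF R])
      have "i $ l - (2 * R + 1) * c $ l - (6 * R + 3) * ((g l + 1) div 3) = i $ l - (2 * R + 1) * g l"
        using e by linarith
      then show "\<bar>i $ l - (2 * R + 1) * c $ l - (6 * R + 3) * ((g l + 1) div 3)\<bar> \<le> 3 * R + 1"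
        using gb[of l] R by simp
    qed
    then show ?thesis using e by (simp add: tile_centre_def)
  qed
  then have "i \<in> cube (tile_centre R c i) R" using gb by (simp add: mem_cube)
  moreover have "c \<in> cube 0 1"
  proof -
    have "\<bar>(g l + 1) mod 3 - 1\<bar> \<le> 1" for l by (smt (verit) pos_mod_bound pos_mod_sign)
    then show ?thesis by (simp add: mem_cube c_def)
  qed
  ultimately show "c \<in> cube 0 1 \<and> i \<in> cube (tile_centre R c i) R" by blast
  fix d assume d: "d \<in> cube 0 1 \<and> i \<in> cube (tile_centre R d i) R"
  have "d $ l = c $ l" for l
  proof -
    define u where "u = (i $ l - (2 * R + 1) * d $ l + (3 * R + 1)) div (6 * R + 3)"
    have "\<bar>i $ l - ((2 * R + 1) * d $ l + (6 * R + 3) * u)\<bar> \<le> R"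
      using d unfolding mem_cube tile_centre_def u_def by simp
    then have "\<bar>(2 * R + 1) * (g l - (d $ l + 3 * u))\<bar> \<le> 2 * R"
      using gb[of l] by (simp add: algebra_simps)
    then have "\<bar>g l - (d $ l + 3 * u)\<bar> < 1"
    proof -
      assume a: "\<bar>(2 * R + 1) * (g l - (d $ l + 3 * u))\<bar> \<le> 2 * R"
      show ?thesis
      proof (rule ccontr)
        assume "\<not> ?thesis"
        then have "(2 * R + 1) * 1 \<le> (2 * R + 1) * \<bar>g l - (d $ l + 3 * u)\<bar>" using R by (intro mult_left_mono) auto
        also have "\<dots> = \<bar>(2 * R + 1) * (g l - (d $ l + 3 * u))\<bar>" using R by (simp add: abs_mult)
        also note a
        finally show False by simp
      qed
    qed
    then have e: "g l + 1 = (d $ l + 1) + 3 * u" by linarith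
    have "\<bar>d $ l\<bar> \<le> 1" using d by (simp add: mem_cube)
    then have "(d $ l + 1) mod 3 = d $ l + 1" by (intro mod_pos_pos_trivial) linarith+
    then have "(g l + 1) mod 3 = d $ l + 1" unfolding e mod_mult_self2 .
    then show ?thesis by (simp add: c_def)
  qed
  then show "d = c" by (simp add: vec_eq_iff)
qed

section \<open>Neumann series and the parametrix\<close>

context lp_exponent
begin

text \<open>
  \<open>(I + E)\<^sup>-\<^sup>1\<close> as the fixed point of \<open>z = x - E z\<close>. The iterates are operators in \<open>L\<close> and converge
  uniformly on bounded sets, so the limit is in \<open>L\<close>; uniqueness of the fixed point makes it linear.
\<close>

lemma neumann_inverse:
  fixes E :: "('n::finite, 'x::complex_banach) seq_op"
  assumes E: "E \<in> L_ops p" and le: "\<And>x. x \<in> lp p \<Longrightarrow> lp_norm p (E x) \<le> 1 / 2 * lp_norm p x"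
  obtains S where "S \<in> L_ops p" "\<And>x. x \<in> lp p \<Longrightarrow> S x + E (S x) = x"
proof -
  have Eb: "E \<in> bounded_ops p" by (rule L_bop[OF E])
  define s :: "nat \<Rightarrow> ('n, 'x) seq_op" where "s = rec_nat 0 (\<lambda>_ T. id_op p - (E \<circ> T))"
  have s0: "s 0 = 0" and sS: "s (Suc n) = id_op p - (E \<circ> s n)" for n by (simp_all add: s_def)
  have sL: "s n \<in> L_ops p" for n
  proof (induction n)
    case 0
    have "(0 :: ('n, 'x) seq_op) = (\<Sum>k\<in>({} :: nat set). 0)" by (rule sum.empty[symmetric])
    then show ?case unfolding s0 using L_sum[of "{} :: nat set" "\<lambda>_. 0 :: ('n, 'x) seq_op"] by (metis empty_iff)
  next
    case (Suc n)
    show ?case unfolding sS using L_add[OF L_id L_uminus[OF L_comp[OF E Suc]]] by (metis diff_conv_add_uminus)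
  qed
  have sb: "s n \<in> bounded_ops p" for n by (rule L_bop[OF sL])
  have s_step: "s (Suc n) x = x - E (s n x)" if "x \<in> lp p" for n x
    using that by (simp add: sS id_apply)
  have s_norm: "lp_norm p (s n x) \<le> 2 * lp_norm p x" if x: "x \<in> lp p" for n x
  proof (induction n)
    case 0
    show ?case using lp_norm_nonneg[OF x] by (simp add: s0)
  next
    case (Suc n)
    have "lp_norm p (x - E (s n x)) \<le> lp_norm p x + lp_norm p (E (s n x))" by (rule lp_diff(2)[OF x bop_in[OF Eb]])
    then show ?case unfolding s_step[OF x] using le[OF bop_in[OF sb], of n x] Suc by linarith
  qed
  have s_diff: "lp_norm p (s (n + d) x - s n x) \<le> (1 / 2) ^ n * (2 * lp_norm p x)" if x: "x \<in> lp p" for n d x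
  proof (induction n)
    case 0
    show ?case using s_norm[OF x, of d] by (simp add: s0)
  next
    case (Suc n)
    have i: "s (n + d) x \<in> lp p" "s n x \<in> lp p" using bop_in[OF sb] by auto
    have eq: "s (Suc n + d) x - s (Suc n) x = E (s n x - s (n + d) x)"
      using s_step[OF x, of "n + d"] s_step[OF x, of n] bop_diff[OF Eb i(2,1)] by simp
    have "lp_norm p (s n x - s (n + d) x) = lp_norm p (s (n + d) x - s n x)"
      using lp_minus(2)[OF lp_diff(1)[OF i]] by simp
    moreover have "lp_norm p (E (s n x - s (n + d) x)) \<le> 1 / 2 * lp_norm p (s n x - s (n + d) x)"
      by (rule le[OF lp_diff(1)[OF i(2,1)]])
    moreover have "(1 / 2) ^ Suc n * (2 * lp_norm p x) = 1 / 2 * ((1 / 2) ^ n * (2 * lp_norm p x))" by simp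
    ultimately show ?case unfolding eq using Suc.IH by linarith
  qed
  have geom: "(\<lambda>n. (1 / 2) ^ n * C) \<longlonglongrightarrow> 0" for C :: real
    by (rule tendsto_mult_left_zero[OF LIMSEQ_power_zero]) simp
  have small: "\<exists>n0. \<forall>n\<ge>n0. (1 / 2) ^ n * C \<le> e" if "e > 0" for C e :: real
  proof -
    have "\<forall>\<^sub>F n in sequentially. (1 / 2) ^ n * C < e" by (rule order_tendstoD(2)[OF geom that])
    then show ?thesis unfolding eventually_sequentially by (meson less_imp_le)
  qed
  have "\<exists>z\<in>lp p. (\<lambda>n. lp_norm p (s n x - z)) \<longlonglongrightarrow> 0" if x: "x \<in> lp p" for x
  proof -
    have "\<exists>M. \<forall>m\<ge>M. \<forall>n\<ge>M. lp_norm p (s m x - s n x) \<le> e" if e: "e > 0" for e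
    proof -
      obtain M where M: "\<forall>n\<ge>M. (1 / 2) ^ n * (2 * lp_norm p x) \<le> e" using small[OF e] by blast
      have "lp_norm p (s m x - s n x) \<le> e" if "m \<ge> M" "n \<ge> M" "m \<ge> n" for m n
      proof -
        have "lp_norm p (s m x - s n x) \<le> (1 / 2) ^ n * (2 * lp_norm p x)"
          using s_diff[OF x, of n "m - n"] that(3) by simp
        then show ?thesis using M that(2) by (meson order_trans)
      qed
      moreover have "lp_norm p (s m x - s n x) = lp_norm p (s n x - s m x)" for m n
        using lp_minus(2)[OF lp_diff(1)[OF bop_in[OF sb] bop_in[OF sb]], of m x n x] by simp
      ultimately show ?thesis by (metis nat_le_linear)
    qed
    from lp_complete[OF bop_in[OF sb] this] show ?thesis by metis
  qed
  then obtain z where z: "\<And>x. x \<in> lp p \<Longrightarrow> z x \<in> lp p"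
    "\<And>x. x \<in> lp p \<Longrightarrow> (\<lambda>n. lp_norm p (s n x - z x)) \<longlonglongrightarrow> 0" by metis
  have fix_unique: "u = v" if "x \<in> lp p" "u \<in> lp p" "v \<in> lp p" "u + E u = x" "v + E v = x" for x u v
  proof -
    have uv: "u - v \<in> lp p" using lp_diff(1) that by blast
    have eu: "u = x - E u" and ev: "v = x - E v" using that(4,5) by (simp_all only: eq_diff_eq)
    have "(x - E u) - (x - E v) = - (E u - E v)" by simp
    then have "u - v = - E (u - v)"
      unfolding bop_diff[OF Eb that(2,3)] using arg_cong2[OF eu ev, of minus] by (rule trans[rotated])
    then have "lp_norm p (u - v) = lp_norm p (E (u - v))" using lp_minus(2)[OF bop_in[OF Eb]] by metis
    then have "lp_norm p (u - v) \<le> 0" using le[OF uv] lp_norm_nonneg[OF uv] by linarith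
    then have "u - v = 0" using lp_norm_eq_0[OF uv] lp_norm_nonneg[OF uv] by linarith
    then show ?thesis by simp
  qed
  have fix_z: "z x + E (z x) = x" if x: "x \<in> lp p" for x
  proof -
    let ?r = "z x + E (z x) - x"
    have r: "?r \<in> lp p" using lp_diff(1)[OF lp_add(1)[OF z(1)[OF x] bop_in[OF Eb]] x] .
    have "lp_norm p ?r \<le> lp_norm p (s (Suc n) x - z x) + lp_norm p (s n x - z x)" for n
    proof -
      have i: "s (Suc n) x - z x \<in> lp p" "s n x - z x \<in> lp p"
        using lp_diff(1)[OF bop_in[OF sb] z(1)[OF x]] by auto
      have eq: "?r = - (s (Suc n) x - z x) - E (s n x - z x)"
        unfolding bop_diff[OF Eb bop_in[OF sb] z(1)[OF x]] s_step[OF x] by simp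
      have "lp_norm p ?r \<le> lp_norm p (- (s (Suc n) x - z x)) + lp_norm p (E (s n x - z x))"
        unfolding eq by (rule lp_diff(2)[OF lp_minus(1)[OF i(1)] bop_in[OF Eb]])
      then show ?thesis using lp_minus(2)[OF i(1)] le[OF i(2)] lp_norm_nonneg[OF i(2)] by linarith
    qed
    moreover have "(\<lambda>n. lp_norm p (s (Suc n) x - z x) + lp_norm p (s n x - z x)) \<longlonglongrightarrow> 0 + 0"
      by (intro tendsto_add LIMSEQ_Suc z(2) x)
    ultimately have "lp_norm p ?r \<le> 0 + 0" by (intro LIMSEQ_le_const[of _ "0 + 0"]) auto
    then have "?r = 0" using lp_norm_eq_0[OF r] lp_norm_nonneg[OF r] by linarith
    then show ?thesis by simp
  qed
  have z_norm: "lp_norm p (z x) \<le> 2 * lp_norm p x" if x: "x \<in> lp p" for x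
  proof -
    have eq: "z x = x - E (z x)" using fix_z[OF x] by (simp only: eq_diff_eq)
    have "lp_norm p (x - E (z x)) \<le> lp_norm p x + lp_norm p (E (z x))"
      by (rule lp_diff(2)[OF x bop_in[OF Eb]])
    then have "lp_norm p (z x) \<le> lp_norm p x + lp_norm p (E (z x))" unfolding eq[symmetric] .
    then show ?thesis using le[OF z(1)[OF x]] by linarith
  qed
  define S where "S = on_lp p z"
  have Sb: "S \<in> bounded_ops p" unfolding S_def
  proof (rule on_lp_bop[where C = 2])
    fix x y :: "('n, 'x) seq" assume x: "x \<in> lp p" and y: "y \<in> lp p"
    show "z (x + y) = z x + z y"
    proof (rule fix_unique[of "x + y"])
      have "z x + z y + E (z x + z y) = (z x + E (z x)) + (z y + E (z y))"
        using bop_add[OF Eb z(1)[OF x] z(1)[OF y]] by (simp add: ac_simps)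
      then show "z x + z y + E (z x + z y) = x + y" unfolding fix_z[OF x] fix_z[OF y] .
    qed (use lp_add(1) z(1) x y fix_z in blast)+
  next
    fix c and x :: "('n, 'x) seq" assume x: "x \<in> lp p"
    show "z (cscale c x) = cscale c (z x)"
    proof (rule fix_unique[of "cscale c x"])
      have "cscale c (z x) + E (cscale c (z x)) = cscale c (z x + E (z x))"
        using bop_cscale[OF Eb z(1)[OF x], of c] by (simp add: fun_eq_iff scaleC_add_right)
      then show "cscale c (z x) + E (cscale c (z x)) = cscale c x" unfolding fix_z[OF x] .
    qed (use lp_cscale(1) z(1) x fix_z in blast)+
  qed (use z z_norm in auto)
  have z_approx: "lp_norm p (z x - s n x) \<le> (1 / 2) ^ n * (2 * lp_norm p x)" if x: "x \<in> lp p" for x n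
  proof (rule LIMSEQ_le_const2)
    have i: "z x - s n x \<in> lp p" using lp_diff(1)[OF z(1)[OF x] bop_in[OF sb]] .
    show "(\<lambda>d. lp_norm p (z x - s n x) - lp_norm p (s (d + n) x - z x)) \<longlonglongrightarrow> lp_norm p (z x - s n x)"
      using tendsto_diff[OF tendsto_const LIMSEQ_ignore_initial_segment[OF z(2)[OF x], of n]] by simp
    have "lp_norm p (z x - s n x) - lp_norm p (s (d + n) x - z x) \<le> (1 / 2) ^ n * (2 * lp_norm p x)" for d
    proof -
      have j: "s (d + n) x - z x \<in> lp p" "s (d + n) x - s n x \<in> lp p"
        using lp_diff(1)[OF bop_in[OF sb] z(1)[OF x]] lp_diff(1)[OF bop_in[OF sb] bop_in[OF sb]] by auto
      have eq: "z x - s n x = (s (d + n) x - s n x) - (s (d + n) x - z x)" by simp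
      have "lp_norm p (z x - s n x) \<le> lp_norm p (s (d + n) x - s n x) + lp_norm p (s (d + n) x - z x)"
        unfolding eq by (rule lp_diff(2)[OF j(2,1)])
      then show ?thesis using s_diff[OF x, of n d] by (simp add: add.commute)
    qed
    then show "\<exists>N. \<forall>d\<ge>N. lp_norm p (z x - s n x) - lp_norm p (s (d + n) x - z x) \<le> (1 / 2) ^ n * (2 * lp_norm p x)" by blast
  qed
  have "S \<in> L_ops p"
  proof (rule L_limit[OF Sb])
    fix \<epsilon> :: real assume e: "\<epsilon> > 0"
    obtain n where n: "(1 / 2) ^ n * 2 \<le> \<epsilon>" using small[OF e, of 2] by blast
    have "lp_norm p (S x - s n x) \<le> \<epsilon> * lp_norm p x" if x: "x \<in> lp p" for x
    proof -
      have "lp_norm p (z x - s n x) \<le> ((1 / 2) ^ n * 2) * lp_norm p x" using z_approx[OF x, of n] by (simp add: mult.assoc)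
      also have "\<dots> \<le> \<epsilon> * lp_norm p x" using n lp_norm_nonneg[OF x] by (rule mult_right_mono)
      finally show ?thesis using x by (simp add: S_def on_lp_apply)
    qed
    then show "\<exists>T\<in>L_ops p. \<forall>x\<in>lp p. lp_norm p (S x - T x) \<le> \<epsilon> * lp_norm p x" using sL by blast
  qed
  moreover have "S x + E (S x) = x" if "x \<in> lp p" for x
    using fix_z[OF that] that by (simp add: S_def on_lp_apply)
  ultimately show ?thesis using that by blast
qed

end

text \<open>
  Where \<open>A\<close> is bounded below, smallness of \<open>A T y\<close> implies smallness of \<open>T y\<close>; the remaining part
  \<open>P\<^sub>m T y\<close> is small for \<open>y\<close> far out because \<open>P\<^sub>m T\<close> is in \<open>K\<close>.
\<close>

lemma (in far_bounded) K_if_comp_K: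
  assumes T: "T \<in> L_ops p" and AT: "A \<circ> T \<in> K_ops p"
  shows "T \<in> K_ops p"
proof (rule K_limit)
  show Tb: "T \<in> bounded_ops p" by (rule L_bop[OF T])
  fix \<epsilon> :: real assume e: "\<epsilon> > 0"
  define a where "a = op_norm p A + \<delta>"
  have a: "a > 0" using op_norm_nonneg[OF A] \<delta> by (simp add: a_def)
  have PT: "P_op p m \<circ> T \<in> K_ops p" by (rule K_L[OF T P_K])
  have e1: "\<delta> * \<epsilon> / 2 > 0" "\<delta> * \<epsilon> / (2 * a) > 0" using e \<delta> a by auto
  have b1: "A \<circ> T \<in> bounded_ops p" "right_tail_null (A \<circ> T)" and b2: "P_op p m \<circ> T \<in> bounded_ops p" "right_tail_null (P_op p m \<circ> T)"
    using AT PT unfolding K_iff by auto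
  obtain n1 where n1: "\<And>n x. n \<ge> n1 \<Longrightarrow> x \<in> lp p \<Longrightarrow>
      lp_norm p ((A \<circ> T) (cutoff (- cube 0 (int n)) x)) \<le> \<delta> * \<epsilon> / 2 * lp_norm p x"
    using right_tail_null_eventually[OF b1 e1(1)] by metis
  obtain n2 where n2: "\<And>n x. n \<ge> n2 \<Longrightarrow> x \<in> lp p \<Longrightarrow>
      lp_norm p ((P_op p m \<circ> T) (cutoff (- cube 0 (int n)) x)) \<le> \<delta> * \<epsilon> / (2 * a) * lp_norm p x"
    using right_tail_null_eventually[OF b2 e1(2)] by metis
  define n where "n = max n1 n2"
  have "lp_norm p (T x - (T \<circ> P_op p n) x) \<le> \<epsilon> * lp_norm p x" if x: "x \<in> lp p" for x
  proof -
    let ?y = "cutoff (- cube 0 (int n)) x"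
    have y: "?y \<in> lp p" using lp_cutoff(1)[OF x] .
    have "x - cutoff (cube 0 (int n)) x = ?y" by (auto simp: fun_eq_iff cutoff_apply)
    then have eq: "T x - (T \<circ> P_op p n) x = T ?y"
      using bop_diff[OF Tb x lp_cutoff(1)[OF x, of "cube 0 (int n)"]] by (simp add: P_apply x)
    have Ty: "T ?y \<in> lp p" using bop_in[OF Tb] .
    let ?u = "cutoff (cube 0 (int m)) (T ?y)" and ?v = "cutoff (- cube 0 (int m)) (T ?y)"
    have uv: "?u \<in> lp p" "?v \<in> lp p" "T ?y = ?u + ?v" "?v = T ?y - ?u"
      using lp_cutoff(1)[OF Ty] cutoff_split by (auto simp: fun_eq_iff cutoff_apply)
    have u: "lp_norm p ?u \<le> \<delta> * \<epsilon> / (2 * a) * lp_norm p x" 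
    proof -
      have "(P_op p m \<circ> T) ?y = ?u" using P_apply[OF Ty] by simp
      then show ?thesis using n2[of n x] x unfolding n_def by (metis max.cobounded2)
    qed
    have 1: "\<delta> * lp_norm p ?v \<le> lp_norm p (A ?v)" by (rule low[OF uv(2) supported_cutoff])
    have Av: "A ?v = A (T ?y) - A ?u" using bop_diff[OF A Ty uv(1)] uv(4) by simp
    have 2: "lp_norm p (A ?v) \<le> lp_norm p (A (T ?y)) + lp_norm p (A ?u)"
      unfolding Av by (rule lp_diff(2)[OF bop_in[OF A] bop_in[OF A]])
    have 3: "lp_norm p (A (T ?y)) \<le> \<delta> * \<epsilon> / 2 * lp_norm p x" using n1[of n x] x unfolding n_def o_apply by (metis max.cobounded1)
    have 4: "lp_norm p (A ?u) \<le> op_norm p A * lp_norm p ?u" by (rule op_bound[OF A uv(1)])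
    have 5: "\<delta> * lp_norm p (T ?y) \<le> \<delta> * lp_norm p ?u + \<delta> * lp_norm p ?v"
      using lp_add(2)[OF uv(1,2)] uv(3) \<delta> by (simp add: distrib_left[symmetric])
    have "\<delta> * lp_norm p (T ?y) \<le> \<delta> * \<epsilon> / 2 * lp_norm p x + a * lp_norm p ?u"
      using 1 2 3 4 5 by (simp add: a_def distrib_right)
    moreover have "a * lp_norm p ?u \<le> a * (\<delta> * \<epsilon> / (2 * a) * lp_norm p x)"
      using u a by (intro mult_left_mono) auto
    moreover have "a * (\<delta> * \<epsilon> / (2 * a) * lp_norm p x) = \<delta> * \<epsilon> / 2 * lp_norm p x" using a by simp
    ultimately have "\<delta> * lp_norm p (T ?y) \<le> \<delta> * (\<epsilon> * lp_norm p x)" by simp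
    then show ?thesis unfolding eq using \<delta> by simp
  qed
  then show "\<exists>S\<in>K_ops p. \<forall>x\<in>lp p. lp_norm p (T x - S x) \<le> \<epsilon> * lp_norm p x" using L_K[OF T P_K] by blast
qed

text \<open>
  Summing the patched operators over all colours inverts \<open>A\<close> up to an error of norm \<open>1/2\<close>, except on
  the finitely many cubes near the origin; the latter contribute an element of \<open>K\<close>.
\<close>

lemma (in far_bounded) right_parametrix:
  assumes bd: "A \<in> band_dominated p" and rich: "rich p A"
  obtains B where "B \<in> L_ops p" "(A \<circ> B) - id_op p \<in> K_ops p"
proof -
  define J where "J = real (card (cube 0 1 :: (int ^ 'n) set))"
  have fin: "finite (cube 0 1 :: (int ^ 'n) set)" by simp
  have "card (cube 0 1 :: (int ^ 'n) set) > 0" using cube_center[of 1 "0 :: int ^ 'n"] fin card_gt_0_iff by fastforce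
  then have J: "J \<ge> 1" unfolding J_def by linarith
  \<comment> \<open>Each colour contributes the error \<open>\<epsilon> + 2 \<epsilon>' / \<delta> = 1 / (2 J)\<close>. The constants depend only on the number of colours, so the radius \<open>R\<close> may be chosen after them.\<close>
  define \<epsilon> where "\<epsilon> = 1 / (4 * J)"
  define \<epsilon>' where "\<epsilon>' = \<delta> / (8 * J)"
  have \<epsilon>: "\<epsilon> > 0" "\<epsilon>' > 0" and sum: "J * (\<epsilon> + 2 * \<epsilon>' / \<delta>) = 1 / 2"
    using J \<delta> by (auto simp: \<epsilon>_def \<epsilon>'_def field_simps)
  obtain A' b where A': "A' \<in> bounded_ops p" "b \<ge> 0" "propagates b A'"
    "\<And>x. x \<in> lp p \<Longrightarrow> lp_norm p (A x - A' x) \<le> \<epsilon>' * lp_norm p x"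
    using band_dominated_approx[OF bd \<epsilon>(2)] by metis
  have e2: "\<epsilon> * \<delta> / 2 > 0" using \<epsilon> \<delta> by simp
  obtain R where R: "R > 0" "R \<ge> b" and comm: "\<And>k x. x \<in> lp p \<Longrightarrow>
      lp_norm p (A (weight (bump R k) x) - weight (bump R k) (A x)) \<le> \<epsilon> * \<delta> / 2 * lp_norm p x"
    using commutator_scale[OF e2, of b] by blast
  obtain M :: nat where "\<forall>k. k \<notin> cube 0 (int M) \<longrightarrow> (\<exists>T. local_right_inverse R \<epsilon> k T)"
    using local_inverses[OF rich R(1) \<epsilon>(1) comm] by blast
  then obtain T where T: "\<And>k. k \<notin> cube 0 (int M) \<Longrightarrow> local_right_inverse R \<epsilon> k (T k)" by metis
  define \<kappa> :: "int ^ 'n \<Rightarrow> int ^ 'n \<Rightarrow> int ^ 'n" where "\<kappa> = tile_centre R"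
  define U :: "int ^ 'n \<Rightarrow> (int ^ 'n) set" where "U c = {i. i \<in> cube (\<kappa> c i) R \<and> \<kappa> c i \<notin> cube 0 (int M)}" for c
  have "\<exists>B\<in>L_ops p. \<forall>y\<in>lp p. lp_norm p (A (B y) - cutoff (U c) y) \<le> (\<epsilon> + 2 * \<epsilon>' / \<delta>) * lp_norm p y" for c
    unfolding U_def
    by (rule patch_one_colour[OF R(1) \<epsilon> _ _ T A'(1) propagates_mono[OF A'(3) R(2)] A'(4)])
      (use tile_centre_mem[OF R(1)] tile_centre_unique[OF R(1)] in \<open>auto simp: \<kappa>_def\<close>)
  then obtain B where B: "\<And>c. B c \<in> L_ops p"
    "\<And>c y. y \<in> lp p \<Longrightarrow> lp_norm p (A (B c y) - cutoff (U c) y) \<le> (\<epsilon> + 2 * \<epsilon>' / \<delta>) * lp_norm p y" by metis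
  define C where "C = (cube 0 1 :: (int ^ 'n) set)"
  define B0 where "B0 = (\<Sum>c\<in>C. B c)"
  define W where "W = (\<Union>c\<in>C. U c)"
  have B0: "B0 \<in> L_ops p" unfolding B0_def by (rule L_sum) (rule B(1))
  have B0_apply: "B0 y = (\<Sum>c\<in>C. B c y)" for y unfolding B0_def by (rule sum_seq_apply)
  have colour: "\<exists>!c. c \<in> C \<and> i \<in> cube (\<kappa> c i) R" for i
    unfolding C_def \<kappa>_def by (rule tile_colour[OF R(1)])
  have cutW: "cutoff W y = (\<Sum>c\<in>C. cutoff (U c) y)" for y :: "('n, 'x) seq"
  proof
    fix i
    have "(\<Sum>c\<in>C. cutoff (U c) y) i = (\<Sum>c\<in>C. cutoff (U c) y i)" by (rule sum_seq_apply)
    also have "\<dots> = cutoff W y i"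
    proof (cases "i \<in> W")
      case True
      then obtain c where c: "c \<in> C" "i \<in> U c" unfolding W_def by blast
      have "cutoff (U d) y i = (if d = c then y i else 0)" if "d \<in> C" for d
        using colour[of i] c that unfolding U_def by (auto simp: cutoff_apply)
      then have "(\<Sum>d\<in>C. cutoff (U d) y i) = (\<Sum>d\<in>C. if d = c then y i else 0)" by (intro sum.cong) auto
      also have "\<dots> = y i" using c(1) fin unfolding C_def[symmetric] by simp
      finally show ?thesis using True by (simp add: cutoff_apply)
    next
      case False
      then have "(\<Sum>d\<in>C. cutoff (U d) y i) = 0" unfolding W_def by (intro sum.neutral) (auto simp: cutoff_apply)
      then show ?thesis using False by (simp add: cutoff_apply)
    qed
    finally show "cutoff W y i = (\<Sum>c\<in>C. cutoff (U c) y) i" by simp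
  qed
  have "finite (- W)"
  proof (rule finite_subset)
    show "- W \<subseteq> cube 0 (R + int M)"
    proof
      fix i assume i: "i \<in> - W"
      obtain c where c: "c \<in> C" "i \<in> cube (\<kappa> c i) R" using colour[of i] by blast
      then have "\<kappa> c i \<in> cube 0 (int M)" using i unfolding W_def U_def by blast
      with c(2) show "i \<in> cube 0 (R + int M)" by (rule cube_trans)
    qed
  qed simp
  then have cK: "on_lp p (cutoff (- W)) \<in> (K_ops p :: ('n, 'x) seq_op set)" by (rule cutoff_finite_K)
  \<comment> \<open>\<open>W\<close> is the union of all inner cubes that carry a local inverse, and its complement is finite.\<close>
  define E where "E = (A \<circ> B0) - (id_op p - on_lp p (cutoff (- W)))"
  have AL: "A \<in> L_ops p" by (rule band_dominated_L[OF bd])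
  have EL: "E \<in> L_ops p" unfolding E_def
    by (metis AL B0 L_add L_comp L_id L_uminus K_subset_L[OF cK] diff_conv_add_uminus)
  have E_apply: "E y = A (B0 y) - cutoff W y" if "y \<in> lp p" for y
  proof -
    have "y - cutoff (- W) y = cutoff W y" by (auto simp: fun_eq_iff cutoff_apply)
    then show ?thesis using that by (simp add: E_def id_apply on_lp_apply)
  qed
  have E_le: "lp_norm p (E y) \<le> 1 / 2 * lp_norm p y" if y: "y \<in> lp p" for y
  proof -
    have Bb: "B c y \<in> lp p" for c using bop_in[OF L_bop[OF B(1)]] .
    have ABsum: "A (\<Sum>c\<in>F. B c y) = (\<Sum>c\<in>F. A (B c y))" if "finite F" for F
      using that
    proof (induction F rule: finite_induct)
      case empty
      show ?case unfolding sum.empty by (rule bop_zero[OF A])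
    next
      case (insert c F)
      show ?case unfolding sum.insert[OF insert(1,2)] bop_add[OF A Bb lp_sum(1)[OF insert(1) Bb]] insert.IH ..
    qed
    have "E y = (\<Sum>c\<in>C. A (B c y) - cutoff (U c) y)"
      unfolding E_apply[OF y] cutW B0_apply using ABsum[OF fin] by (simp add: C_def sum_subtractf)
    then have "lp_norm p (E y) \<le> (\<Sum>c\<in>C. lp_norm p (A (B c y) - cutoff (U c) y))"
      using lp_sum(2)[of C "\<lambda>c. A (B c y) - cutoff (U c) y"] fin lp_diff(1)[OF bop_in[OF A] lp_cutoff(1)[OF y]]
      unfolding C_def by simp
    also have "\<dots> \<le> (\<Sum>c\<in>C. (\<epsilon> + 2 * \<epsilon>' / \<delta>) * lp_norm p y)" by (intro sum_mono B(2) y)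
    also have "\<dots> = (J * (\<epsilon> + 2 * \<epsilon>' / \<delta>)) * lp_norm p y" by (simp add: J_def C_def)
    finally show ?thesis unfolding sum .
  qed
  obtain S where S: "S \<in> L_ops p" "\<And>x. x \<in> lp p \<Longrightarrow> S x + E (S x) = x" using neumann_inverse[OF EL E_le] by blast
  have "(A \<circ> (B0 \<circ> S)) - id_op p = - (on_lp p (cutoff (- W)) \<circ> S)"
  proof
    fix x
    show "((A \<circ> (B0 \<circ> S)) - id_op p) x = (- (on_lp p (cutoff (- W)) \<circ> S)) x"
    proof (cases "x \<in> lp p")
      case True
      have Sx: "S x \<in> lp p" using bop_in[OF L_bop[OF S(1)]] .
      have "S x - cutoff W (S x) = cutoff (- W) (S x)" by (auto simp: fun_eq_iff cutoff_apply)
      then have "A (B0 (S x)) - x = - cutoff (- W) (S x)"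
      proof -
        have "x = S x + (A (B0 (S x)) - cutoff W (S x))" using S(2)[OF True] unfolding E_apply[OF Sx] by (rule sym)
        then have "A (B0 (S x)) - x = - (S x - cutoff W (S x))" by (simp add: algebra_simps)
        then show ?thesis unfolding \<open>S x - cutoff W (S x) = cutoff (- W) (S x)\<close> .
      qed
      then show ?thesis using True Sx by (simp add: id_apply on_lp_apply)
    next
      case False
      have "S x = 0" using bop_off[OF L_bop[OF S(1)] False] .
      then show ?thesis using False bop_zero[OF A] bop_zero[OF L_bop[OF B0]] bop_zero[OF cutoff_op_bop]
          bop_off[OF id_bop False] by simp
    qed
  qed
  moreover have "- (on_lp p (cutoff (- W)) \<circ> S) \<in> K_ops p" by (rule K_uminus[OF K_L[OF S(1) cK]])
  ultimately show ?thesis using that[of "B0 \<circ> S"] L_comp[OF B0 S(1)] by simp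
qed

text \<open>
  For a right inverse \<open>B\<close> modulo \<open>K\<close>, the operator \<open>T = B A - I\<close> satisfies \<open>A T = (A B - I) A\<close>, which is in
  \<open>K\<close>.
\<close>

theorem (in far_bounded) parametrix:
  assumes bd: "A \<in> band_dominated p" and rich: "rich p A"
  obtains B where "B \<in> L_ops p" "(A \<circ> B) - id_op p \<in> K_ops p" "(B \<circ> A) - id_op p \<in> K_ops p"
proof -
  obtain B where B: "B \<in> L_ops p" "(A \<circ> B) - id_op p \<in> K_ops p" using right_parametrix[OF bd rich] by blast
  have AL: "A \<in> L_ops p" by (rule band_dominated_L[OF bd])
  have TL: "(B \<circ> A) - id_op p \<in> L_ops p"
    by (metis AL B(1) L_add L_comp L_id L_uminus diff_conv_add_uminus)
  have "A \<circ> ((B \<circ> A) - id_op p) = ((A \<circ> B) - id_op p) \<circ> A"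
    unfolding comp_diff_right[OF A bop_comp(1)[OF L_bop[OF B(1)] A] id_bop] comp_diff_left comp_id[OF A] o_assoc ..
  then have "(B \<circ> A) - id_op p \<in> K_ops p" using K_if_comp_K[OF TL] K_L[OF AL B(2)] by simp
  then show ?thesis using that B by blast
qed

section \<open>The quotient algebra and lower norms at infinity\<close>

context lp_exponent
begin

lemma L_ring_simps [simp]:
  "carrier (L_ring p) = L_ops p" "mult (L_ring p) A B = A \<circ> B" "one (L_ring p) = id_op p"
  "ring.zero (L_ring p) = 0" "add (L_ring p) A B = A + B"
  by (simp_all add: L_ring_def zero_fun_def)

lemma L_zero: "0 \<in> L_ops p"
  by (rule K_subset_L) (use K_diff[OF P_K P_K, of 0 0] in simp)

lemma L_ring_ring: "ring (L_ring p :: ('n::finite, 'x::complex_banach) seq_op ring)"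
proof (rule ringI)
  show "abelian_group (L_ring p :: ('n, 'x) seq_op ring)"
  proof (rule abelian_groupI)
    fix A :: "('n, 'x) seq_op" assume "A \<in> carrier (L_ring p)"
    then show "\<exists>B\<in>carrier (L_ring p). B \<oplus>\<^bsub>L_ring p\<^esub> A = \<zero>\<^bsub>L_ring p\<^esub>"
      using L_uminus[of A] by (intro bexI[of _ "- A"]) auto
  qed (auto simp: L_add L_zero add.assoc add.commute)
  show "Group.monoid (L_ring p :: ('n, 'x) seq_op ring)"
    by (rule monoidI) (auto simp: L_comp L_id o_assoc comp_id[OF L_bop])
qed (auto simp: comp_add_left comp_add_right L_bop)

lemma K_ideal: "ideal (K_ops p) (L_ring p :: ('n::finite, 'x::complex_banach) seq_op ring)"
proof (rule idealI[OF L_ring_ring])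
  interpret ring "L_ring p :: ('n, 'x) seq_op ring" by (rule L_ring_ring)
  show "subgroup (K_ops p) (add_monoid (L_ring p :: ('n, 'x) seq_op ring))"
  proof (rule group.subgroupI[OF a_group])
    show "K_ops p \<subseteq> carrier (add_monoid (L_ring p :: ('n, 'x) seq_op ring))" using K_subset_L by auto
    show "(K_ops p :: ('n, 'x) seq_op set) \<noteq> {}" using P_K by blast
    fix K :: "('n, 'x) seq_op" assume K: "K \<in> K_ops p"
    have "inv\<^bsub>add_monoid (L_ring p)\<^esub> K = - K"
      by (rule group.inv_equality[OF a_group]) (use K_subset_L[OF K] K_subset_L[OF K_uminus[OF K]] in auto)
    then show "inv\<^bsub>add_monoid (L_ring p)\<^esub> K \<in> K_ops p" using K_uminus[OF K] by simp
  qed (auto simp: K_add)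
qed (auto simp: L_K K_L)

lemma mem_LK_coset: "B \<in> LK_coset p A \<longleftrightarrow> B - A \<in> K_ops p"
proof
  assume "B \<in> LK_coset p A"
  then obtain K where "K \<in> K_ops p" "B = K + A" unfolding LK_coset_def a_r_coset_def' by auto
  then show "B - A \<in> K_ops p" by simp
next
  assume "B - A \<in> K_ops p"
  then show "B \<in> LK_coset p A" unfolding LK_coset_def a_r_coset_def' by (auto intro!: bexI[of _ "B - A"])
qed

lemma LK_coset_eq_iff: "LK_coset p A = LK_coset p B \<longleftrightarrow> A - B \<in> K_ops p"
proof
  assume "LK_coset p A = LK_coset p B"
  moreover have "A \<in> LK_coset p A" unfolding mem_LK_coset using K_diff[OF P_K P_K, of 0 0] by simp
  ultimately show "A - B \<in> K_ops p" using mem_LK_coset by blast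
next
  assume AB: "A - B \<in> K_ops p"
  have "C - A \<in> K_ops p \<longleftrightarrow> C - B \<in> K_ops p" for C
  proof
    assume "C - A \<in> K_ops p"
    moreover have "C - B = (C - A) + (A - B)" by simp
    ultimately show "C - B \<in> K_ops p" using K_add AB by metis
  next
    assume "C - B \<in> K_ops p"
    moreover have "C - A = (C - B) - (A - B)" by simp
    ultimately show "C - A \<in> K_ops p" using K_diff AB by metis
  qed
  then show "LK_coset p A = LK_coset p B" using mem_LK_coset by blast
qed

lemma LK_coset_inverse:
  assumes A: "A \<in> L_ops p"
  shows "LK_coset p A \<in> Units (LK_quot p) \<longleftrightarrow>
      (\<exists>B\<in>L_ops p. (A \<circ> B) - id_op p \<in> K_ops p \<and> (B \<circ> A) - id_op p \<in> K_ops p)" (is "?U \<longleftrightarrow> ?R")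
    and "B \<in> L_ops p \<Longrightarrow> (A \<circ> B) - id_op p \<in> K_ops p \<Longrightarrow> (B \<circ> A) - id_op p \<in> K_ops p \<Longrightarrow>
      m_inv (LK_quot p) (LK_coset p A) = LK_coset p B"
proof -
  interpret I: ideal "K_ops p" "L_ring p :: ('a, 'b) seq_op ring" by (rule K_ideal)
  interpret Q: ring "LK_quot p :: ('a, 'b) seq_op set ring" unfolding LK_quot_def by (rule I.quotient_is_ring)
  have carr: "carrier (LK_quot p :: ('a, 'b) seq_op set ring) = LK_coset p ` L_ops p"
    unfolding LK_quot_def FactRing_def LK_coset_def by (auto simp: A_RCOSETS_def')
  have mul: "LK_coset p S \<otimes>\<^bsub>LK_quot p\<^esub> LK_coset p T = LK_coset p (S \<circ> T)" if "S \<in> L_ops p" "T \<in> L_ops p" for S T :: "('a, 'b) seq_op"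
    using I.rcoset_mult_add[of S T] that unfolding LK_quot_def FactRing_def LK_coset_def by simp
  have one: "\<one>\<^bsub>LK_quot p\<^esub> = LK_coset p (id_op p :: ('a, 'b) seq_op)"
    unfolding LK_quot_def FactRing_def LK_coset_def by simp
  show inv: "m_inv (LK_quot p) (LK_coset p A) = LK_coset p B"
    if B: "B \<in> L_ops p" "(A \<circ> B) - id_op p \<in> K_ops p" "(B \<circ> A) - id_op p \<in> K_ops p" for B
    by (rule Q.inv_char) (simp_all add: A B carr mul one LK_coset_eq_iff imageI)
  show "?U \<longleftrightarrow> ?R"
  proof
    assume ?U
    then obtain b where b: "b \<in> carrier (LK_quot p)" "b \<otimes>\<^bsub>LK_quot p\<^esub> LK_coset p A = \<one>\<^bsub>LK_quot p\<^esub>"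
      "LK_coset p A \<otimes>\<^bsub>LK_quot p\<^esub> b = \<one>\<^bsub>LK_quot p\<^esub>" unfolding Units_def by blast
    then obtain B where B: "B \<in> L_ops p" "b = LK_coset p B" using carr by auto
    show ?R using b(2,3) mul[OF B(1) A] mul[OF A B(1)] B one LK_coset_eq_iff by metis
  next
    assume ?R
    then obtain B where B: "B \<in> L_ops p" "(A \<circ> B) - id_op p \<in> K_ops p" "(B \<circ> A) - id_op p \<in> K_ops p" by blast
    then have "LK_coset p B \<in> carrier (LK_quot p)" "LK_coset p A \<in> carrier (LK_quot p)"
      "LK_coset p B \<otimes>\<^bsub>LK_quot p\<^esub> LK_coset p A = \<one>\<^bsub>LK_quot p\<^esub>"
      "LK_coset p A \<otimes>\<^bsub>LK_quot p\<^esub> LK_coset p B = \<one>\<^bsub>LK_quot p\<^esub>"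
      using A by (simp_all add: carr mul one LK_coset_eq_iff imageI)
    then show ?U unfolding Units_def by blast
  qed
qed

end

text \<open>
  The lower norms over a decreasing sequence of domains increase to their limit. The unit spheres have
  to be nonempty, since otherwise the infima are arbitrary. The last part is the form in which a left
  inverse modulo small tails bounds the limit from below.
\<close>

lemma lower_norm_limit:
  fixes E :: "nat \<Rightarrow> 'e set" and nE :: "'e \<Rightarrow> real" and nF :: "'f \<Rightarrow> real" and T :: "'e \<Rightarrow> 'f"
  assumes dec: "\<And>m. E (Suc m) \<subseteq> E m" and ne: "\<And>m. \<exists>x\<in>E m. nE x = 1"
    and bd: "\<forall>m. \<forall>x\<in>E m. nE x = 1 \<longrightarrow> 0 \<le> nF (T x) \<and> nF (T x) \<le> C"
  defines "\<nu> \<equiv> \<lambda>m. lower_norm (E m) nE nF T"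
  shows "0 \<le> lim \<nu>" "d < lim \<nu> \<Longrightarrow> \<exists>m. \<forall>n\<ge>m. \<forall>x\<in>E n. nE x = 1 \<longrightarrow> d \<le> nF (T x)"
    "\<And>b. 0 \<le> b \<Longrightarrow> (\<And>\<epsilon>. \<epsilon> > 0 \<Longrightarrow> \<exists>m. \<forall>x\<in>E m. nE x = 1 \<longrightarrow> 1 - \<epsilon> \<le> b * nF (T x)) \<Longrightarrow> 1 \<le> lim \<nu> * b"
proof -
  have bdb: "bdd_below ((\<lambda>x. nF (T x)) ` {x \<in> E m. nE x = 1})" for m
    using bd by (intro bdd_belowI2[where m = 0]) auto
  have nonempty: "{x \<in> E m. nE x = 1} \<noteq> {}" for m using ne by blast
  have le: "\<nu> m \<le> nF (T x)" if "x \<in> E m" "nE x = 1" for m x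
    unfolding \<nu>_def lower_norm_def using that by (intro cINF_lower[OF bdb]) auto
  have ge: "c \<le> \<nu> m" if "\<And>x. x \<in> E m \<Longrightarrow> nE x = 1 \<Longrightarrow> c \<le> nF (T x)" for c m
    unfolding \<nu>_def lower_norm_def using that by (intro cINF_greatest[OF nonempty]) auto
  have inc: "incseq \<nu>" using dec le by (intro incseq_SucI ge) blast
  have up: "\<nu> m \<le> C" for m using ne[of m] le bd by (meson order_trans)
  have "bdd_above (range \<nu>)" using up by (auto simp: bdd_above_def)
  then have lim: "\<nu> \<longlonglongrightarrow> lim \<nu>" using LIMSEQ_incseq_SUP[OF _ inc] by (simp add: limI)
  have \<nu>le: "\<nu> m \<le> lim \<nu>" for m using inc lim by (rule incseq_le)
  show "0 \<le> lim \<nu>" using order_trans[OF ge \<nu>le, of 0 0] bd by blast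
  show "\<exists>m. \<forall>n\<ge>m. \<forall>x\<in>E n. nE x = 1 \<longrightarrow> d \<le> nF (T x)" if d: "d < lim \<nu>"
  proof -
    have "\<forall>\<^sub>F m in sequentially. d < \<nu> m" by (rule order_tendstoD(1)[OF lim d])
    then show ?thesis unfolding eventually_sequentially using le by (meson less_imp_le order_trans)
  qed
  show "1 \<le> lim \<nu> * b" if b: "0 \<le> b"
    and small: "\<And>\<epsilon>. \<epsilon> > 0 \<Longrightarrow> \<exists>m. \<forall>x\<in>E m. nE x = 1 \<longrightarrow> 1 - \<epsilon> \<le> b * nF (T x)" for b
  proof -
    have "b \<noteq> 0"
    proof
      assume "b = 0"
      then show False using small[of "1 / 2"] ne by fastforce
    qed
    then have b: "b > 0" using b by simp
    have "1 \<le> lim \<nu> * b + \<epsilon>" if e: "\<epsilon> > 0" for \<epsilon>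
    proof -
      obtain m where m: "\<forall>x\<in>E m. nE x = 1 \<longrightarrow> 1 - \<epsilon> \<le> b * nF (T x)" using small[OF e] by blast
      have "(1 - \<epsilon>) / b \<le> \<nu> m" using m b by (intro ge) (simp add: divide_le_eq mult.commute)
      then have "(1 - \<epsilon>) / b \<le> lim \<nu>" using \<nu>le order_trans by blast
      then show ?thesis using b by (simp add: divide_le_eq)
    qed
    then show ?thesis by (rule field_le_epsilon)
  qed
qed

context lp_exponent
begin

lemma Q_image: "Q_op p m ` lp p = {x \<in> lp p. supported (- cube 0 (int m)) x}"
proof (intro equalityI subsetI)
  fix x :: "('a, 'b) seq" assume "x \<in> Q_op p m ` lp p"
  then show "x \<in> {x \<in> lp p. supported (- cube 0 (int m)) x}"
    by (auto simp: Q_apply lp_cutoff supported_cutoff)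
next
  fix x :: "('a, 'b) seq" assume "x \<in> {x \<in> lp p. supported (- cube 0 (int m)) x}"
  then show "x \<in> Q_op p m ` lp p" using Q_apply[of x m] cutoff_supported[of "- cube 0 (int m)" x] by (metis (mono_tags, lifting) image_eqI mem_Collect_eq)
qed

lemma Q_supported: "x \<in> lp p \<Longrightarrow> supported (- cube 0 (int m)) x \<Longrightarrow> Q_op p m x = x"
  by (simp add: Q_apply cutoff_supported)

lemma normalise:
  assumes "x \<in> lp p" "x \<noteq> 0"
  defines "c \<equiv> complex_of_real (inverse (lp_norm p x))"
  shows "lp_norm p x > 0" "lp_norm p (cscale c x) = 1" "cmod c = inverse (lp_norm p x)"
proof -
  show pos: "lp_norm p x > 0" using assms lp_norm_eq_0 lp_norm_nonneg by (metis less_eq_real_def)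
  show c: "cmod c = inverse (lp_norm p x)" using pos by (simp add: c_def norm_inverse)
  show "lp_norm p (cscale c x) = 1" using lp_cscale(2)[OF assms(1), of c] c pos by simp
qed

lemma nonzero_far_sequence:
  assumes "\<exists>v::'x. v \<noteq> 0"
  obtains x :: "('n::finite, 'x::complex_banach) seq" where "x \<in> lp p" "supported (- cube 0 (int m)) x" "x \<noteq> 0"
proof -
  obtain v :: 'x where v: "v \<noteq> 0" using assms by blast
  define i :: "int ^ 'n" where "i = (\<chi> j. int m + 1)"
  define x :: "('n, 'x) seq" where "x = (\<lambda>j. if j = i then v else 0)"
  have "x \<in> lp p" by (rule lp_finite_support[of "{i}"]) (auto simp: x_def)
  moreover have "i \<notin> cube 0 (int m)" by (simp add: mem_cube i_def)
  then have "supported (- cube 0 (int m)) x" by (auto simp: supported_def x_def)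
  moreover have "x i \<noteq> 0" using v by (simp add: x_def)
  then have "x \<noteq> 0" by auto
  ultimately show ?thesis using that by blast
qed

lemma dual_sc_norm:
  assumes f: "f \<in> dual p"
  shows "(\<lambda>x. c * f x) \<in> dual p" "dual_norm p (\<lambda>x. c * f x) = cmod c * dual_norm p f"
proof -
  have *: "(\<lambda>x. c * f x) \<in> dual p \<and> dual_norm p (\<lambda>x. c * f x) \<le> cmod c * dual_norm p f"
    if f: "f \<in> dual p" for c and f :: "('a, 'b) seq \<Rightarrow> complex"
  proof -
    have le: "cmod (c * f x) \<le> cmod c * dual_norm p f * lp_norm p x" if "x \<in> lp p" for x
      using mult_left_mono[OF dual_bound[OF f that], of "cmod c"] by (simp add: norm_mult mult.assoc)
    have "(\<lambda>x. c * f x) \<in> dual p"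
      by (rule dualI[OF _ _ _ le]) (use dual_off[OF f] dual_add[OF f] dual_cscale[OF f] in \<open>auto simp: algebra_simps\<close>)
    moreover have "dual_norm p (\<lambda>x. c * f x) \<le> cmod c * dual_norm p f"
      by (rule dual_norm_le[OF le]) (use dual_norm_nonneg[OF f] in auto)
    ultimately show ?thesis by blast
  qed
  show d: "(\<lambda>x. c * f x) \<in> dual p" using *[OF f] by blast
  show "dual_norm p (\<lambda>x. c * f x) = cmod c * dual_norm p f"
  proof (cases "c = 0")
    case True
    then show ?thesis using *[OF f, of c] dual_norm_nonneg[OF d] by simp
  next
    case False
    have "(\<lambda>x. inverse c * (c * f x)) = f" using False by (simp add: fun_eq_iff)
    then have "dual_norm p f \<le> cmod (inverse c) * dual_norm p (\<lambda>x. c * f x)" using *[OF d, of "inverse c"] by simp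
    then have "cmod c * dual_norm p f \<le> dual_norm p (\<lambda>x. c * f x)" 
      unfolding norm_inverse using False by (simp add: field_simps)
    then show ?thesis using *[OF f, of c] by simp
  qed
qed

lemma Q_op_comp: "n \<ge> m \<Longrightarrow> Q_op p n \<circ> Q_op p m = (Q_op p n :: ('n::finite, 'x::complex_banach) seq_op)"
proof
  fix x :: "('n, 'x) seq" assume nm: "n \<ge> m"
  show "(Q_op p n \<circ> Q_op p m) x = Q_op p n x"
  proof (cases "x \<in> lp p")
    case True
    have "cube 0 (int m) \<subseteq> (cube 0 (int n) :: (int ^ 'n) set)" using nm by (intro cube_mono) simp
    then have "- cube 0 (int n) \<inter> - cube 0 (int m) = - (cube 0 (int n) :: (int ^ 'n) set)" by blast
    then show ?thesis using True by (simp add: Q_apply lp_cutoff cutoff_cutoff)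
  next
    case False
    then show ?thesis using bop_off[OF Q_bop False] bop_zero[OF Q_bop] by simp
  qed
qed

text \<open>
  The last part is the estimate \<open>1 = \<parallel>x\<parallel> \<le> \<parallel>B\<parallel> \<parallel>A x\<parallel> + \<parallel>(B A - I) x\<parallel>\<close> for unit vectors \<open>x\<close> far out.
\<close>

lemma mu_tilde_properties:
  fixes A :: "('n::finite, 'x::complex_banach) seq_op"
  assumes A: "A \<in> bounded_ops p" and ex: "\<exists>v::'x. v \<noteq> 0"
  shows "0 \<le> mu_tilde p A"
    "d < mu_tilde p A \<Longrightarrow> \<exists>m. \<forall>n\<ge>m. \<forall>x\<in>lp p. supported (- cube 0 (int n)) x \<longrightarrow> d * lp_norm p x \<le> lp_norm p (A x)"
    "B \<in> bounded_ops p \<Longrightarrow> (B \<circ> A) - id_op p \<in> K_ops p \<Longrightarrow> 1 \<le> mu_tilde p A * op_norm p B"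
proof -
  let ?E = "\<lambda>m. Q_op p m ` lp p :: ('n, 'x) seq set"
  have dec: "?E (Suc m) \<subseteq> ?E m" for m
  proof -
    have "- cube 0 (int (Suc m)) \<subseteq> (- cube 0 (int m) :: (int ^ 'n) set)" by (intro Compl_anti_mono cube_mono) simp
    then show ?thesis unfolding Q_image using supported_mono by blast
  qed
  have ne: "\<exists>x\<in>?E m. lp_norm p x = 1" for m
  proof -
    obtain x :: "('n, 'x) seq" where x: "x \<in> lp p" "supported (- cube 0 (int m)) x" "x \<noteq> 0"
      using nonzero_far_sequence[OF ex] by blast
    show ?thesis unfolding Q_image
      using normalise(2)[OF x(1,3)] lp_cscale(1)[OF x(1)] supported_cscale[OF x(2)] by blast
  qed
  have "0 \<le> lp_norm p (A x) \<and> lp_norm p (A x) \<le> op_norm p A" if "x \<in> ?E m" "lp_norm p x = 1" for m x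
  proof -
    have "x \<in> lp p" using that(1) unfolding Q_image by blast
    then show ?thesis using lp_norm_nonneg[OF bop_in[OF A]] op_bound[OF A, of x] that(2) by simp
  qed
  then have bd: "\<forall>m. \<forall>x\<in>?E m. lp_norm p x = 1 \<longrightarrow> 0 \<le> lp_norm p (A x) \<and> lp_norm p (A x) \<le> op_norm p A" by blast
  note L = lower_norm_limit[where E = ?E and nE = "lp_norm p" and nF = "lp_norm p" and T = A and C = "op_norm p A",
      OF dec ne bd, folded mu_tilde_def]
  show "0 \<le> mu_tilde p A" by (rule L(1))
  show "\<exists>m. \<forall>n\<ge>m. \<forall>x\<in>lp p. supported (- cube 0 (int n)) x \<longrightarrow> d * lp_norm p x \<le> lp_norm p (A x)"
    if d: "d < mu_tilde p A"
  proof -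
    obtain m where m: "\<And>n x. n \<ge> m \<Longrightarrow> x \<in> lp p \<Longrightarrow> supported (- cube 0 (int n)) x \<Longrightarrow> lp_norm p x = 1 \<Longrightarrow> d \<le> lp_norm p (A x)"
      using L(2)[OF d] unfolding Q_image by blast
    have "d * lp_norm p x \<le> lp_norm p (A x)" if n: "n \<ge> m" and x: "x \<in> lp p" "supported (- cube 0 (int n)) x" for n x
    proof (cases "x = 0")
      case True
      then show ?thesis using bop_zero[OF A] by simp
    next
      case False
      define c where "c = complex_of_real (inverse (lp_norm p x))"
      note N = normalise[OF x(1) False, folded c_def]
      have "d \<le> lp_norm p (A (cscale c x))" by (rule m[OF n lp_cscale(1)[OF x(1)] supported_cscale[OF x(2)] N(2)])
      also have "\<dots> = inverse (lp_norm p x) * lp_norm p (A x)"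
        using bop_cscale[OF A x(1), of c] lp_cscale(2)[OF bop_in[OF A, of x], of c] N(3) by simp
      finally show ?thesis using N(1) by (simp add: field_simps)
    qed
    then show ?thesis by blast
  qed
  show "1 \<le> mu_tilde p A * op_norm p B" if B: "B \<in> bounded_ops p" and K: "(B \<circ> A) - id_op p \<in> K_ops p"
  proof (rule L(3)[OF op_norm_nonneg[OF B]])
    fix \<epsilon> :: real assume e: "\<epsilon> > 0"
    let ?K = "(B \<circ> A) - id_op p"
    obtain m :: nat where m: "\<forall>x\<in>lp p. lp_norm p (?K (cutoff (- cube 0 (int m)) x)) \<le> \<epsilon> * lp_norm p x"
      using K e unfolding K_iff right_tail_null_def by blast
    have "1 - \<epsilon> \<le> op_norm p B * lp_norm p (A x)" if x: "x \<in> ?E m" "lp_norm p x = 1" for x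
    proof -
      have xl: "x \<in> lp p" and xs: "supported (- cube 0 (int m)) x" using x(1) unfolding Q_image by auto
      have Kx: "lp_norm p (?K x) \<le> \<epsilon>" using m xl x(2) cutoff_supported[OF xs] by force
      have eq: "x = B (A x) - ?K x" using xl by (simp add: id_apply)
      have "lp_norm p (B (A x) - ?K x) \<le> lp_norm p (B (A x)) + lp_norm p (?K x)"
        by (rule lp_diff(2)[OF bop_in[OF B] bop_in[OF K_bop[OF K]]])
      then have "1 \<le> lp_norm p (B (A x)) + lp_norm p (?K x)" unfolding eq[symmetric] x(2) .
      then show ?thesis using Kx op_bound[OF B bop_in[OF A], of x] by linarith
    qed
    then show "\<exists>m. \<forall>x\<in>?E m. lp_norm p x = 1 \<longrightarrow> 1 - \<epsilon> \<le> op_norm p B * lp_norm p (A x)" by blast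
  qed
qed

text \<open>
  The same for functionals \<open>g = f Q\<^sub>m\<close>: here \<open>g = g A B - g (A B - I)\<close>, and the last term is small because
  \<open>g\<close> only sees \<open>Q\<^sub>m (A B - I)\<close>. The Hahn--Banach theorem provides functionals of norm one of this form.
\<close>

lemma mu_tilde_dual_properties:
  fixes A :: "('n::finite, 'x::complex_banach) seq_op"
  assumes A: "A \<in> bounded_ops p" and ex: "\<exists>v::'x. v \<noteq> 0"
  shows "0 \<le> mu_tilde_dual p A"
    "d < mu_tilde_dual p A \<Longrightarrow> \<exists>m. \<forall>n\<ge>m. \<forall>f\<in>dual p. d * dual_norm p (f \<circ> Q_op p n) \<le> dual_norm p (f \<circ> Q_op p n \<circ> A)"
    "B \<in> bounded_ops p \<Longrightarrow> (A \<circ> B) - id_op p \<in> K_ops p \<Longrightarrow> 1 \<le> mu_tilde_dual p A * op_norm p B"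
proof -
  let ?E = "\<lambda>m. adjoint_op (Q_op p m) ` dual p :: (('n, 'x) seq \<Rightarrow> complex) set"
  have memE: "g \<in> ?E m \<longleftrightarrow> (\<exists>f\<in>dual p. g = f \<circ> Q_op p m)" for g m by (auto simp: adjoint_op_def)
  have fQ: "f \<circ> Q_op p m \<in> dual p" if "f \<in> dual p" for f :: "('n, 'x) seq \<Rightarrow> complex" and m
    by (rule dual_comp(1)[OF that Q_bop])
  have dec: "?E (Suc m) \<subseteq> ?E m" for m
  proof
    fix g assume "g \<in> ?E (Suc m)"
    then obtain f where f: "f \<in> dual p" "g = f \<circ> Q_op p (Suc m)" unfolding memE by blast
    have "g = (f \<circ> Q_op p (Suc m)) \<circ> Q_op p m" unfolding f(2) o_assoc[symmetric] by (simp add: Q_op_comp)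
    then show "g \<in> ?E m" unfolding memE using fQ[OF f(1)] by blast
  qed
  have scE: "(\<lambda>x. c * g x) \<in> ?E m" if "g \<in> ?E m" for c g m
  proof -
    obtain f where "f \<in> dual p" "g = f \<circ> Q_op p m" using \<open>g \<in> ?E m\<close> unfolding memE by blast
    then show ?thesis unfolding memE by (intro bexI[of _ "\<lambda>x. c * f x"] dual_sc_norm(1)) (auto simp: fun_eq_iff)
  qed
  have Ed: "g \<in> dual p" if "g \<in> ?E m" for g m using that fQ unfolding memE by blast
  have ne: "\<exists>g\<in>?E m. dual_norm p g = 1" for m
  proof -
    obtain x :: "('n, 'x) seq" where x: "x \<in> lp p" "supported (- cube 0 (int m)) x" "x \<noteq> 0"
      using nonzero_far_sequence[OF ex] by blast
    have "lp_norm p z \<le> 1 * lp_norm p z" for z :: "('n, 'x) seq" by simp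
    then obtain f where f: "f \<in> dual p" "f x = complex_of_real (lp_norm p x)"
      using dominated_functional[OF lp_add(2) lp_cscale(2) _ x(1)] by blast
    define g where "g = f \<circ> Q_op p m"
    have g: "g \<in> ?E m" unfolding memE g_def using f(1) by blast
    have "cmod (g x) = lp_norm p x" using f(2) Q_supported[OF x(1,2)] lp_norm_nonneg[OF x(1)] by (simp add: g_def)
    then have "dual_norm p g \<noteq> 0" using dual_bound[OF Ed[OF g] x(1)] normalise(1)[OF x(1,3)] by auto
    then have pos: "dual_norm p g > 0" using dual_norm_nonneg[OF Ed[OF g]] by simp
    have "dual_norm p (\<lambda>x. complex_of_real (inverse (dual_norm p g)) * g x) = 1"
      unfolding dual_sc_norm(2)[OF Ed[OF g]] using pos by (simp add: norm_inverse)
    then show ?thesis using scE[OF g] by blast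
  qed
  have "0 \<le> dual_norm p (adjoint_op A g) \<and> dual_norm p (adjoint_op A g) \<le> op_norm p A"
    if "g \<in> ?E m" "dual_norm p g = 1" for m g
    using dual_comp[OF Ed[OF that(1)] A] dual_norm_nonneg[OF dual_comp(1)[OF Ed[OF that(1)] A]] that(2)
    by (simp add: adjoint_op_def)
  then have bd: "\<forall>m. \<forall>g\<in>?E m. dual_norm p g = 1 \<longrightarrow>
      0 \<le> dual_norm p (adjoint_op A g) \<and> dual_norm p (adjoint_op A g) \<le> op_norm p A" by blast
  note L = lower_norm_limit[where E = ?E and nE = "dual_norm p" and nF = "dual_norm p" and T = "adjoint_op A"
      and C = "op_norm p A", OF dec ne bd, folded mu_tilde_dual_def]
  show "0 \<le> mu_tilde_dual p A" by (rule L(1))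
  show "\<exists>m. \<forall>n\<ge>m. \<forall>f\<in>dual p. d * dual_norm p (f \<circ> Q_op p n) \<le> dual_norm p (f \<circ> Q_op p n \<circ> A)"
    if d: "d < mu_tilde_dual p A"
  proof -
    obtain m where m: "\<And>n g. n \<ge> m \<Longrightarrow> g \<in> ?E n \<Longrightarrow> dual_norm p g = 1 \<Longrightarrow> d \<le> dual_norm p (g \<circ> A)"
      using L(2)[OF d] unfolding adjoint_op_def[of A] by blast
    have "d * dual_norm p (f \<circ> Q_op p n) \<le> dual_norm p (f \<circ> Q_op p n \<circ> A)" if n: "n \<ge> m" and f: "f \<in> dual p" for n f
    proof -
      define g where "g = f \<circ> Q_op p n"
      have g: "g \<in> ?E n" unfolding memE g_def using f by blast
      have gA: "g \<circ> A \<in> dual p" using dual_comp(1)[OF Ed[OF g] A] .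
      have "d * dual_norm p g \<le> dual_norm p (g \<circ> A)"
      proof (cases "dual_norm p g = 0")
        case True
        then show ?thesis using dual_norm_nonneg[OF gA] by simp
      next
        case False
        then have pos: "dual_norm p g > 0" using dual_norm_nonneg[OF Ed[OF g]] by simp
        define c where "c = complex_of_real (inverse (dual_norm p g))"
        have cn: "cmod c = inverse (dual_norm p g)" using pos by (simp add: c_def norm_inverse)
        have "dual_norm p (\<lambda>x. c * g x) = 1" unfolding dual_sc_norm(2)[OF Ed[OF g]] cn using pos by simp
        then have "d \<le> dual_norm p ((\<lambda>x. c * g x) \<circ> A)" using m[OF n scE[OF g]] by blast
        also have "(\<lambda>x. c * g x) \<circ> A = (\<lambda>x. c * (g \<circ> A) x)" by (simp add: fun_eq_iff)
        finally have "d \<le> inverse (dual_norm p g) * dual_norm p (g \<circ> A)"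
          unfolding dual_sc_norm(2)[OF gA] cn .
        then show ?thesis using pos by (simp add: field_simps)
      qed
      then show ?thesis unfolding g_def .
    qed
    then show ?thesis by blast
  qed
  show "1 \<le> mu_tilde_dual p A * op_norm p B" if B: "B \<in> bounded_ops p" and K: "(A \<circ> B) - id_op p \<in> K_ops p"
  proof (rule L(3)[OF op_norm_nonneg[OF B]])
    fix \<epsilon> :: real assume e: "\<epsilon> > 0"
    let ?K = "(A \<circ> B) - id_op p"
    obtain m :: nat where m: "\<forall>x\<in>lp p. lp_norm p (cutoff (- cube 0 (int m)) (?K x)) \<le> \<epsilon> * lp_norm p x"
      using K e unfolding K_iff left_tail_null_def by blast
    have "1 - \<epsilon> \<le> op_norm p B * dual_norm p (adjoint_op A g)" if g: "g \<in> ?E m" "dual_norm p g = 1" for g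
    proof -
      note gd = Ed[OF g(1)]
      note gA = dual_comp(1)[OF gd A]
      obtain f where f: "f \<in> dual p" "g = f \<circ> Q_op p m" using g(1) unfolding memE by blast
      have gQ: "g (Q_op p m x) = g x" for x using fun_cong[OF Q_op_comp[of m m], of x] unfolding f(2) by simp
      have "cmod (g x) \<le> (op_norm p B * dual_norm p (g \<circ> A) + \<epsilon>) * lp_norm p x" if x: "x \<in> lp p" for x
      proof -
        have Kx: "?K x \<in> lp p" using bop_in[OF K_bop[OF K]] .
        have "x + ?K x = A (B x)" using x by (simp add: id_apply)
        then have "g (A (B x)) = g x + g (?K x)" using dual_add[OF gd x Kx] by simp
        then have "cmod (g x) \<le> cmod (g (A (B x))) + cmod (g (?K x))"
          using norm_triangle_ineq4[of "g (A (B x))" "g (?K x)"] by simp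
        moreover have "cmod (g (?K x)) \<le> \<epsilon> * lp_norm p x"
        proof -
          have "cmod (g (?K x)) = cmod (g (Q_op p m (?K x)))" unfolding gQ ..
          also have "\<dots> \<le> dual_norm p g * lp_norm p (Q_op p m (?K x))" by (rule dual_bound[OF gd bop_in[OF Q_bop]])
          also have "\<dots> \<le> \<epsilon> * lp_norm p x" unfolding g(2) Q_apply[OF Kx] using m x by simp
          finally show ?thesis .
        qed
        moreover have "cmod (g (A (B x))) \<le> op_norm p B * dual_norm p (g \<circ> A) * lp_norm p x"
        proof -
          have "cmod ((g \<circ> A) (B x)) \<le> dual_norm p (g \<circ> A) * lp_norm p (B x)" by (rule dual_bound[OF gA bop_in[OF B]])
          also have "\<dots> \<le> dual_norm p (g \<circ> A) * (op_norm p B * lp_norm p x)"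
            by (rule mult_left_mono[OF op_bound[OF B x] dual_norm_nonneg[OF gA]])
          finally show ?thesis by (simp add: mult_ac)
        qed
        ultimately show ?thesis by (simp add: distrib_right)
      qed
      then have "dual_norm p g \<le> op_norm p B * dual_norm p (g \<circ> A) + \<epsilon>"
        using e op_norm_nonneg[OF B] dual_norm_nonneg[OF gA] by (intro dual_norm_le) auto
      then show ?thesis unfolding g(2) adjoint_op_def by simp
    qed
    then show "\<exists>m. \<forall>g\<in>?E m. dual_norm p g = 1 \<longrightarrow> 1 - \<epsilon> \<le> op_norm p B * dual_norm p (adjoint_op A g)" by blast
  qed
qed

text \<open>
  Half of \<open>\<mu>(A)\<close> is a lower bound for \<open>A\<close> and for its adjoint on a common far region; the second becomes
  approximate solvability there, and the parametrix construction applies.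
\<close>

lemma invertible_if_mu_pos:
  fixes A :: "('n::finite, 'x::complex_banach) seq_op"
  assumes ex: "\<exists>v::'x. v \<noteq> 0" and A: "A \<in> rich_band_dominated p" and pos: "mu p A > 0"
  obtains B where "B \<in> L_ops p" "(A \<circ> B) - id_op p \<in> K_ops p" "(B \<circ> A) - id_op p \<in> K_ops p"
proof -
  have bd: "A \<in> band_dominated p" and rich: "rich p A" using A unfolding rich_band_dominated_def by auto
  have Ab: "A \<in> bounded_ops p" using L_bop[OF band_dominated_L[OF bd]] .
  define \<delta> where "\<delta> = mu p A / 2"
  have \<delta>: "\<delta> > 0" "\<delta> < mu_tilde p A" "\<delta> < mu_tilde_dual p A" using pos unfolding \<delta>_def mu_def by auto
  obtain m1 where m1: "\<forall>n\<ge>m1. \<forall>x\<in>lp p. supported (- cube 0 (int n)) x \<longrightarrow> \<delta> * lp_norm p x \<le> lp_norm p (A x)"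
    using mu_tilde_properties(2)[OF Ab ex \<delta>(2)] by blast
  obtain m2 where m2: "\<forall>n\<ge>m2. \<forall>f\<in>dual p. \<delta> * dual_norm p (f \<circ> Q_op p n) \<le> dual_norm p (f \<circ> Q_op p n \<circ> A)"
    using mu_tilde_dual_properties(2)[OF Ab ex \<delta>(3)] by blast
  define m where "m = max m1 m2"
  have m: "m1 \<le> m" "m2 \<le> m" by (simp_all add: m_def)
  interpret far_bounded p A \<delta> m
  proof
    show "A \<in> bounded_ops p" by (rule Ab)
    show "nearly_local A" by (rule band_dominated_nearly_local[OF bd])
    show "\<delta> > 0" by (rule \<delta>(1))
    show "\<delta> * lp_norm p x \<le> lp_norm p (A x)" if "x \<in> lp p" "supported (- cube 0 (int m)) x" for x
      using m1 m(1) that by blast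
    show "\<exists>x\<in>lp p. lp_norm p (y - cutoff (- cube 0 (int m)) (A x)) \<le> r * lp_norm p y \<and> lp_norm p x \<le> 2 / \<delta> * lp_norm p y"
      if y: "y \<in> lp p" "supported (- cube 0 (int m)) y" and r: "r > 0" for y r
    proof -
      have low: "\<delta> * dual_norm p (f \<circ> Q_op p m) \<le> dual_norm p (f \<circ> Q_op p m \<circ> A)" if "f \<in> dual p" for f
        using m2 m(2) that by blast
      obtain x where x: "x \<in> lp p" "lp_norm p (y - Q_op p m (A x)) \<le> r * lp_norm p y"
        "lp_norm p x \<le> 2 / \<delta> * lp_norm p y"
        using approximately_onto[OF Ab Q_bop \<delta>(1) low y(1) Q_supported[OF y] r] by blast
      then show ?thesis unfolding Q_apply[OF bop_in[OF Ab]] by blast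
    qed
  qed
  show ?thesis using parametrix[OF bd rich] that by blast
qed

text \<open>
  \<open>B Q\<^sub>n\<close> represents the same class as \<open>B\<close>. For \<open>z = Q\<^sub>n x\<close> the vector \<open>A B z\<close> is close to \<open>z\<close> and \<open>P\<^sub>m B z\<close> is
  small, so the lower bound of \<open>A\<close>, applied to \<open>Q\<^sub>m B z\<close>, gives \<open>\<delta> \<parallel>B z\<parallel> \<le> (1 + e) \<parallel>x\<parallel>\<close>.
\<close>

lemma quot_norm_le:
  fixes A :: "('n::finite, 'x::complex_banach) seq_op"
  assumes A: "A \<in> bounded_ops p" and B: "B \<in> L_ops p" and K: "(A \<circ> B) - id_op p \<in> K_ops p"
    and \<delta>: "\<delta> > 0" and low: "\<And>x. x \<in> lp p \<Longrightarrow> supported (- cube 0 (int m)) x \<Longrightarrow> \<delta> * lp_norm p x \<le> lp_norm p (A x)"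
  shows "\<delta> * quot_norm p (LK_coset p B) \<le> 1"
proof (rule field_le_epsilon)
  fix e :: real assume e: "e > 0"
  let ?K = "(A \<circ> B) - id_op p"
  have Bb: "B \<in> bounded_ops p" by (rule L_bop[OF B])
  define a where "a = 1 + op_norm p A + \<delta>"
  have a: "a > 0" using op_norm_nonneg[OF A] \<delta> by (simp add: a_def)
  define \<epsilon> where "\<epsilon> = e / a"
  have \<epsilon>: "\<epsilon> > 0" "\<epsilon> * a = e" using e a by (auto simp: \<epsilon>_def)
  have b1: "?K \<in> bounded_ops p" "right_tail_null ?K" and b2: "P_op p m \<circ> B \<in> bounded_ops p" "right_tail_null (P_op p m \<circ> B)"
    using K K_L[OF B P_K] unfolding K_iff by auto
  obtain n1 where n1: "\<And>n x. n \<ge> n1 \<Longrightarrow> x \<in> lp p \<Longrightarrow> lp_norm p (?K (cutoff (- cube 0 (int n)) x)) \<le> \<epsilon> * lp_norm p x"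
    using right_tail_null_eventually[OF b1 \<epsilon>(1)] by metis
  obtain n2 where n2: "\<And>n x. n \<ge> n2 \<Longrightarrow> x \<in> lp p \<Longrightarrow>
      lp_norm p ((P_op p m \<circ> B) (cutoff (- cube 0 (int n)) x)) \<le> \<epsilon> * lp_norm p x"
    using right_tail_null_eventually[OF b2 \<epsilon>(1)] by metis
  define n where "n = max n1 n2"
  have "lp_norm p ((B \<circ> Q_op p n) x) \<le> (1 + e) / \<delta> * lp_norm p x" if x: "x \<in> lp p" for x
  proof -
    let ?z = "cutoff (- cube 0 (int n)) x"
    have z: "?z \<in> lp p" "lp_norm p ?z \<le> lp_norm p x" using lp_cutoff[OF x] by auto
    have Bz: "B ?z \<in> lp p" using bop_in[OF Bb] .
    let ?u = "cutoff (cube 0 (int m)) (B ?z)" and ?v = "cutoff (- cube 0 (int m)) (B ?z)"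
    have uv: "?u \<in> lp p" "?v \<in> lp p" using lp_cutoff(1)[OF Bz] by auto
    have Buv: "B ?z = ?u + ?v" "?v = B ?z - ?u" by (auto simp: fun_eq_iff cutoff_apply)
    have u: "lp_norm p ?u \<le> \<epsilon> * lp_norm p x"
    proof -
      have "(P_op p m \<circ> B) ?z = ?u" using P_apply[OF Bz] by simp
      then show ?thesis using n2[of n x] x unfolding n_def by (metis max.cobounded2)
    qed
    have Kz: "lp_norm p (?K ?z) \<le> \<epsilon> * lp_norm p x" using n1[of n x] x unfolding n_def by (metis max.cobounded1)
    have ABz: "A (B ?z) = ?z + ?K ?z" using z by (simp add: id_apply)
    have 1: "lp_norm p (A (B ?z)) \<le> lp_norm p x + \<epsilon> * lp_norm p x"
      unfolding ABz using lp_add(2)[OF z(1) bop_in[OF b1(1)]] z(2) Kz by (meson add_mono order_trans)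
    have 2: "\<delta> * lp_norm p ?v \<le> lp_norm p (A ?v)" by (rule low[OF uv(2) supported_cutoff])
    have Av: "A ?v = A (B ?z) - A ?u" using bop_diff[OF A Bz uv(1)] Buv(2) by simp
    have 3: "lp_norm p (A ?v) \<le> lp_norm p (A (B ?z)) + lp_norm p (A ?u)"
      unfolding Av by (rule lp_diff(2)[OF bop_in[OF A] bop_in[OF A]])
    have 4: "lp_norm p (A ?u) \<le> op_norm p A * (\<epsilon> * lp_norm p x)"
      using op_bound[OF A uv(1)] mult_left_mono[OF u op_norm_nonneg[OF A]] by linarith
    have 5: "lp_norm p (B ?z) \<le> lp_norm p ?u + lp_norm p ?v"
      using lp_add(2)[OF uv] unfolding Buv(1)[symmetric] .
    have 6: "\<delta> * lp_norm p (B ?z) \<le> \<delta> * lp_norm p ?u + \<delta> * lp_norm p ?v"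
      using mult_left_mono[OF 5, of \<delta>] \<delta> by (simp add: distrib_left)
    have 7: "\<delta> * lp_norm p ?u \<le> \<delta> * (\<epsilon> * lp_norm p x)" using u \<delta> by (intro mult_left_mono) auto
    have "\<delta> * lp_norm p (B ?z) \<le> lp_norm p x + \<epsilon> * lp_norm p x + op_norm p A * (\<epsilon> * lp_norm p x) + \<delta> * (\<epsilon> * lp_norm p x)"
      using 1 2 3 4 6 7 by linarith
    also have "\<dots> = (1 + \<epsilon> * a) * lp_norm p x" by (simp add: a_def algebra_simps)
    finally have "\<delta> * lp_norm p (B ?z) \<le> (1 + e) * lp_norm p x" unfolding \<epsilon>(2) .
    then have "lp_norm p (B ?z) \<le> (1 + e) / \<delta> * lp_norm p x" using \<delta> by (simp add: field_simps)
    then show ?thesis by (simp add: Q_apply x)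
  qed
  then have le: "op_norm p (B \<circ> Q_op p n) \<le> (1 + e) / \<delta>" using e \<delta> by (intro op_norm_le) auto
  have "(B \<circ> Q_op p n) - B = - (B \<circ> P_op p n)"
    unfolding Q_op_def comp_diff_right[OF Bb id_bop P_bop] comp_id[OF Bb] by simp
  then have "B \<circ> Q_op p n \<in> LK_coset p B" unfolding mem_LK_coset using K_uminus[OF L_K[OF B P_K]] by simp
  moreover have "bdd_below (op_norm p ` LK_coset p B)"
  proof (rule bdd_belowI2[where m = 0])
    fix C assume "C \<in> LK_coset p B"
    then have "(C - B) + B \<in> bounded_ops p" unfolding mem_LK_coset by (intro bop_plus(1) K_bop Bb)
    then show "0 \<le> op_norm p C" using op_norm_nonneg by simp
  qed
  ultimately have "quot_norm p (LK_coset p B) \<le> op_norm p (B \<circ> Q_op p n)"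
    unfolding quot_norm_def by (intro cINF_lower)
  then have "quot_norm p (LK_coset p B) \<le> (1 + e) / \<delta>" using le by linarith
  then show "\<delta> * quot_norm p (LK_coset p B) \<le> 1 + e" using \<delta> by (simp add: field_simps)
qed

lemma parametrix_coset:
  assumes A: "A \<in> L_ops p" and B: "B \<in> L_ops p" "(A \<circ> B) - id_op p \<in> K_ops p" "(B \<circ> A) - id_op p \<in> K_ops p"
    and C: "C \<in> LK_coset p B"
  shows "C \<in> bounded_ops p" "(A \<circ> C) - id_op p \<in> K_ops p" "(C \<circ> A) - id_op p \<in> K_ops p"
proof -
  have CB: "C - B \<in> K_ops p" using C mem_LK_coset by blast
  have "(C - B) + B \<in> bounded_ops p" by (rule bop_plus(1)[OF K_bop[OF CB] L_bop[OF B(1)]])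
  then show "C \<in> bounded_ops p" by simp
  then have "A \<circ> (C - B) = (A \<circ> C) - (A \<circ> B)" by (rule comp_diff_right[OF L_bop[OF A] _ L_bop[OF B(1)]])
  then have eq: "(A \<circ> C) - id_op p = (A \<circ> (C - B)) + ((A \<circ> B) - id_op p)" by simp
  show "(A \<circ> C) - id_op p \<in> K_ops p" unfolding eq by (rule K_add[OF L_K[OF A CB] B(2)])
  have "(C - B) \<circ> A = (C \<circ> A) - (B \<circ> A)" by (rule comp_diff_left)
  then have eq': "(C \<circ> A) - id_op p = ((C - B) \<circ> A) + ((B \<circ> A) - id_op p)" by simp
  show "(C \<circ> A) - id_op p \<in> K_ops p" unfolding eq' by (rule K_add[OF K_L[OF A CB] B(3)])
qed

end

theorem theorem5p3:
  fixes p :: ennreal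
    and A :: "('n::finite, 'x::complex_banach) seq_op"
  assumes "p = 0 \<or> 1 \<le> p"
    and "\<exists>x::'x. x \<noteq> 0"
    and "A \<in> rich_band_dominated p"
  shows "inv_norm_recip p (LK_coset p A) = mu p A"
proof -
  interpret lp_exponent p by standard (rule assms(1))
  have AL: "A \<in> L_ops p" using assms(3) band_dominated_L unfolding rich_band_dominated_def by blast
  have Ab: "A \<in> bounded_ops p" by (rule L_bop[OF AL])
  note m1 = mu_tilde_properties[OF Ab assms(2)] and m2 = mu_tilde_dual_properties[OF Ab assms(2)]
  show ?thesis
  proof (cases "LK_coset p A \<in> Units (LK_quot p)")
    case False
    have "\<not> mu p A > 0"
    proof
      assume "mu p A > 0"
      then obtain B where "B \<in> L_ops p" "(A \<circ> B) - id_op p \<in> K_ops p" "(B \<circ> A) - id_op p \<in> K_ops p"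
        using invertible_if_mu_pos[OF assms(2,3)] by blast
      then show False using False LK_coset_inverse(1)[OF AL] by blast
    qed
    moreover have "mu p A \<ge> 0" using m1(1) m2(1) by (simp add: mu_def)
    ultimately show ?thesis using False by (simp add: inv_norm_recip_def)
  next
    case True
    then obtain B where B: "B \<in> L_ops p" "(A \<circ> B) - id_op p \<in> K_ops p" "(B \<circ> A) - id_op p \<in> K_ops p"
      using LK_coset_inverse(1)[OF AL] by blast
    define q where "q = quot_norm p (LK_coset p B)"
    have recip: "inv_norm_recip p (LK_coset p A) = inverse q"
      using True LK_coset_inverse(2)[OF AL B] by (simp add: inv_norm_recip_def q_def)
    have ge: "1 \<le> mu p A * op_norm p C" if "C \<in> LK_coset p B" for C
      using m1(3) m2(3) parametrix_coset[OF AL B that] unfolding mu_def by (simp add: min_def)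
    have BB: "B \<in> LK_coset p B" unfolding mem_LK_coset using K_diff[OF P_K P_K, of 0 0] by simp
    have pos: "mu p A > 0"
    proof (rule ccontr)
      assume "\<not> mu p A > 0"
      then have "mu p A * op_norm p B \<le> 0" using op_norm_nonneg[OF L_bop[OF B(1)]] by (simp add: mult_le_0_iff)
      then show False using ge[OF BB] by simp
    qed
    have "inverse (mu p A) \<le> q" unfolding q_def quot_norm_def
      using ge pos BB by (intro cINF_greatest) (auto simp: field_simps)
    moreover have "mu p A * q \<le> 1"
    proof (rule ccontr)
      assume "\<not> mu p A * q \<le> 1"
      moreover have q: "q > 0" using \<open>inverse (mu p A) \<le> q\<close> pos by (meson less_le_trans positive_imp_inverse_positive)
      ultimately have "1 / q < mu p A" by (simp add: field_simps)
      then obtain \<delta> where \<delta>: "1 / q < \<delta>" "\<delta> < mu p A" using dense by blast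
      have \<delta>0: "\<delta> > 0" using \<delta>(1) q by (meson less_trans zero_less_divide_1_iff)
      obtain m where "\<forall>x\<in>lp p. supported (- cube 0 (int m)) x \<longrightarrow> \<delta> * lp_norm p x \<le> lp_norm p (A x)"
        using m1(2)[of \<delta>] \<delta>(2) by (auto simp: mu_def)
      then have "\<delta> * q \<le> 1" unfolding q_def by (intro quot_norm_le[OF Ab B(1,2) \<delta>0]) auto
      then show False using \<delta>(1) q by (simp add: field_simps)
    qed
    ultimately have "mu p A * q = 1" using pos by (simp add: field_simps)
    then show ?thesis unfolding recip by (metis inverse_unique mult.commute)
  qed
qed

end
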